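(* Consider the learning problem $F_\lambda=(\mathcal X_\lambda,\mathcal Y_\lambda,\mathcal D_\lambda,\mathcal H_\lambda)$ defined in the context, with adversarial budget $(1-R)n/2$ in Hamming distance over $\mathbb F_{2^\ell}$. Then: (1) There is a (computationally unbounded) learner that outputs models with at most $2\lambda$ bits of parameters and that $\varepsilon$-learns, and moreover $\varepsilon$-robustly learns against all adversaries of budget $(1-R)n/2$, the problem $F_\lambda$ with sample complexity $\Theta(\lambda/\varepsilon)$. (2) There is a polynomial-time learner that outputs models with at most $\alpha+\beta$ bits of parameters and that $\varepsilon$-learns, and moreover $\varepsilon$-robustly learns against all adversaries of budget $(1-R)n/2$, the problem $F_\lambda$ with sample complexity $\Theta((\alpha+\beta)/\varepsilon)$. Here "with sample complexity $\Theta(T/\varepsilon)$" means that for a sample size $N=\Theta(T/\varepsilon)$ the expected (robust) risk is at most $\varepsilon$ for every $D\in\mathcal D_\lambda$ and $h\in\mathcal H_\lambda$.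
   Context: **Learning.** A learning problem is a family $F_\lambda=(\mathcal X_\lambda,\mathcal Y_\lambda,\mathcal D_\lambda,\mathcal H_\lambda)$, $\lambda\in\mathbb N$, where $\mathcal H_\lambda$ is a set of functions $\mathcal X_\lambda\to\mathcal Y_\lambda$ and $\mathcal D_\lambda$ is a set of distributions on $\mathcal X_\lambda$. A learner $L$ is a (possibly randomized) algorithm that receives a labeled sample $\mathcal S^h=\{(x,h(x)):x\in\mathcal S\}$ and $\lambda$ and outputs a function $f:\mathcal X_\lambda\to\mathcal Y_\lambda$ (not necessarily in $\mathcal H_\lambda$). Let $\mathrm{Risk}(h,D,f)=\Pr_{x\leftarrow D}[h(x)\ne f(x)]$ and, for a metric $d$ and budget $r$, $\mathrm{Risk}_{d,r}(h,D,f)=\Pr_{x\leftarrow D}[\exists x':\ d(x,x')\le r \text{ and } f(x')\neq h(x)]$. With sample size $N$, $L$ $\varepsilon$-learns $F_\lambda$ if for all $D\in\mathcal D_\lambda$, $h\in\mathcal H_\lambda$: $\mathbf E_{\mathcal S\leftarrow D^N,\,f\leftarrow L(\mathcal S^h,\lambda)}[\mathrm{Risk}(h,D,f)]\le\varepsilon$; it $\varepsilon$-robustly learns against all adversaries of budget $r$ if the same holds with $\mathrm{Risk}_{d,r}$. $L$ outputs models with at most $p(\lambda)$ bits of parameters if the set of all possible outputs of $L(\cdot,\lambda)$ (over all inputs and all randomness) has size at most $2^{p(\lambda)}$. $L$ runs in polynomial time if the running time of $L(\mathcal S,\lambda)$ is bounded by a polynomial in $|\mathcal S|\cdot\lambda$.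 **Building blocks.** $n<\lambda<\alpha<\beta$ are polynomially related functions of $\lambda$ (e.g. $n=\lambda^{0.1}$, $\alpha=\lambda^5$, $\beta=\lambda^{10}$). - A pseudorandom generator (PRG) is a polynomial-time computable $f:\{0,1\}^\lambda\to\{0,1\}^{a}$, $a>\lambda$, such that for every probabilistic polynomial-time $A$, $|\Pr_{x\leftarrow\{0,1\}^\lambda}[A(f(x))=1]-\Pr_{y\leftarrow\{0,1\}^{a}}[A(y)=1]|$ is negligible in $\lambda$. Let $f_1:\{0,1\}^\lambda\to\{0,1\}^\alpha$ and $f_2:\{0,1\}^\lambda\to\{0,1\}^\beta$ be PRGs. - $\ell=\Theta(\log\lambda)$ and $\mathrm{Enc}:\mathbb F_{2^\ell}^k\to\mathbb F_{2^\ell}^n$ is the Reed–Solomon encoding (the message gives the coefficients of a polynomial of degree $\le k-1$, which is evaluated at $n$ fixed distinct field elements), with rate $R=k/n$ a constant $<1/3$. - A sampler with parameters $\kappa_1,\kappa_2\in(0,1)$, source length $M$ and output size $t$ is a deterministic polynomial-time map $\mathsf{samp}:\{0,1\}^r\to\binom{\{1,\dots,M\}}{t}$ (subsets of size $t$), $r=\Theta(M^{\kappa_2})$, such that for every random variable $X$ on $\{0,1\}^M$ with min-entropy $\ge\mu M$ there is a random variable $Y$ on $\{0,1\}^t$, jointly distributed with $U_r$ (uniform on $\{0,1\}^r$), such that $Y$ conditioned on each value of $U_r$ has min-entropy $\ge(\mu-\kappa_1)t$, and the statistical distance between $(U_r,X|_{\mathsf{samp}(U_r)})$ and $(U_r,Y)$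 is at most $\exp(-\Theta(M\kappa_1))+\exp(-M^{\kappa_2})$. Here $x|_{\mathcal S}$ is the restriction of $x$ to the coordinates in $\mathcal S$. Let $\mathsf{samp}_1:\{0,1\}^{r_1}\to\binom{\{1,\dots,\alpha\}}{k\ell}$ and $\mathsf{samp}_2:\{0,1\}^{r_2}\to\binom{\{1,\dots,\beta\}}{n\ell}$ be samplers with sufficiently small $\kappa_1=\Theta(1/\log\lambda)$ and sufficiently small constant $\kappa_2>0$. - For a binary string $v$, $[v]$ is an (efficiently encodable and decodable) error-correcting encoding of $v$ over $\mathbb F_{2^\ell}$ that can correct more than $(1-R)n/2$ symbol errors. **The learning problem.** $\mathcal Y_\lambda=\{0,1\}$. $\mathcal D_\lambda=\{D_s: s\in\{0,1\}^\lambda\}$, where $D_s$ is the distribution of $$x=\big([u_1],\,[u_2],\,m,\,\mathrm{Enc}(m)+f_2(s)|_{\mathsf{samp}_2(u_2)}\big)$$ with $u_1\leftarrow\{0,1\}^{r_1}$, $u_2\leftarrow\{0,1\}^{r_2}$, $m\leftarrow\mathbb F_{2^\ell}^k$ independent and uniform; the $n\ell$-bit string $f_2(s)|_{\mathsf{samp}_2(u_2)}$ is read as a vector in $\mathbb F_{2^\ell}^n$ and added coordinate-wise. $\mathcal X_\lambda$ is the corresponding set of vectors over $\mathbb F_{2^\ell}$. $\mathcal H_\lambda=\{h_s:s\in\{0,1\}^\lambda\}$ with $h_s(x)=\langle m,\,f_1(s)|_{\mathsf{samp}_1(u_1)}\rangle$, the inner product over $\mathbb F_2$ with $m$ read as an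 element of $\mathbb F_2^{k\ell}$. (The seeds indexing the distribution and the hypothesis are independent of one another.) The metric $d$ is Hamming distance, counting symbols of $\mathbb F_{2^\ell}$ in the entire vector $x$. *)

theory Defs
  imports
    "HOL-Probability.Probability"
    "HOL-Computational_Algebra.Polynomial"
    "HOL-Library.Landau_Symbols"
    "HOL-Algebra.Ring"
begin

section \<open>Polynomial-time computation\<close>

text \<open>
  The machine model is Jones' WHILE language over binary trees. An assignment is charged the size
  of the tree that it stores, so the size of a computed value never exceeds the time spent on
  computing it (plus the size of the input), and running times agree with those of Turing machines
  up to a polynomial.
\<close>

datatype bintree = Atom | Cell bintree bintree

primrec tsize :: "bintree \<Rightarrow> nat" where
  "tsize Atom = 1"
| "tsize (Cell a b) = 1 + tsize a + tsize b"

datatype expr = Var nat | EAtom | ECell expr expr | Fst expr | Snd expr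

type_synonym store = "nat \<Rightarrow> bintree"

fun left :: "bintree \<Rightarrow> bintree" where
  "left Atom = Atom"
| "left (Cell a b) = a"

fun right :: "bintree \<Rightarrow> bintree" where
  "right Atom = Atom"
| "right (Cell a b) = b"

primrec evalx :: "expr \<Rightarrow> store \<Rightarrow> bintree" where
  "evalx (Var i) s = s i"
| "evalx EAtom s = Atom"
| "evalx (ECell e1 e2) s = Cell (evalx e1 s) (evalx e2 s)"
| "evalx (Fst e) s = left (evalx e s)"
| "evalx (Snd e) s = right (evalx e s)"

datatype prog = Skip | Assign nat expr | Seq prog prog | Cond expr prog prog | Loop expr prog

text \<open>\<open>exec c s t s'\<close>: started in store \<open>s\<close>, \<open>c\<close> halts in store \<open>s'\<close> after time \<open>t\<close>. The tree
  \<open>Atom\<close> counts as false, every other tree as true.\<close>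

inductive exec :: "prog \<Rightarrow> store \<Rightarrow> nat \<Rightarrow> store \<Rightarrow> bool" where
  exec_Skip: "exec Skip s 1 s"
| exec_Assign: "exec (Assign i e) s (1 + tsize (evalx e s)) (s(i := evalx e s))"
| exec_Seq: "exec c1 s t1 s' \<Longrightarrow> exec c2 s' t2 s'' \<Longrightarrow> exec (Seq c1 c2) s (t1 + t2) s''"
| exec_CondT: "evalx e s \<noteq> Atom \<Longrightarrow> exec c1 s t s' \<Longrightarrow> exec (Cond e c1 c2) s (1 + t) s'"
| exec_CondF: "evalx e s = Atom \<Longrightarrow> exec c2 s t s' \<Longrightarrow> exec (Cond e c1 c2) s (1 + t) s'"
| exec_LoopF: "evalx e s = Atom \<Longrightarrow> exec (Loop e c) s 1 s"
| exec_LoopT: "evalx e s \<noteq> Atom \<Longrightarrow> exec c s t1 s' \<Longrightarrow> exec (Loop e c) s' t2 s''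
    \<Longrightarrow> exec (Loop e c) s (1 + t1 + t2) s''"

definition runs :: "prog \<Rightarrow> bintree \<Rightarrow> nat \<Rightarrow> bintree \<Rightarrow> bool" where
  "runs c a t b \<longleftrightarrow> (\<exists>s. exec c ((\<lambda>_. Atom)(0 := a)) t s \<and> s 0 = b)"

class encodable =
  fixes encode :: "'a \<Rightarrow> bintree"
  assumes encode_inject: "encode x = encode y \<Longrightarrow> x = y"

instantiation bintree :: encodable
begin
definition encode_bintree :: "bintree \<Rightarrow> bintree" where "encode_bintree a = a"
instance by standard (simp add: encode_bintree_def)
end

instantiation bool :: encodable
begin
definition encode_bool :: "bool \<Rightarrow> bintree" where
  "encode_bool b = (if b then Cell Atom Atom else Atom)"
instance by standard (simp add: encode_bool_def split: if_splits)
end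

text \<open>Natural numbers are encoded in unary, so a security parameter \<open>x\<close> is passed as \<open>1^x\<close>.\<close>

instantiation nat :: encodable
begin
primrec encode_nat :: "nat \<Rightarrow> bintree" where
  "encode_nat 0 = Atom"
| "encode_nat (Suc x) = Cell Atom (encode_nat x)"
instance
proof
  fix x y :: nat
  show "encode x = encode y \<Longrightarrow> x = y"
    by (induction x arbitrary: y) (case_tac y; simp)+
qed
end

instantiation prod :: (encodable, encodable) encodable
begin
definition encode_prod :: "'a \<times> 'b \<Rightarrow> bintree" where
  "encode_prod p = Cell (encode (fst p)) (encode (snd p))"
instance by standard (auto simp: encode_prod_def prod_eq_iff dest: encode_inject)
end

instantiation list :: (encodable) encodable
begin
primrec encode_list :: "'a list \<Rightarrow> bintree" where
  "encode_list [] = Atom"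
| "encode_list (x # xs) = Cell (encode x) (encode_list xs)"
instance
proof
  fix xs ys :: "'a list"
  show "encode xs = encode ys \<Longrightarrow> xs = ys"
    by (induction xs arbitrary: ys) (case_tac ys; auto dest: encode_inject)+
qed
end

definition polytime_on :: "'a::encodable set \<Rightarrow> ('a \<Rightarrow> 'b::encodable) \<Rightarrow> bool" where
  "polytime_on A f \<longleftrightarrow> (\<exists>(c::prog) (p::nat poly). \<forall>a\<in>A.
     \<exists>t \<le> poly p (tsize (encode a)). runs c (encode a) t (encode (f a)))"

section \<open>Words\<close>

definition words :: "'a set \<Rightarrow> nat \<Rightarrow> 'a list set" where
  "words A m = {w. set w \<subseteq> A \<and> length w = m}"

definition bits :: "nat \<Rightarrow> bool list set" where
  "bits m = words UNIV m"

definition unif :: "nat \<Rightarrow> bool list pmf" where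
  "unif m = pmf_of_set (bits m)"

text \<open>Only meant for words of equal length.\<close>

definition hamming :: "'a list \<Rightarrow> 'a list \<Rightarrow> nat" where
  "hamming v w = card {i. i < length v \<and> v ! i \<noteq> w ! i}"

section \<open>Learning\<close>

record ('x, 'y) learning_problem =
  instances :: "'x set"
  labels :: "'y set"
  dists :: "'x pmf set"
  hyps :: "('x \<Rightarrow> 'y) set"

type_synonym ('x, 'y) learner = "('x \<times> 'y) list \<Rightarrow> nat \<Rightarrow> ('x \<Rightarrow> 'y) pmf"

definition risk :: "('x \<Rightarrow> 'y) \<Rightarrow> 'x pmf \<Rightarrow> ('x \<Rightarrow> 'y) \<Rightarrow> real" where
  "risk h D f = measure_pmf.prob D {x. h x \<noteq> f x}"

definition robust_risk ::
  "'x set \<Rightarrow> ('x \<Rightarrow> 'x \<Rightarrow> nat) \<Rightarrow> real \<Rightarrow> ('x \<Rightarrow> 'y) \<Rightarrow> 'x pmf \<Rightarrow> ('x \<Rightarrow> 'y) \<Rightarrow> real" where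
  "robust_risk X d r h D f =
     measure_pmf.prob D {x. \<exists>x'\<in>X. real (d x x') \<le> r \<and> f x' \<noteq> h x}"

definition samples :: "('x, 'y) learning_problem \<Rightarrow> ('x \<times> 'y) list set" where
  "samples P = lists (instances P \<times> labels P)"

text \<open>Functions on \<open>instances\<close> are represented by their extensional versions, so that counting the
  outputs of a learner counts functions on \<open>instances\<close>. All notions are relative to security
  parameters of at least \<open>sec0\<close>.\<close>

definition is_learner ::
  "nat \<Rightarrow> (nat \<Rightarrow> ('x, 'y) learning_problem) \<Rightarrow> ('x, 'y) learner \<Rightarrow> bool" where
  "is_learner sec0 F L \<longleftrightarrow> (\<forall>sec\<ge>sec0. \<forall>S\<in>samples (F sec).
     set_pmf (L S sec) \<subseteq> instances (F sec) \<rightarrow>\<^sub>E labels (F sec))"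

definition trained ::
  "('x, 'y) learner \<Rightarrow> nat \<Rightarrow> nat \<Rightarrow> ('x \<Rightarrow> 'y) \<Rightarrow> 'x pmf \<Rightarrow> ('x \<Rightarrow> 'y) pmf" where
  "trained L sec N h D =
     do {xs \<leftarrow> replicate_pmf N D; L (map (\<lambda>x. (x, h x)) xs) sec}"

definition eps_learns ::
  "('x, 'y) learner \<Rightarrow> ('x, 'y) learning_problem \<Rightarrow> nat \<Rightarrow> nat \<Rightarrow> real \<Rightarrow> bool" where
  "eps_learns L P sec N \<epsilon> \<longleftrightarrow> (\<forall>D\<in>dists P. \<forall>h\<in>hyps P.
     measure_pmf.expectation (trained L sec N h D) (\<lambda>f. risk h D f) \<le> \<epsilon>)"

definition eps_robustly_learns ::
  "('x \<Rightarrow> 'x \<Rightarrow> nat) \<Rightarrow> real \<Rightarrow> ('x, 'y) learner \<Rightarrow> ('x, 'y) learning_problem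
     \<Rightarrow> nat \<Rightarrow> nat \<Rightarrow> real \<Rightarrow> bool" where
  "eps_robustly_learns d r L P sec N \<epsilon> \<longleftrightarrow> (\<forall>D\<in>dists P. \<forall>h\<in>hyps P.
     measure_pmf.expectation (trained L sec N h D)
       (\<lambda>f. robust_risk (instances P) d r h D f) \<le> \<epsilon>)"

definition learns_with_sample_complexity ::
  "nat \<Rightarrow> ('x \<Rightarrow> 'x \<Rightarrow> nat) \<Rightarrow> (nat \<Rightarrow> real) \<Rightarrow> (nat \<Rightarrow> ('x, 'y) learning_problem)
     \<Rightarrow> ('x, 'y) learner \<Rightarrow> (nat \<Rightarrow> real) \<Rightarrow> bool" where
  "learns_with_sample_complexity sec0 d r F L T \<longleftrightarrow>
     (\<exists>c C. \<exists>N :: nat \<Rightarrow> real \<Rightarrow> nat. 0 < c \<and> 0 < C \<and>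
       (\<forall>sec\<ge>sec0. \<forall>\<epsilon>. 0 < \<epsilon> \<and> \<epsilon> < 1 \<longrightarrow>
          c * (T sec / \<epsilon>) \<le> real (N sec \<epsilon>) \<and> real (N sec \<epsilon>) \<le> C * (T sec / \<epsilon>) \<and>
          eps_learns L (F sec) sec (N sec \<epsilon>) \<epsilon> \<and>
          eps_robustly_learns d (r sec) L (F sec) sec (N sec \<epsilon>) \<epsilon>))"

definition outputs_models_with_bits ::
  "nat \<Rightarrow> (nat \<Rightarrow> ('x, 'y) learning_problem) \<Rightarrow> ('x, 'y) learner \<Rightarrow> (nat \<Rightarrow> nat) \<Rightarrow> bool" where
  "outputs_models_with_bits sec0 F L p \<longleftrightarrow> (\<forall>sec\<ge>sec0.
     let out = (\<Union>S\<in>samples (F sec). set_pmf (L S sec)) in finite out \<and> card out \<le> 2 ^ p sec)"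

text \<open>
  A program cannot output a function, so the program \<open>train\<close> maps the security parameter, the
  sample and uniformly random coins to a description of the output function, which the
  fixed program \<open>infer\<close> evaluates at a given point. Both must be polynomial-time: an unrestricted
  evaluator could do the work of the learner. The maximum only matters for the empty sample.
\<close>

definition polytime_learner ::
  "nat \<Rightarrow> (nat \<Rightarrow> ('x::encodable, 'y::encodable) learning_problem) \<Rightarrow> ('x, 'y) learner \<Rightarrow> bool"
  where
  "polytime_learner sec0 F L \<longleftrightarrow>
     (\<exists>(train::prog) (infer::prog) (p::nat poly) (q::nat poly). \<forall>sec\<ge>sec0. \<forall>S\<in>samples (F sec).
        let X = instances (F sec); size = max 1 (length S) * sec; coins = poly q size in
        \<exists>(model :: bool list \<Rightarrow> bintree) (g :: bool list \<Rightarrow> 'x \<Rightarrow> 'y).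
          (\<forall>\<omega>\<in>bits coins.
             (\<exists>t \<le> poly p size. runs train (encode (sec, S, \<omega>)) t (model \<omega>)) \<and>
             (\<forall>x\<in>X. \<exists>t \<le> poly p size. runs infer (encode (sec, model \<omega>, x)) t (encode (g \<omega> x)))) \<and>
          L S sec = map_pmf (\<lambda>\<omega>. restrict (g \<omega>) X) (unif coins))"

section \<open>Pseudorandom generators\<close>

definition negligible :: "(nat \<Rightarrow> real) \<Rightarrow> bool" where
  "negligible \<delta> \<longleftrightarrow> (\<forall>c::nat. \<forall>\<^sub>F x in sequentially. \<bar>\<delta> x\<bar> < 1 / real x ^ c)"

text \<open>Acceptance probability, on an input drawn from \<open>Y\<close>, of the probabilistic algorithm that runs
  \<open>A\<close> with \<open>poly q (length y)\<close> uniform coins on input \<open>y\<close>.\<close>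

definition accept_prob :: "(bool list \<times> bool list \<Rightarrow> bool) \<Rightarrow> nat poly \<Rightarrow> bool list pmf \<Rightarrow> real" where
  "accept_prob A q Y =
     pmf (do {y \<leftarrow> Y; \<omega> \<leftarrow> unif (poly q (length y)); return_pmf (A (y, \<omega>))}) True"

definition prg :: "(bool list \<Rightarrow> bool list) \<Rightarrow> (nat \<Rightarrow> nat) \<Rightarrow> bool" where
  "prg f a \<longleftrightarrow>
     (\<forall>s. length (f s) = a (length s)) \<and> (\<forall>sec. sec < a sec) \<and> polytime_on UNIV f \<and>
     (\<forall>A q. polytime_on UNIV A \<longrightarrow>
        negligible (\<lambda>sec. accept_prob A q (map_pmf f (unif sec)) - accept_prob A q (unif (a sec))))"

section \<open>Samplers\<close>

definition min_entropy :: "'a pmf \<Rightarrow> real" where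
  "min_entropy p = - log 2 (SUP x. pmf p x)"

definition stat_dist :: "'a pmf \<Rightarrow> 'a pmf \<Rightarrow> real" where
  "stat_dist p q = (SUP A. \<bar>measure_pmf.prob p A - measure_pmf.prob q A\<bar>)"

text \<open>
  Coordinates are numbered from \<open>0\<close>, and \<open>nths x A\<close> is the restriction of \<open>x\<close> to the coordinates
  in \<open>A\<close>. The random variable \<open>Y\<close> is given by its conditional distributions \<open>Y u\<close>. The algorithm
  halts in polynomial time also on seeds of wrong length, where its output is not constrained.
\<close>

definition sampler ::
  "nat \<Rightarrow> (nat \<Rightarrow> real) \<Rightarrow> real \<Rightarrow> (nat \<Rightarrow> nat) \<Rightarrow> (nat \<Rightarrow> nat) \<Rightarrow> (nat \<Rightarrow> nat)
     \<Rightarrow> (nat \<Rightarrow> bool list \<Rightarrow> nat set) \<Rightarrow> bool" where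
  "sampler sec0 \<kappa>1 \<kappa>2 M t r samp \<longleftrightarrow>
     (\<forall>sec\<ge>sec0. 0 < \<kappa>1 sec \<and> \<kappa>1 sec < 1) \<and> 0 < \<kappa>2 \<and> \<kappa>2 < 1 \<and>
     (\<lambda>sec. real (r sec)) \<in> \<Theta>(\<lambda>sec. real (M sec) powr \<kappa>2) \<and>
     polytime_on {(sec, u). sec0 \<le> sec} (\<lambda>(sec, u). sorted_list_of_set (samp sec u)) \<and>
     (\<forall>sec\<ge>sec0. \<forall>u\<in>bits (r sec). samp sec u \<subseteq> {..<M sec} \<and> card (samp sec u) = t sec) \<and>
     (\<exists>c>0. \<forall>sec\<ge>sec0. \<forall>(\<mu>::real) (X :: bool list pmf).
        set_pmf X \<subseteq> bits (M sec) \<and> min_entropy X \<ge> \<mu> * real (M sec) \<longrightarrow>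
        (\<exists>Y :: bool list \<Rightarrow> bool list pmf.
           (\<forall>u\<in>bits (r sec). set_pmf (Y u) \<subseteq> bits (t sec) \<and>
              min_entropy (Y u) \<ge> (\<mu> - \<kappa>1 sec) * real (t sec)) \<and>
           stat_dist
             (do {u \<leftarrow> unif (r sec); x \<leftarrow> X; return_pmf (u, nths x (samp sec u))})
             (do {u \<leftarrow> unif (r sec); y \<leftarrow> Y u; return_pmf (u, y)})
           \<le> exp (- c * real (M sec) * \<kappa>1 sec) + exp (- (real (M sec) powr \<kappa>2))))"

section \<open>Finite fields and codes\<close>

text \<open>Symbols, i.e. elements of the field with \<open>2^l\<close> elements, are bit strings of length \<open>l\<close>, their
  coordinates with respect to a basis over the field with two elements; so addition is XOR.\<close>

type_synonym symbol = "bool list"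

definition binary_field :: "nat \<Rightarrow> symbol ring \<Rightarrow> bool" where
  "binary_field l K \<longleftrightarrow> field K \<and> carrier K = bits l \<and>
     (\<forall>a\<in>bits l. \<forall>b\<in>bits l. a \<oplus>\<^bsub>K\<^esub> b = map2 (\<noteq>) a b)"

definition efficient_binary_fields :: "nat \<Rightarrow> (nat \<Rightarrow> nat) \<Rightarrow> (nat \<Rightarrow> symbol ring) \<Rightarrow> bool" where
  "efficient_binary_fields sec0 l K \<longleftrightarrow>
     (\<forall>sec\<ge>sec0. binary_field (l sec) (K sec)) \<and>
     polytime_on {(sec, a, b). sec0 \<le> sec \<and> a \<in> carrier (K sec) \<and> b \<in> carrier (K sec)}
       (\<lambda>(sec, a, b). a \<otimes>\<^bsub>K sec\<^esub> b)"

definition evaluation_points ::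
  "nat \<Rightarrow> (nat \<Rightarrow> symbol ring) \<Rightarrow> (nat \<Rightarrow> nat) \<Rightarrow> (nat \<Rightarrow> symbol list) \<Rightarrow> bool" where
  "evaluation_points sec0 K n pts \<longleftrightarrow>
     (\<forall>sec\<ge>sec0. distinct (pts sec) \<and> pts sec \<in> words (carrier (K sec)) (n sec)) \<and>
     polytime_on {sec. sec0 \<le> sec} pts"

definition rs_encode :: "symbol ring \<Rightarrow> symbol list \<Rightarrow> symbol list \<Rightarrow> symbol list" where
  "rs_encode K pts m =
     map (\<lambda>a. \<Oplus>\<^bsub>K\<^esub>i\<in>{..<length m}. (m ! i) \<otimes>\<^bsub>K\<^esub> (a [^]\<^bsub>K\<^esub> i)) pts"

text \<open>The code \<open>[v]\<close>: \<open>ecc sec v\<close> has \<open>len sec (length v)\<close> symbols, and more than \<open>\<rho> sec\<close> symbol errors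
  can be corrected efficiently.\<close>

definition efficient_ecc ::
  "nat \<Rightarrow> (nat \<Rightarrow> symbol ring) \<Rightarrow> (nat \<Rightarrow> real) \<Rightarrow> (nat \<Rightarrow> nat \<Rightarrow> nat)
     \<Rightarrow> (nat \<Rightarrow> bool list \<Rightarrow> symbol list) \<Rightarrow> bool" where
  "efficient_ecc sec0 K \<rho> len ecc \<longleftrightarrow>
     (\<forall>sec\<ge>sec0. \<forall>v. ecc sec v \<in> words (carrier (K sec)) (len sec (length v))) \<and>
     polytime_on {(sec, v). sec0 \<le> sec} (\<lambda>(sec, v). ecc sec v) \<and>
     (\<exists>(dec :: nat \<Rightarrow> symbol list \<Rightarrow> bool list) (e :: nat \<Rightarrow> nat).
        polytime_on {(sec, w). sec0 \<le> sec \<and> set w \<subseteq> carrier (K sec)} (\<lambda>(sec, w). dec sec w) \<and>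
        (\<forall>sec\<ge>sec0. \<rho> sec < real (e sec) \<and>
           (\<forall>v. \<forall>w\<in>words (carrier (K sec)) (len sec (length v)).
              hamming w (ecc sec v) \<le> e sec \<longrightarrow> dec sec w = v)))"

section \<open>The learning problem\<close>

type_synonym point = "symbol list \<times> symbol list \<times> symbol list \<times> symbol list"

definition point_dist :: "point \<Rightarrow> point \<Rightarrow> nat" where
  "point_dist = (\<lambda>(a, b, c, d) (a', b', c', d').
     hamming (a @ b @ c @ d) (a' @ b' @ c' @ d'))"

definition inner_F2 :: "bool list \<Rightarrow> bool list \<Rightarrow> bool" where
  "inner_F2 v w = odd (\<Sum>i<length v. of_bool (v ! i \<and> w ! i) :: nat)"

definition to_symbols :: "nat \<Rightarrow> nat \<Rightarrow> bool list \<Rightarrow> symbol list" where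
  "to_symbols l n v = map (\<lambda>i. take l (drop (i * l) v)) [0..<n]"

definition vec_add :: "symbol ring \<Rightarrow> symbol list \<Rightarrow> symbol list \<Rightarrow> symbol list" where
  "vec_add K v w = map2 (\<lambda>a b. a \<oplus>\<^bsub>K\<^esub> b) v w"

definition point_space ::
  "symbol ring \<Rightarrow> (nat \<Rightarrow> nat) \<Rightarrow> nat \<Rightarrow> nat \<Rightarrow> nat \<Rightarrow> nat \<Rightarrow> point set" where
  "point_space K len r1 r2 k n =
     words (carrier K) (len r1) \<times> words (carrier K) (len r2) \<times>
     words (carrier K) k \<times> words (carrier K) n"

definition point_distribution ::
  "symbol ring \<Rightarrow> symbol list \<Rightarrow> (bool list \<Rightarrow> symbol list) \<Rightarrow> (bool list \<Rightarrow> nat set)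
     \<Rightarrow> nat \<Rightarrow> nat \<Rightarrow> nat \<Rightarrow> nat \<Rightarrow> nat \<Rightarrow> bool list \<Rightarrow> point pmf" where
  "point_distribution K pts ecc samp2 r1 r2 l k n pad =
     do {u1 \<leftarrow> unif r1; u2 \<leftarrow> unif r2; m \<leftarrow> pmf_of_set (words (carrier K) k);
         return_pmf (ecc u1, ecc u2, m,
           vec_add K (rs_encode K pts m) (to_symbols l n (nths pad (samp2 u2))))}"

text \<open>The label of \<open>([u1], _, m, _)\<close>; its value where the first component is not a codeword is
  arbitrary, as such points are outside the support of every distribution of the problem.\<close>

definition point_label ::
  "(bool list \<Rightarrow> symbol list) \<Rightarrow> (bool list \<Rightarrow> nat set) \<Rightarrow> nat \<Rightarrow> bool list \<Rightarrow> point \<Rightarrow> bool" where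
  "point_label ecc samp1 r1 key = (\<lambda>(c1, c2, m, y).
     inner_F2 (concat m) (nths key (samp1 (inv_into (bits r1) ecc c1))))"

definition prg_problem ::
  "(nat \<Rightarrow> symbol ring) \<Rightarrow> (nat \<Rightarrow> symbol list) \<Rightarrow> (nat \<Rightarrow> nat \<Rightarrow> nat)
     \<Rightarrow> (nat \<Rightarrow> bool list \<Rightarrow> symbol list)
     \<Rightarrow> (bool list \<Rightarrow> bool list) \<Rightarrow> (bool list \<Rightarrow> bool list)
     \<Rightarrow> (nat \<Rightarrow> bool list \<Rightarrow> nat set) \<Rightarrow> (nat \<Rightarrow> bool list \<Rightarrow> nat set)
     \<Rightarrow> (nat \<Rightarrow> nat) \<Rightarrow> (nat \<Rightarrow> nat) \<Rightarrow> (nat \<Rightarrow> nat) \<Rightarrow> (nat \<Rightarrow> nat) \<Rightarrow> (nat \<Rightarrow> nat)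
     \<Rightarrow> nat \<Rightarrow> (point, bool) learning_problem" where
  "prg_problem K pts len ecc f1 f2 samp1 samp2 r1 r2 l k n sec =
     \<lparr> instances = point_space (K sec) (len sec) (r1 sec) (r2 sec) (k sec) (n sec),
       labels = UNIV,
       dists = {point_distribution (K sec) (pts sec) (ecc sec) (samp2 sec)
                  (r1 sec) (r2 sec) (l sec) (k sec) (n sec) (f2 s) | s. s \<in> bits sec},
       hyps = {point_label (ecc sec) (samp1 sec) (r1 sec) (f1 s) | s. s \<in> bits sec} \<rparr>"

end

theory Submission
  imports Defs
begin

text \<open>
  A model is a pair of bit strings that stand in for the two generator outputs: the key \<open>f1 s\<close>, on which
  the labels depend linearly, and the pad \<open>f2 s'\<close>, of which every clean example reveals the sampled
  bits, since the message is part of the example. So consistency of a model with a sample is a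
  system of affine equations over the field with two elements. The unbounded learner searches all
  pairs of seeds, the efficient one solves the system by elimination. A model consistent with
  \<open>N\<close> examples errs with expected probability at most \<open>ln A / N\<close>, where \<open>A\<close> counts the models, and
  where it does not err on the clean point it is robust: both seeds and, after subtracting the pad,
  the message are recovered from any perturbation within the budget, the message by
  Berlekamp--Welch decoding. The decoder is in turn elimination over the bits of the symbols.
\<close>

subsection \<open>Composing programs\<close>

text \<open>Elimination works on bits because multiplication is the only field operation that comes
  with a program besides XOR; over the symbols it would have to divide. Multiplication by a fixed
  symbol and evaluation at a fixed point are linear over the field with two elements, so each system
  becomes one of XORs. It is passed on as a polynomial-time affine map; evaluation at zero and at
  the unit vectors yields its coefficients.

  An error of a model means a nonzero residue on a clean example, pad bits included, and not just a
  wrong label: a model with a wrong pad might label the clean point correctly and fail under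
  perturbation. With this notion one event dominates both risks.

  Points outside the support shape the definitions. Training and inference must stay efficient
  there, although a decoded seed may have any length and select any number of bits. So restrictions
  are padded, inner products truncate, and parameters without a program are read off the data, such
  as the message length off the point and the symbol length off the evaluation points.\<close>

definition poly_bounded :: "(nat \<Rightarrow> nat) \<Rightarrow> bool" where
  "poly_bounded f \<longleftrightarrow> (\<exists>p :: nat poly. \<forall>x. f x \<le> poly p x)"

text \<open>Natural coefficients leave no negative terms. Monotonicity is what lets a size bound be
  substituted into a time bound.\<close>

lemma poly_nat_mono: "x \<le> y \<Longrightarrow> poly p x \<le> poly p y" for p :: "nat poly"
  by (induction p) (auto intro!: add_mono mult_mono)

lemma poly_bounded_poly: "poly_bounded (poly p)"
  by (auto simp: poly_bounded_def)

lemma poly_bounded_const: "poly_bounded (\<lambda>_. c)"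
  unfolding poly_bounded_def by (rule exI[of _ "[:c:]"]) simp

lemma poly_bounded_id: "poly_bounded (\<lambda>x. x)"
  unfolding poly_bounded_def by (rule exI[of _ "[:0, 1:]"]) simp

lemma poly_bounded_add: "poly_bounded f \<Longrightarrow> poly_bounded g \<Longrightarrow> poly_bounded (\<lambda>x. f x + g x)"
  unfolding poly_bounded_def by (metis add_mono poly_add)

lemma poly_bounded_mult: "poly_bounded f \<Longrightarrow> poly_bounded g \<Longrightarrow> poly_bounded (\<lambda>x. f x * g x)"
  unfolding poly_bounded_def by (metis mult_le_mono poly_mult)

lemma poly_bounded_Suc: "poly_bounded f \<Longrightarrow> poly_bounded (\<lambda>x. Suc (f x))"
  using poly_bounded_add[OF poly_bounded_const[of 1]] by simp

lemma poly_bounded_power: "poly_bounded f \<Longrightarrow> poly_bounded (\<lambda>x. f x ^ d)"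
  by (induction d) (auto intro: poly_bounded_const poly_bounded_mult)

lemma poly_bounded_comp: "poly_bounded f \<Longrightarrow> poly_bounded (\<lambda>x. poly p (f x))"
proof -
  assume "poly_bounded f"
  then obtain q where q: "\<And>x. f x \<le> poly q x" by (auto simp: poly_bounded_def)
  have "poly p (f x) \<le> poly (pcompose p q) x" for x
    by (simp add: poly_pcompose q poly_nat_mono)
  then show ?thesis by (auto simp: poly_bounded_def)
qed

lemmas poly_bounded_intros =
  poly_bounded_const poly_bounded_id poly_bounded_add poly_bounded_mult poly_bounded_Suc
  poly_bounded_power poly_bounded_comp

section \<open>Variables in use and calls of subprograms\<close>

primrec expr_vars :: "expr \<Rightarrow> nat" where
  "expr_vars (Var i) = Suc i"
| "expr_vars EAtom = 0"
| "expr_vars (ECell e1 e2) = max (expr_vars e1) (expr_vars e2)"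
| "expr_vars (Fst e) = expr_vars e"
| "expr_vars (Snd e) = expr_vars e"

primrec prog_vars :: "prog \<Rightarrow> nat" where
  "prog_vars Skip = 0"
| "prog_vars (Assign i e) = max (Suc i) (expr_vars e)"
| "prog_vars (Seq c1 c2) = max (prog_vars c1) (prog_vars c2)"
| "prog_vars (Cond e c1 c2) = max (expr_vars e) (max (prog_vars c1) (prog_vars c2))"
| "prog_vars (Loop e c) = max (expr_vars e) (prog_vars c)"

lemma evalx_cong: "\<forall>i<expr_vars e. s i = s' i \<Longrightarrow> evalx e s = evalx e s'"
  by (induction e) auto

text \<open>\<open>runs\<close> starts from a store of atoms, whereas a subprogram finds the data of
  its caller. A computation neither reads nor writes beyond \<open>prog_vars\<close>, a strict upper
  bound on the variables in use, so time and result are the same in all stores that agree below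
  \<open>V\<close>.\<close>

lemma exec_frame:
  assumes "exec c s t s'" "prog_vars c \<le> V" "\<forall>i<V. s i = u i"
  shows "\<exists>u'. exec c u t u' \<and> (\<forall>i<V. u' i = s' i) \<and> (\<forall>i\<ge>V. u' i = u i)"
  using assms
proof (induction arbitrary: u)
  case (exec_Assign i e s)
  have "evalx e s = evalx e u" using exec_Assign by (intro evalx_cong) auto
  then have "exec (Assign i e) u (1 + tsize (evalx e s)) (u(i := evalx e s))"
    by (metis exec.exec_Assign)
  moreover have "\<forall>j<V. (u(i := evalx e s)) j = (s(i := evalx e s)) j"
    and "\<forall>j\<ge>V. (u(i := evalx e s)) j = u j" using exec_Assign.prems by auto
  ultimately show ?case by (intro exI[of _ "u(i := evalx e s)"] conjI)
next
  case (exec_Seq c1 s t1 s' c2 t2 s'')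
  from exec_Seq.prems obtain u' where u': "exec c1 u t1 u'" "\<forall>i<V. u' i = s' i" "\<forall>i\<ge>V. u' i = u i"
    using exec_Seq.IH(1)[of u] by auto
  then obtain u'' where "exec c2 u' t2 u''" "\<forall>i<V. u'' i = s'' i" "\<forall>i\<ge>V. u'' i = u' i"
    using exec_Seq.IH(2)[of u'] exec_Seq.prems by auto
  then show ?case using u' by (metis exec.exec_Seq)
next
  case (exec_CondT e s c1 t s' c2)
  have "evalx e s = evalx e u" using exec_CondT by (intro evalx_cong) auto
  moreover obtain u' where "exec c1 u t u'" "\<forall>i<V. u' i = s' i" "\<forall>i\<ge>V. u' i = u i"
    using exec_CondT.IH[of u] exec_CondT.prems by auto
  ultimately show ?case using exec_CondT.hyps by (metis exec.exec_CondT)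
next
  case (exec_CondF e s c2 t s' c1)
  have "evalx e s = evalx e u" using exec_CondF by (intro evalx_cong) auto
  moreover obtain u' where "exec c2 u t u'" "\<forall>i<V. u' i = s' i" "\<forall>i\<ge>V. u' i = u i"
    using exec_CondF.IH[of u] exec_CondF.prems by auto
  ultimately show ?case using exec_CondF.hyps by (metis exec.exec_CondF)
next
  case (exec_LoopF e s c)
  have "evalx e s = evalx e u" using exec_LoopF by (intro evalx_cong) auto
  then show ?case using exec_LoopF by (metis exec.exec_LoopF)
next
  case (exec_LoopT e s c t1 s' t2 s'')
  have e: "evalx e s = evalx e u" using exec_LoopT by (intro evalx_cong) auto
  obtain u' where u': "exec c u t1 u'" "\<forall>i<V. u' i = s' i" "\<forall>i\<ge>V. u' i = u i"
    using exec_LoopT.IH(1)[of u] exec_LoopT.prems by auto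
  then obtain u'' where "exec (Loop e c) u' t2 u''" "\<forall>i<V. u'' i = s'' i" "\<forall>i\<ge>V. u'' i = u' i"
    using exec_LoopT.IH(2)[of u'] exec_LoopT.prems by auto
  then show ?case using u' e exec_LoopT.hyps by (metis exec.exec_LoopT)
next
  case (exec_Skip s)
  then show ?case using exec.exec_Skip[of u] by (intro exI[of _ u]) auto
qed

text \<open>An assignment is charged the size of the tree that it stores. A time bound is therefore
  also a bound on the output, on which composition relies.\<close>

lemma exec_tsize: "exec c s t s' \<Longrightarrow> tsize (s' i) \<le> tsize (s i) + t"
  by (induction rule: exec.induct) auto

abbreviation esize :: "'a::encodable \<Rightarrow> nat" where
  "esize x \<equiv> tsize (encode x)"

lemma tsize_pos: "0 < tsize a"
  by (cases a) auto

lemma runs_tsize: "runs c a t b \<Longrightarrow> tsize b \<le> tsize a + t"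
  unfolding runs_def by (metis exec_tsize fun_upd_same)

primrec clear :: "nat \<Rightarrow> prog" where
  "clear 0 = Skip"
| "clear (Suc v) = Seq (clear v) (Assign (Suc v) EAtom)"

lemma exec_clear: "exec (clear V) u (1 + 2 * V) (\<lambda>i. if 0 < i \<and> i \<le> V then Atom else u i)"
proof (induction V)
  case 0
  have "(\<lambda>i. if 0 < i \<and> i \<le> 0 then Atom else u i) = u" by auto
  then show ?case using exec_Skip[of u] by simp
next
  case (Suc V)
  let ?u = "\<lambda>i. if 0 < i \<and> i \<le> V then Atom else u i"
  have "exec (Assign (Suc V) EAtom) ?u 2 (?u(Suc V := Atom))"
    using exec_Assign[of "Suc V" EAtom ?u] by (simp add: numeral_2_eq_2)
  moreover have "?u(Suc V := Atom) = (\<lambda>i. if 0 < i \<and> i \<le> Suc V then Atom else u i)"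
    by (auto simp: fun_eq_iff)
  ultimately have "exec (clear (Suc V)) u (1 + 2 * V + 2) (\<lambda>i. if 0 < i \<and> i \<le> Suc V then Atom else u i)"
    using exec_Seq[OF Suc] by (metis clear.simps(2))
  then show ?case by simp
qed

text \<open>Restores the state that \<open>runs\<close> presupposes: the argument in variable 0 and
  atoms in the other variables of \<open>c\<close>. The caller keeps its own data above
  \<open>V\<close>.\<close>

definition call :: "nat \<Rightarrow> prog \<Rightarrow> prog" where
  "call V c = Seq (clear V) c"

lemma exec_call:
  assumes "runs c a t b" "prog_vars c \<le> V" "u 0 = a"
  shows "\<exists>u'. exec (call V c) u (1 + 2 * V + t) u' \<and> u' 0 = b \<and> (\<forall>i>V. u' i = u i)"
proof -
  obtain s where s: "exec c ((\<lambda>_. Atom)(0 := a)) t s" "s 0 = b"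
    using assms(1) by (auto simp: runs_def)
  let ?u = "\<lambda>i. if 0 < i \<and> i \<le> V then Atom else u i"
  have agree: "\<forall>i<Suc V. ((\<lambda>_. Atom)(0 := a)) i = ?u i" using assms(3) by auto
  have "prog_vars c \<le> Suc V" using assms(2) by simp
  from exec_frame[OF s(1) this agree]
  obtain u' where u': "exec c ?u t u' \<and> (\<forall>i<Suc V. u' i = s i) \<and> (\<forall>i\<ge>Suc V. u' i = ?u i)"
    by (rule exE)
  have "exec (call V c) u (1 + 2 * V + t) u'"
    unfolding call_def by (rule exec_Seq[OF exec_clear conjunct1[OF u']])
  then show ?thesis using conjunct2[OF u'] s(2) by (intro exI[of _ u']) auto
qed

lemma exec_Assign': "evalx e s = b \<Longrightarrow> t = 1 + tsize b \<Longrightarrow> u = s(i := b) \<Longrightarrow> exec (Assign i e) s t u"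
  using exec_Assign by metis

lemma polytime_onI:
  assumes "poly_bounded g"
    and "\<And>a. a \<in> A \<Longrightarrow> \<exists>t \<le> g (esize a). runs c (encode a) t (encode (f a))"
  shows "polytime_on A f"
  using assms unfolding polytime_on_def poly_bounded_def by (meson le_trans)

lemma polytime_subset: "polytime_on B f \<Longrightarrow> A \<subseteq> B \<Longrightarrow> polytime_on A f"
  unfolding polytime_on_def by blast

lemma polytime_cong_encode:
  assumes "\<And>a. a \<in> A \<Longrightarrow> encode (f a) = encode (g a)"
  shows "polytime_on A f \<longleftrightarrow> polytime_on A g"
  using assms unfolding polytime_on_def by auto

lemma polytime_cong:
  "(\<And>a. a \<in> A \<Longrightarrow> f a = g a) \<Longrightarrow> polytime_on A f \<longleftrightarrow> polytime_on A g"
  by (rule polytime_cong_encode) simp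

lemma polytime_expr:
  assumes "\<And>a s. a \<in> A \<Longrightarrow> s 0 = encode a \<Longrightarrow> evalx e s = encode (f a)"
    and "\<And>a. a \<in> A \<Longrightarrow> esize (f a) \<le> g (esize a)" "poly_bounded g"
  shows "polytime_on A f"
proof (rule polytime_onI[where c = "Assign 0 e" and g = "\<lambda>x. Suc (g x)"])
  fix a assume a: "a \<in> A"
  let ?s = "(\<lambda>_. Atom)(0 := encode a)"
  have "exec (Assign 0 e) ?s (1 + esize (f a)) (?s(0 := encode (f a)))"
    using a by (intro exec_Assign') (auto intro: assms(1))
  then have "runs (Assign 0 e) (encode a) (1 + esize (f a)) (encode (f a))"
    unfolding runs_def by force
  then show "\<exists>t\<le>Suc (g (esize a)). runs (Assign 0 e) (encode a) t (encode (f a))"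
    using assms(2)[OF a] by auto
qed (intro poly_bounded_intros assms)

lemma polytime_id: "polytime_on A (\<lambda>x. x)"
  by (rule polytime_expr[of _ "Var 0" _ "\<lambda>x. x"]) (auto intro: poly_bounded_intros)

lemma polytime_const: "polytime_on A (\<lambda>_. c)"
proof -
  have *: "\<exists>e. \<forall>s. evalx e s = b" for b
  proof (induction b)
    case Atom
    show ?case by (rule exI[of _ EAtom]) simp
  next
    case (Cell b1 b2)
    then obtain e1 e2 where "\<forall>s. evalx e1 s = b1" "\<forall>s. evalx e2 s = b2" by blast
    then show ?case by (intro exI[of _ "ECell e1 e2"]) simp
  qed
  obtain e where "\<forall>s. evalx e s = encode c" using * by blast
  then show ?thesis
    by (intro polytime_expr[of _ e _ "\<lambda>_. esize c"]) (auto intro: poly_bounded_intros)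
qed

lemma polytime_comp:
  assumes "polytime_on A f" "polytime_on B g" "\<And>a. a \<in> A \<Longrightarrow> f a \<in> B"
  shows "polytime_on A (\<lambda>a. g (f a))"
proof -
  obtain c1 p1 where f: "\<And>a. a \<in> A \<Longrightarrow> \<exists>t \<le> poly p1 (esize a). runs c1 (encode a) t (encode (f a))"
    using assms(1) unfolding polytime_on_def by blast
  obtain c2 p2 where g: "\<And>a. a \<in> B \<Longrightarrow> \<exists>t \<le> poly p2 (esize a). runs c2 (encode a) t (encode (g a))"
    using assms(2) unfolding polytime_on_def by blast
  define V where "V = prog_vars c2"
  have Vc2: "prog_vars c2 \<le> V" by (simp add: V_def)
  show ?thesis
  \<comment> \<open>The second program runs on \<open>f a\<close>, whose size is at most that of
    \<open>a\<close> plus the time of the first; \<open>1 + 2 * V\<close> is the time for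
    clearing.\<close>
  proof (rule polytime_onI[where c = "Seq c1 (call V c2)" and
        g = "\<lambda>x. poly p1 x + (1 + 2 * V + poly p2 (x + poly p1 x))"])
    fix a assume a: "a \<in> A"
    obtain t1 where t1: "t1 \<le> poly p1 (esize a)" "runs c1 (encode a) t1 (encode (f a))"
      using f[OF a] by blast
    obtain t2 where t2: "t2 \<le> poly p2 (esize (f a))" "runs c2 (encode (f a)) t2 (encode (g (f a)))"
      using g[OF assms(3)[OF a]] by blast
    have "esize (f a) \<le> esize a + poly p1 (esize a)"
      using runs_tsize[OF t1(2)] t1(1) by linarith
    then have le: "t2 \<le> poly p2 (esize a + poly p1 (esize a))"
      using t2(1) poly_nat_mono le_trans by blast
    obtain s where s: "exec c1 ((\<lambda>_. Atom)(0 := encode a)) t1 s" "s 0 = encode (f a)"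
      using t1(2) by (auto simp: runs_def)
    obtain s' where s': "exec (call V c2) s (1 + 2 * V + t2) s'" "s' 0 = encode (g (f a))"
      using exec_call[OF t2(2) Vc2, of s] s(2) by auto
    show "\<exists>t\<le>poly p1 (esize a) + (1 + 2 * V + poly p2 (esize a + poly p1 (esize a))).
            runs (Seq c1 (call V c2)) (encode a) t (encode (g (f a)))"
      unfolding runs_def using exec_Seq[OF s(1) s'(1)] s'(2) le t1(1)
      by (intro exI[of _ "t1 + (1 + 2 * V + t2)"]) auto
  qed (intro poly_bounded_intros poly_bounded_poly)
qed

text \<open>Beyond the reach of both calls, \<open>V+1\<close> keeps the argument and
  \<open>V+2\<close> the first result. The factor 100 is plain slack for copying.\<close>

lemma polytime_pair:
  assumes "polytime_on A f" "polytime_on A g"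
  shows "polytime_on A (\<lambda>a. (f a, g a))"
proof -
  obtain c1 p1 where f: "\<And>a. a \<in> A \<Longrightarrow> \<exists>t \<le> poly p1 (esize a). runs c1 (encode a) t (encode (f a))"
    using assms(1) unfolding polytime_on_def by blast
  obtain c2 p2 where g: "\<And>a. a \<in> A \<Longrightarrow> \<exists>t \<le> poly p2 (esize a). runs c2 (encode a) t (encode (g a))"
    using assms(2) unfolding polytime_on_def by blast
  define V where "V = max (prog_vars c1) (prog_vars c2)"
  have Vc1: "prog_vars c1 \<le> V" by (simp add: V_def)
  have Vc2: "prog_vars c2 \<le> V" by (simp add: V_def)
  let ?c = "Seq (Assign (V+1) (Var 0)) (Seq (call V c1) (Seq (Assign (V+2) (Var 0))
       (Seq (Assign 0 (Var (V+1))) (Seq (call V c2) (Assign 0 (ECell (Var (V+2)) (Var 0)))))))"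
  show ?thesis
  proof (rule polytime_onI[where c = ?c and
        g = "\<lambda>x. 100 * (x + poly p1 x + poly p2 x + V + 1)"])
    fix a assume a: "a \<in> A"
    obtain t1 where t1: "t1 \<le> poly p1 (esize a)" "runs c1 (encode a) t1 (encode (f a))"
      using f[OF a] by blast
    obtain t2 where t2: "t2 \<le> poly p2 (esize a)" "runs c2 (encode a) t2 (encode (g a))"
      using g[OF a] by blast
    let ?s0 = "(\<lambda>_. Atom)(0 := encode a)"
    let ?s1 = "?s0(V+1 := encode a)"
    obtain s2 where s2: "exec (call V c1) ?s1 (1 + 2 * V + t1) s2" "s2 0 = encode (f a)" "\<forall>i>V. s2 i = ?s1 i"
      using exec_call[OF t1(2) Vc1, of ?s1] by auto
    let ?s3 = "s2(V+2 := encode (f a))"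
    let ?s4 = "?s3(0 := encode a)"
    obtain s5 where s5: "exec (call V c2) ?s4 (1 + 2 * V + t2) s5" "s5 0 = encode (g a)" "\<forall>i>V. s5 i = ?s4 i"
      using exec_call[OF t2(2) Vc2, of ?s4] by auto
    let ?s6 = "s5(0 := encode (f a, g a))"
    have 1: "exec (Assign (V+1) (Var 0)) ?s0 (1 + esize a) ?s1"
      by (rule exec_Assign') auto
    have 3: "exec (Assign (V+2) (Var 0)) s2 (1 + esize (f a)) ?s3"
      using s2 by (intro exec_Assign') auto
    have 4: "exec (Assign 0 (Var (V+1))) ?s3 (1 + esize a) ?s4"
      using s2 by (intro exec_Assign') auto
    have 6: "exec (Assign 0 (ECell (Var (V+2)) (Var 0))) s5 (1 + esize (f a, g a)) ?s6"
      using s5 by (intro exec_Assign') (auto simp: encode_prod_def)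
    note ex = exec_Seq[OF 1 exec_Seq[OF s2(1) exec_Seq[OF 3 exec_Seq[OF 4 exec_Seq[OF s5(1) 6]]]]]
    show "\<exists>t\<le>100 * (esize a + poly p1 (esize a) + poly p2 (esize a) + V + 1).
       runs ?c (encode a) t (encode (f a, g a))"
      unfolding runs_def
      apply (intro exI conjI)
        prefer 2 apply (rule ex)
       prefer 2 apply simp
      using t1(1) t2(1) runs_tsize[OF t1(2)] runs_tsize[OF t2(2)]
      by (simp add: encode_prod_def)
  qed (intro poly_bounded_intros poly_bounded_poly)
qed

lemma polytime_if:
  assumes "polytime_on A P" "polytime_on {a\<in>A. P a} f" "polytime_on {a\<in>A. \<not> P a} g"
  shows "polytime_on A (\<lambda>a. if P a then f a else g a)"
proof -
  obtain c0 p0 where P: "\<And>a. a \<in> A \<Longrightarrow> \<exists>t \<le> poly p0 (esize a). runs c0 (encode a) t (encode (P a))"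
    using assms(1) unfolding polytime_on_def by blast
  obtain c1 p1 where f: "\<And>a. a \<in> A \<Longrightarrow> P a \<Longrightarrow> \<exists>t \<le> poly p1 (esize a). runs c1 (encode a) t (encode (f a))"
    using assms(2) unfolding polytime_on_def by blast
  obtain c2 p2 where g: "\<And>a. a \<in> A \<Longrightarrow> \<not> P a \<Longrightarrow> \<exists>t \<le> poly p2 (esize a). runs c2 (encode a) t (encode (g a))"
    using assms(3) unfolding polytime_on_def by blast
  define V where "V = max (prog_vars c0) (max (prog_vars c1) (prog_vars c2))"
  have Vc0: "prog_vars c0 \<le> V" by (simp add: V_def)
  have Vc1: "prog_vars c1 \<le> V" by (simp add: V_def)
  have Vc2: "prog_vars c2 \<le> V" by (simp add: V_def)
  let ?c = "Seq (Assign (V+1) (Var 0)) (Seq (call V c0) (Seq (Assign (V+2) (Var 0))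
       (Seq (Assign 0 (Var (V+1))) (Cond (Var (V+2)) (call V c1) (call V c2)))))"
  show ?thesis
  proof (rule polytime_onI[where c = ?c and
        g = "\<lambda>x. 200 * (x + poly p0 x + poly p1 x + poly p2 x + V + 1)"])
    fix a assume a: "a \<in> A"
    obtain t0 where t0: "t0 \<le> poly p0 (esize a)" "runs c0 (encode a) t0 (encode (P a))"
      using P[OF a] by blast
    let ?s0 = "(\<lambda>_. Atom)(0 := encode a)"
    let ?s1 = "?s0(V+1 := encode a)"
    obtain s2 where s2: "exec (call V c0) ?s1 (1 + 2 * V + t0) s2" "s2 0 = encode (P a)" "\<forall>i>V. s2 i = ?s1 i"
      using exec_call[OF t0(2) Vc0, of ?s1] by auto
    let ?s3 = "s2(V+2 := encode (P a))"
    let ?s4 = "?s3(0 := encode a)"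
    have 1: "exec (Assign (V+1) (Var 0)) ?s0 (1 + esize a) ?s1"
      by (rule exec_Assign') auto
    have 3: "exec (Assign (V+2) (Var 0)) s2 (1 + esize (P a)) ?s3"
      using s2 by (intro exec_Assign') auto
    have 4: "exec (Assign 0 (Var (V+1))) ?s3 (1 + esize a) ?s4"
      using s2 by (intro exec_Assign') auto
    have "\<exists>t\<le>100 + 2 * V + poly p1 (esize a) + poly p2 (esize a).
       \<exists>s5. exec (Cond (Var (V+2)) (call V c1) (call V c2)) ?s4 t s5 \<and> s5 0 = encode (if P a then f a else g a)"
    proof (cases "P a")
      case True
      obtain t1 where t1: "t1 \<le> poly p1 (esize a)" "runs c1 (encode a) t1 (encode (f a))"
        using f[OF a True] by blast
      obtain s5 where s5: "exec (call V c1) ?s4 (1 + 2 * V + t1) s5" "s5 0 = encode (f a)"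
        using exec_call[OF t1(2) Vc1, of ?s4] by auto
      have "exec (Cond (Var (V+2)) (call V c1) (call V c2)) ?s4 (1 + (1 + 2 * V + t1)) s5"
        using True by (intro exec_CondT s5) (auto simp: encode_bool_def)
      then show ?thesis using True t1 s5 by (intro exI[of _ "1 + (1 + 2 * V + t1)"]) auto
    next
      case False
      obtain t1 where t1: "t1 \<le> poly p2 (esize a)" "runs c2 (encode a) t1 (encode (g a))"
        using g[OF a False] by blast
      obtain s5 where s5: "exec (call V c2) ?s4 (1 + 2 * V + t1) s5" "s5 0 = encode (g a)"
        using exec_call[OF t1(2) Vc2, of ?s4] by auto
      have "exec (Cond (Var (V+2)) (call V c1) (call V c2)) ?s4 (1 + (1 + 2 * V + t1)) s5"
        using False by (intro exec_CondF s5) (auto simp: encode_bool_def)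
      then show ?thesis using False t1 s5 by (intro exI[of _ "1 + (1 + 2 * V + t1)"]) auto
    qed
    then obtain t s5 where t: "t \<le> 100 + 2 * V + poly p1 (esize a) + poly p2 (esize a)"
      and 5: "exec (Cond (Var (V+2)) (call V c1) (call V c2)) ?s4 t s5"
      and s5: "s5 0 = encode (if P a then f a else g a)" by blast
    note ex = exec_Seq[OF 1 exec_Seq[OF s2(1) exec_Seq[OF 3 exec_Seq[OF 4 5]]]]
    have "esize (P a) \<le> 3" by (simp add: encode_bool_def)
    then show "\<exists>t\<le>200 * (esize a + poly p0 (esize a) + poly p1 (esize a) + poly p2 (esize a) + V + 1).
       runs ?c (encode a) t (encode (if P a then f a else g a))"
      unfolding runs_def
      apply (intro exI conjI)
        prefer 2 apply (rule ex)
       prefer 2 apply (rule s5)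
      using t0(1) t by simp
  qed (intro poly_bounded_intros poly_bounded_poly)
qed

subsection \<open>Loops and lists\<close>

definition size_bounded :: "'a::encodable set \<Rightarrow> ('a \<Rightarrow> nat) \<Rightarrow> bool" where
  "size_bounded A b \<longleftrightarrow> (\<exists>p :: nat poly. \<forall>a\<in>A. b a \<le> poly p (esize a))"

lemma size_boundedI: "poly_bounded f \<Longrightarrow> (\<And>a. a \<in> A \<Longrightarrow> b a \<le> f (esize a)) \<Longrightarrow> size_bounded A b"
  unfolding size_bounded_def poly_bounded_def by (meson le_trans)

lemma size_bounded_mono: "size_bounded A c \<Longrightarrow> (\<And>a. a \<in> A \<Longrightarrow> b a \<le> c a) \<Longrightarrow> size_bounded A b"
  unfolding size_bounded_def by (meson le_trans)

lemma size_bounded_const: "size_bounded A (\<lambda>_. c)"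
  by (rule size_boundedI[OF poly_bounded_const]) auto

lemma size_bounded_self: "size_bounded A (\<lambda>a. esize a)"
  by (rule size_boundedI[OF poly_bounded_id]) auto

lemma size_bounded_add: "size_bounded A b \<Longrightarrow> size_bounded A c \<Longrightarrow> size_bounded A (\<lambda>a. b a + c a)"
  unfolding size_bounded_def by (metis add_mono poly_add)

lemma size_bounded_mult: "size_bounded A b \<Longrightarrow> size_bounded A c \<Longrightarrow> size_bounded A (\<lambda>a. b a * c a)"
  unfolding size_bounded_def by (metis mult_le_mono poly_mult)

lemma size_bounded_Suc: "size_bounded A b \<Longrightarrow> size_bounded A (\<lambda>a. Suc (b a))"
  using size_bounded_add[OF size_bounded_const[of _ 1]] by simp

lemma size_bounded_poly:
  assumes "size_bounded A b"
  shows "size_bounded A (\<lambda>a. poly p (b a))"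
proof -
  obtain q where q: "\<And>a. a \<in> A \<Longrightarrow> b a \<le> poly q (esize a)"
    using assms by (auto simp: size_bounded_def)
  have "poly p (b a) \<le> poly (pcompose p q) (esize a)" if "a \<in> A" for a
    by (simp add: poly_pcompose q poly_nat_mono that)
  then show ?thesis by (auto simp: size_bounded_def)
qed

lemma size_bounded_polytime: "polytime_on A f \<Longrightarrow> size_bounded A (\<lambda>a. esize (f a))"
proof -
  assume "polytime_on A f"
  then obtain c p where
    f: "\<And>a. a \<in> A \<Longrightarrow> \<exists>t \<le> poly p (esize a). runs c (encode a) t (encode (f a))"
    unfolding polytime_on_def by blast
  show ?thesis
  proof (rule size_boundedI[where f = "\<lambda>x. x + poly p x"])
    fix a assume "a \<in> A"
    from f[OF this] show "esize (f a) \<le> esize a + poly p (esize a)"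
      using runs_tsize by (meson add_left_mono le_trans)
  qed (intro poly_bounded_intros)
qed

lemmas size_bounded_intros = size_bounded_const size_bounded_self size_bounded_add size_bounded_mult
  size_bounded_Suc size_bounded_poly size_bounded_polytime

lemma tsize_encode_pair [simp]: "esize (a, b) = 1 + esize a + esize b"
  by (simp add: encode_prod_def)

lemma tsize_encode_nat [simp]: "esize (m :: nat) = Suc (2 * m)"
  by (induction m) auto

lemma tsize_encode_append:
  "Suc (esize (xs @ ys)) = esize xs + esize ys"
  by (induction xs) auto

lemma tsize_encode_rev [simp]: "esize (rev xs) = esize xs"
proof (induction xs)
  case (Cons x xs)
  then show ?case using tsize_encode_append[of "rev xs" "[x]"] by simp
qed simp

lemma tsize_encode_take: "esize (take i xs) \<le> esize xs"
  using tsize_encode_append[of "take i xs" "drop i xs"] tsize_pos[of "encode (drop i xs)"] by simp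

lemma tsize_encode_drop: "esize (drop i xs) \<le> esize xs"
  using tsize_encode_append[of "take i xs" "drop i xs"] tsize_pos[of "encode (take i xs)"] by simp

lemma tsize_encode_mem: "e \<in> set xs \<Longrightarrow> esize e < esize xs"
  by (induction xs) auto

lemma length_le_tsize: "length xs < esize xs"
  by (induction xs) auto

lemma tsize_encode_list_le:
  "(\<And>e. e \<in> set xs \<Longrightarrow> esize e \<le> B) \<Longrightarrow> esize xs \<le> Suc (length xs * Suc B)"
  by (induction xs) fastforce+

lemma tsize_encode_concat: "esize (concat xss) \<le> esize xss"
proof (induction xss)
  case (Cons xs xss)
  then show ?case using tsize_encode_append[of xs "concat xss"] by simp
qed simp

text \<open>\<open>V+1\<close> holds the context, \<open>V+2\<close> the rest of the list and
  \<open>V+3\<close> the accumulator. Each round hands context, head and accumulator to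
  \<open>c\<close> as a triple, so that the step may depend on the input of the whole
  computation.\<close>

definition fold_prog :: "nat \<Rightarrow> prog \<Rightarrow> prog" where
  "fold_prog V c = Loop (Var (V+2))
     (Seq (Assign 0 (ECell (Var (V+1)) (ECell (Fst (Var (V+2))) (Var (V+3)))))
     (Seq (call V c) (Seq (Assign (V+3) (Var 0)) (Assign (V+2) (Snd (Var (V+2)))))))"

lemma exec_fold_prog:
  fixes x :: "'a::encodable" and es :: "'e::encodable list" and s :: "'s::encodable"
  assumes V: "prog_vars c \<le> V"
    and c: "\<And>i. i < length es \<Longrightarrow>
      \<exists>t\<le>T. runs c (encode (x, es ! i, fold g (take i es) s)) t (encode (fold g (take (Suc i) es) s))"
    and size: "\<And>i. i \<le> length es \<Longrightarrow> esize (fold g (take i es) s) \<le> B"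
    and bounds: "esize es \<le> B" "esize x \<le> B"
    and u: "u (V+1) = encode x" "u (V+2) = encode es" "u (V+3) = encode s"
  shows "\<exists>t u'. t \<le> 1 + length es * (100 * (T + B + V + 1)) \<and> exec (fold_prog V c) u t u' \<and>
    u' (V+3) = encode (fold g es s)"
  using c size bounds(1) u
proof (induction es arbitrary: s u)
  case Nil
  then have "exec (fold_prog V c) u 1 u" unfolding fold_prog_def by (intro exec_LoopF) simp
  then show ?case using Nil by (intro exI[of _ 1] exI[of _ u]) auto
next
  case (Cons e es)
  obtain t where t: "t \<le> T" "runs c (encode (x, e, s)) t (encode (g e s))"
    using Cons.prems(1)[of 0] by auto
  let ?u1 = "u(0 := encode (x, e, s))"
  have sB: "esize s \<le> B" using Cons.prems(2)[of 0] by simp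
  have gB: "esize (g e s) \<le> B" using Cons.prems(2)[of 1] by simp
  have esB: "esize e \<le> B" "esize es \<le> B" using Cons.prems(3) by auto
  have 1: "exec (Assign 0 (ECell (Var (V+1)) (ECell (Fst (Var (V+2))) (Var (V+3))))) u
      (1 + esize (x, e, s)) ?u1"
    using Cons.prems(4-6) by (intro exec_Assign') (auto simp: encode_prod_def)
  obtain u2 where u2: "exec (call V c) ?u1 (1 + 2 * V + t) u2" "u2 0 = encode (g e s)"
    "\<forall>i>V. u2 i = ?u1 i"
    using exec_call[OF t(2) V, of ?u1] by auto
  let ?u3 = "u2(V+3 := encode (g e s))"
  let ?u4 = "?u3(V+2 := encode es)"
  have 3: "exec (Assign (V+3) (Var 0)) u2 (1 + esize (g e s)) ?u3"
    using u2 by (intro exec_Assign') auto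
  have 4: "exec (Assign (V+2) (Snd (Var (V+2)))) ?u3 (1 + esize es) ?u4"
    using u2 Cons.prems by (intro exec_Assign') auto
  have "\<exists>t u'. t \<le> 1 + length es * (100 * (T + B + V + 1)) \<and> exec (fold_prog V c) ?u4 t u' \<and>
    u' (V+3) = encode (fold g es (g e s))"
  proof (rule Cons.IH)
    fix i assume i: "i < length es"
    then show "\<exists>t\<le>T. runs c (encode (x, es ! i, fold g (take i es) (g e s))) t
       (encode (fold g (take (Suc i) es) (g e s)))"
      using Cons.prems(1)[of "Suc i"] by simp
  next
    fix i assume i: "i \<le> length es"
    then show "esize (fold g (take i es) (g e s)) \<le> B"
      using Cons.prems(2)[of "Suc i"] by simp
  next
    show "?u4 (V+1) = encode x" "?u4 (V+2) = encode es" "?u4 (V+3) = encode (g e s)"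
      using u2 Cons.prems by auto
  qed (use esB in auto)
  then obtain t' u' where t': "t' \<le> 1 + length es * (100 * (T + B + V + 1))"
    and 5: "exec (fold_prog V c) ?u4 t' u'" and u': "u' (V+3) = encode (fold g es (g e s))" by blast
  have "evalx (Var (V+2)) u \<noteq> Atom" using Cons.prems by simp
  from exec_LoopT[OF this exec_Seq[OF 1 exec_Seq[OF u2(1) exec_Seq[OF 3 4]]] 5[unfolded fold_prog_def]]
  have ex: "exec (fold_prog V c) u (1 + (1 + esize (x, e, s) + (1 + 2 * V + t +
     (1 + esize (g e s) + (1 + esize es)))) + t') u'"
    unfolding fold_prog_def .
  have "1 + (1 + esize (x, e, s) + (1 + 2 * V + t +
     (1 + esize (g e s) + (1 + esize es)))) + t'
     \<le> 100 * (T + B + V + 1) + (1 + length es * (100 * (T + B + V + 1)))"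
    using sB gB esB t(1) t' assms(5) by simp
  also have "\<dots> = 1 + length (e # es) * (100 * (T + B + V + 1))" by simp
  finally show ?case using ex u' by (metis fold_simps(2))
qed

text \<open>A polynomial-time step may double its accumulator, and iterating it can then leave
  polynomial time. Hence the separate bound \<open>b\<close> on every state that is reached. The
  domain \<open>B\<close> has to contain only the triples that actually occur.\<close>

theorem polytime_fold_reachable:
  fixes L :: "'a::encodable \<Rightarrow> 'e::encodable list" and s0 :: "'a \<Rightarrow> 's::encodable"
  assumes L: "polytime_on A L" and s0: "polytime_on A s0"
    and step: "polytime_on B (\<lambda>y. g (fst y) (fst (snd y)) (snd (snd y)))"
    and reach: "\<And>x i. x \<in> A \<Longrightarrow> i < length (L x) \<Longrightarrow> (x, L x ! i, fold (g x) (take i (L x)) (s0 x)) \<in> B"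
    and b: "size_bounded A b"
    and size: "\<And>x i. x \<in> A \<Longrightarrow> i \<le> length (L x) \<Longrightarrow> esize (fold (g x) (take i (L x)) (s0 x)) \<le> b x"
  shows "polytime_on A (\<lambda>x. fold (g x) (L x) (s0 x))"
proof -
  let ?in = "\<lambda>x. (x, L x, s0 x)"
  have "polytime_on A (\<lambda>x. (x, L x, s0 x))"
    by (intro polytime_pair polytime_id L s0)
  moreover have "polytime_on (?in ` A) (\<lambda>y. fold (g (fst y)) (fst (snd y)) (snd (snd y)))"
  proof -
    obtain c p where c: "\<And>y. y \<in> B \<Longrightarrow> \<exists>t \<le> poly p (esize y).
        runs c (encode y) t (encode (g (fst y) (fst (snd y)) (snd (snd y))))"
      using step unfolding polytime_on_def by blast
    obtain q where q: "\<And>x. x \<in> A \<Longrightarrow> b x \<le> poly q (esize x)"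
      using b unfolding size_bounded_def by blast
    define V where "V = prog_vars c"
    \<comment> \<open>\<open>?b\<close> bounds the accumulators; \<open>?T\<close> bounds the time
      of one step, whose argument has two pair nodes besides context, head and accumulator.\<close>
    let ?b = "\<lambda>m. m + poly q m"
    let ?T = "\<lambda>m. poly p (2 + m + m + ?b m)"
    let ?c = "Seq (Assign (V+1) (Fst (Var 0))) (Seq (Assign (V+2) (Fst (Snd (Var 0))))
      (Seq (Assign (V+3) (Snd (Snd (Var 0)))) (Seq (fold_prog V c) (Assign 0 (Var (V+3))))))"
    show ?thesis
    proof (rule polytime_onI[where c = ?c and
          g = "\<lambda>m. 100 * (1 + m + ?b m) + m * (100 * (?T m + ?b m + V + 1))"])
      fix y assume "y \<in> ?in ` A"
      then obtain x where x: "x \<in> A" and y: "y = (x, L x, s0 x)" by auto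
      let ?m = "esize y"
      have le: "esize x \<le> ?m" "esize (L x) \<le> ?m" "esize (s0 x) \<le> ?m"
        by (auto simp: y)
      have bx: "b x \<le> ?b ?m" using q[OF x] poly_nat_mono[OF le(1), of q] by linarith
      have state: "esize (fold (g x) (take i (L x)) (s0 x)) \<le> ?b ?m" if "i \<le> length (L x)" for i
        using size[OF x that] bx by linarith
      let ?s0 = "(\<lambda>_. Atom)(0 := encode y)"
      let ?s1 = "?s0(V+1 := encode x)"
      let ?s2 = "?s1(V+2 := encode (L x))"
      let ?s3 = "?s2(V+3 := encode (s0 x))"
      have 1: "exec (Assign (V+1) (Fst (Var 0))) ?s0 (1 + esize x) ?s1"
        by (rule exec_Assign') (auto simp: y encode_prod_def)
      have 2: "exec (Assign (V+2) (Fst (Snd (Var 0)))) ?s1 (1 + esize (L x)) ?s2"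
        by (rule exec_Assign') (auto simp: y encode_prod_def)
      have 3: "exec (Assign (V+3) (Snd (Snd (Var 0)))) ?s2 (1 + esize (s0 x)) ?s3"
        by (rule exec_Assign') (auto simp: y encode_prod_def)
      have "\<exists>t s4. t \<le> 1 + length (L x) * (100 * (?T ?m + ?b ?m + V + 1)) \<and> exec (fold_prog V c) ?s3 t s4 \<and>
        s4 (V+3) = encode (fold (g x) (L x) (s0 x))"
      proof (rule exec_fold_prog)
        fix i assume i: "i < length (L x)"
        have "esize (L x ! i) \<le> ?m"
          using tsize_encode_mem[OF nth_mem[OF i]] le(2) by linarith
        then have "esize (x, L x ! i, fold (g x) (take i (L x)) (s0 x)) \<le> 2 + ?m + ?m + ?b ?m"
          using state[of i] i le(1) by simp
        then have "poly p (esize (x, L x ! i, fold (g x) (take i (L x)) (s0 x))) \<le> ?T ?m"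
          by (rule poly_nat_mono)
        moreover have "fold (g x) (take (Suc i) (L x)) (s0 x) = g x (L x ! i) (fold (g x) (take i (L x)) (s0 x))"
          using i by (simp add: take_Suc_conv_app_nth)
        ultimately show "\<exists>t\<le>?T ?m. runs c (encode (x, L x ! i, fold (g x) (take i (L x)) (s0 x))) t
           (encode (fold (g x) (take (Suc i) (L x)) (s0 x)))"
          using c[OF reach[OF x i], unfolded fst_conv snd_conv] by (auto intro: le_trans)
      qed (use state le in \<open>auto simp: V_def intro: trans_le_add1\<close>)
      then obtain t s4 where t: "t \<le> 1 + length (L x) * (100 * (?T ?m + ?b ?m + V + 1))"
        and 4: "exec (fold_prog V c) ?s3 t s4" and s4: "s4 (V+3) = encode (fold (g x) (L x) (s0 x))"
        by blast
      let ?s5 = "s4(0 := encode (fold (g x) (L x) (s0 x)))"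
      have 5: "exec (Assign 0 (Var (V+3))) s4 (1 + esize (fold (g x) (L x) (s0 x))) ?s5"
        using s4 by (intro exec_Assign') auto
      note ex = exec_Seq[OF 1 exec_Seq[OF 2 exec_Seq[OF 3 exec_Seq[OF 4 5]]]]
      have "length (L x) \<le> ?m" using length_le_tsize[of "L x"] le(2) by linarith
      then have "length (L x) * (100 * (?T ?m + ?b ?m + V + 1)) \<le> ?m * (100 * (?T ?m + ?b ?m + V + 1))"
        by (rule mult_right_mono) simp
      then have t': "t \<le> 1 + ?m * (100 * (?T ?m + ?b ?m + V + 1))" using t by linarith
      have fin: "esize (fold (g x) (L x) (s0 x)) \<le> ?b ?m"
        using state[of "length (L x)"] by simp
      let ?t = "1 + esize x + (1 + esize (L x) + (1 + esize (s0 x) +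
        (t + (1 + esize (fold (g x) (L x) (s0 x))))))"
      have "1 + esize x + (1 + esize (L x) + (1 + esize (s0 x) + (t + (1 + w))))
          \<le> 100 * (1 + ?m + v) + u" if "w \<le> v" "t \<le> 1 + u" for u v w
        using le that by simp
      from this[OF fin t'] have "?t \<le> 100 * (1 + ?m + ?b ?m) + ?m * (100 * (?T ?m + ?b ?m + V + 1))" .
      moreover have "runs ?c (encode y) ?t (encode (fold (g (fst y)) (fst (snd y)) (snd (snd y))))"
        unfolding runs_def using ex by (intro exI[of _ ?s5] conjI) (simp_all add: y)
      ultimately show "\<exists>t \<le> 100 * (1 + ?m + ?b ?m) + ?m * (100 * (?T ?m + ?b ?m + V + 1)).
         runs ?c (encode y) t (encode (fold (g (fst y)) (fst (snd y)) (snd (snd y))))"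
        by blast
    qed (intro poly_bounded_intros poly_bounded_poly)
  qed
  ultimately have "polytime_on A (\<lambda>x. (\<lambda>y. fold (g (fst y)) (fst (snd y)) (snd (snd y))) (?in x))"
    by (rule polytime_comp) auto
  then show ?thesis by simp
qed

lemma polytime_fold:
  fixes L :: "'a::encodable \<Rightarrow> 'e::encodable list" and s0 :: "'a \<Rightarrow> 's::encodable"
  assumes L: "polytime_on A L" and s0: "polytime_on A s0"
    and step: "polytime_on {(x, e, s). x \<in> A \<and> e \<in> set (L x) \<and> s \<in> I x}
      (\<lambda>y. g (fst y) (fst (snd y)) (snd (snd y)))"
    and I0: "\<And>x. x \<in> A \<Longrightarrow> s0 x \<in> I x"
    and I: "\<And>x e s. x \<in> A \<Longrightarrow> e \<in> set (L x) \<Longrightarrow> s \<in> I x \<Longrightarrow> g x e s \<in> I x"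
    and b: "size_bounded A b" and size: "\<And>x s. x \<in> A \<Longrightarrow> s \<in> I x \<Longrightarrow> esize s \<le> b x"
  shows "polytime_on A (\<lambda>x. fold (g x) (L x) (s0 x))"
proof (rule polytime_fold_reachable[OF L s0 step _ b])
  have inv: "fold (g x) (take i (L x)) (s0 x) \<in> I x" if "x \<in> A" "i \<le> length (L x)" for x i
    using that(2)
  proof (induction i)
    case (Suc i)
    then show ?case using I[OF that(1), of "L x ! i"] by (simp add: take_Suc_conv_app_nth)
  qed (simp add: I0 that)
  then show "esize (fold (g x) (take i (L x)) (s0 x)) \<le> b x"
    if "x \<in> A" "i \<le> length (L x)" for x i
    using that size by blast
  show "(x, L x ! i, fold (g x) (take i (L x)) (s0 x)) \<in> {(x, e, s). x \<in> A \<and> e \<in> set (L x) \<and> s \<in> I x}"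
    if "x \<in> A" "i < length (L x)" for x i
    using that inv[of x i] by simp
qed

section \<open>Closure rules for polynomial-time functions\<close>

named_theorems polytime_intros

declare polytime_id [polytime_intros] polytime_const [polytime_intros] polytime_pair [polytime_intros]

lemma polytime_fst [polytime_intros]:
  assumes "polytime_on A f" shows "polytime_on A (\<lambda>x. fst (f x))"
proof (rule polytime_comp[OF assms(1)])
  show "polytime_on UNIV (fst :: 'b \<times> 'c \<Rightarrow> 'b)"
    by (rule polytime_expr[of _ "Fst (Var 0)" _ "\<lambda>x. x"])
      (auto simp: encode_prod_def intro: poly_bounded_intros)
qed simp

lemma polytime_snd [polytime_intros]:
  assumes "polytime_on A f" shows "polytime_on A (\<lambda>x. snd (f x))"
proof (rule polytime_comp[OF assms(1)])
  show "polytime_on UNIV (snd :: 'b \<times> 'c \<Rightarrow> 'c)"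
    by (rule polytime_expr[of _ "Snd (Var 0)" _ "\<lambda>x. x"])
      (auto simp: encode_prod_def intro: poly_bounded_intros)
qed simp

lemma polytime_hd:
  assumes "polytime_on A f" "\<And>x. x \<in> A \<Longrightarrow> f x \<noteq> []"
  shows "polytime_on A (\<lambda>x. hd (f x))"
proof (rule polytime_comp[OF assms(1)])
  show "polytime_on {xs. xs \<noteq> []} (hd :: 'b list \<Rightarrow> 'b)"
    by (rule polytime_expr[of _ "Fst (Var 0)" _ "\<lambda>x. x"])
      (auto simp: neq_Nil_conv intro: poly_bounded_intros)
qed (use assms in simp)

lemma polytime_tl [polytime_intros]:
  assumes "polytime_on A f" shows "polytime_on A (\<lambda>x. tl (f x))"
proof (rule polytime_comp[OF assms(1)])
  have "evalx (Snd (Var 0)) s = encode (tl xs) \<and> esize (tl xs) \<le> esize xs"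
    if "s 0 = encode xs" for s and xs :: "'b list"
    using that by (cases xs) auto
  then show "polytime_on UNIV (tl :: 'b list \<Rightarrow> 'b list)"
    by (intro polytime_expr[of _ "Snd (Var 0)" _ "\<lambda>x. x"]) (auto intro: poly_bounded_intros)
qed simp

text \<open>A list cell is encoded like a pair, and so is the unary successor below; neither calls
  for a program of its own.\<close>

lemma polytime_Cons [polytime_intros]:
  assumes "polytime_on A f" "polytime_on A g" shows "polytime_on A (\<lambda>x. f x # g x)"
  using polytime_pair[OF assms] by (subst polytime_cong_encode) (auto simp: encode_prod_def)

lemma polytime_Suc [polytime_intros]:
  assumes "polytime_on A f" shows "polytime_on A (\<lambda>x. Suc (f x))"
  using polytime_pair[OF polytime_const[of _ Atom] assms]
  by (subst polytime_cong_encode) (auto simp: encode_prod_def encode_bintree_def)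

lemma encode_bool_simps [simp]: "encode True = Cell Atom Atom" "encode False = Atom"
  by (auto simp: encode_bool_def)

lemma polytime_Nil_eq [polytime_intros]:
  assumes "polytime_on A f" shows "polytime_on A (\<lambda>x. f x = [])"
proof (rule polytime_comp[OF assms(1)])
  let ?c = "Cond (Var 0) (Assign 0 EAtom) (Assign 0 (ECell EAtom EAtom))"
  show "polytime_on UNIV (\<lambda>xs :: 'b list. xs = [])"
  proof (rule polytime_onI[where g = "\<lambda>_. 5"])
    fix xs :: "'b list"
    let ?s = "(\<lambda>_. Atom)(0 := encode xs)"
    show "\<exists>t\<le>5. runs ?c (encode xs) t (encode (xs = []))"
    proof (cases xs)
      case Nil
      have "exec ?c ?s (1 + (1 + tsize (Cell Atom Atom))) (?s(0 := Cell Atom Atom))"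
        using Nil by (intro exec_CondF exec_Assign') auto
      moreover have "1 + (1 + tsize (Cell Atom Atom)) \<le> 5" by simp
      ultimately show ?thesis unfolding runs_def using Nil by (metis encode_bool_simps(1) fun_upd_same)
    next
      case (Cons a list)
      have "exec ?c ?s (1 + (1 + tsize Atom)) (?s(0 := Atom))"
        using Cons by (intro exec_CondT exec_Assign') auto
      moreover have "1 + (1 + tsize Atom) \<le> 5" by simp
      ultimately show ?thesis unfolding runs_def using Cons
        by (metis encode_bool_simps(2) fun_upd_same list.distinct(1))
    qed
  qed (intro poly_bounded_intros)
qed simp

lemma polytime_If [polytime_intros]:
  assumes "polytime_on A P" "polytime_on A f" "polytime_on A g"
  shows "polytime_on A (\<lambda>a. if P a then f a else g a)"
  using assms by (intro polytime_if) (auto elim: polytime_subset)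

lemma polytime_not [polytime_intros]:
  assumes "polytime_on A P" shows "polytime_on A (\<lambda>x. \<not> P x)"
proof -
  have "(\<lambda>x. \<not> P x) = (\<lambda>x. if P x then False else True)" by auto
  then show ?thesis by (simp only:) (intro polytime_intros assms)
qed

lemma polytime_conj [polytime_intros]:
  assumes "polytime_on A P" "polytime_on A Q" shows "polytime_on A (\<lambda>x. P x \<and> Q x)"
proof -
  have "(\<lambda>x. P x \<and> Q x) = (\<lambda>x. if P x then Q x else False)" by auto
  then show ?thesis by (simp only:) (intro polytime_intros assms)
qed

lemma polytime_neq_bool [polytime_intros]:
  fixes P :: "_ \<Rightarrow> bool"
  assumes "polytime_on A P" "polytime_on A Q" shows "polytime_on A (\<lambda>x. P x \<noteq> Q x)"
proof -
  have "polytime_on A (\<lambda>x. if P x then \<not> Q x else Q x)"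
    by (intro polytime_intros assms)
  then show ?thesis by (subst polytime_cong[of _ _ "\<lambda>x. if P x then \<not> Q x else Q x"]) auto
qed

text \<open>Unary numbers are lists of atoms, so arithmetic reduces to list functions: sums to
  appending, products to \<open>concat\<close>, differences to \<open>drop\<close>.\<close>

lemma encode_replicate_Atom: "encode (replicate n Atom) = encode n"
  by (induction n) (auto simp: encode_bintree_def)

lemma polytime_replicate_Atom:
  "polytime_on A (\<lambda>x. replicate (f x) Atom) \<longleftrightarrow> polytime_on A f"
  by (rule polytime_cong_encode) (simp add: encode_replicate_Atom)

lemma fold_Cons_rev: "fold (#) xs ys = rev xs @ ys"
  by (induction xs arbitrary: ys) auto

lemma polytime_rev_append:
  assumes "polytime_on A f" "polytime_on A g" shows "polytime_on A (\<lambda>x. rev (f x) @ g x)"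
proof -
  have "polytime_on A (\<lambda>x. fold (#) (f x) (g x))"
  proof (rule polytime_fold_reachable[where B = UNIV and b = "\<lambda>x. esize (f x) + esize (g x)"])
    show "polytime_on UNIV (\<lambda>y. fst (snd y) # snd (snd y))"
      by (intro polytime_intros)
    fix x i
    show "esize (fold (#) (take i (f x)) (g x)) \<le> esize (f x) + esize (g x)"
      using tsize_encode_append[of "rev (take i (f x))" "g x"] tsize_encode_take[of i "f x"]
      by (simp add: fold_Cons_rev)
  qed (intro assms size_bounded_intros UNIV_I)+
  then show ?thesis by (simp add: fold_Cons_rev)
qed

lemma polytime_rev [polytime_intros]:
  assumes "polytime_on A f" shows "polytime_on A (\<lambda>x. rev (f x))"
  using polytime_rev_append[OF assms polytime_const, of "[]"] by simp

lemma polytime_append [polytime_intros]: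
  assumes "polytime_on A f" "polytime_on A g" shows "polytime_on A (\<lambda>x. f x @ g x)"
  using polytime_rev_append[OF polytime_rev[OF assms(1)] assms(2)] by simp

lemma fold_Cons_map: "fold (\<lambda>e acc. f e # acc) xs acc = rev (map f xs) @ acc"
  by (induction xs arbitrary: acc) auto

text \<open>No size hypothesis is called for: each round adds one value of \<open>g\<close>, and
  every such value is polynomial in \<open>?m x\<close>, which bounds all pairs of context and list
  element.\<close>

lemma polytime_map [polytime_intros]:
  assumes L: "polytime_on A L"
    and g: "polytime_on {(x, e). x \<in> A \<and> e \<in> set (L x)} (\<lambda>y. g (fst y) (snd y))"
  shows "polytime_on A (\<lambda>x. map (g x) (L x))"
proof -
  obtain p where p: "\<And>x e. x \<in> A \<Longrightarrow> e \<in> set (L x) \<Longrightarrow>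
      esize (g x e) \<le> poly p (esize (x, e))"
    using size_bounded_polytime[OF g] unfolding size_bounded_def by auto
  let ?m = "\<lambda>x. 1 + esize x + esize (L x)"
  let ?b = "\<lambda>x. Suc (esize (L x) * Suc (poly p (?m x)))"
  have "polytime_on A (\<lambda>x. fold (\<lambda>e acc. g x e # acc) (L x) [])"
  proof (rule polytime_fold_reachable[where B = "{(x, e, acc). x \<in> A \<and> e \<in> set (L x)}" and b = ?b])
    have "polytime_on {(x, e, acc). x \<in> A \<and> e \<in> set (L x)}
        (\<lambda>y. (\<lambda>y. g (fst y) (snd y)) (fst y, fst (snd y)))"
      by (rule polytime_comp[OF _ g]) (auto intro!: polytime_intros)
    then show "polytime_on {(x, e, acc). x \<in> A \<and> e \<in> set (L x)}
        (\<lambda>y. g (fst y) (fst (snd y)) # snd (snd y))"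
      by (intro polytime_intros) simp
    fix x i assume x: "x \<in> A"
    have "esize (map (g x) (take i (L x))) \<le> Suc (length (map (g x) (take i (L x))) * Suc (poly p (?m x)))"
    proof (rule tsize_encode_list_le)
      fix e assume "e \<in> set (map (g x) (take i (L x)))"
      then obtain e' where e': "e' \<in> set (L x)" "e = g x e'" by (auto dest: in_set_takeD)
      then have "esize (x, e') \<le> ?m x" using tsize_encode_mem[of e' "L x"] by simp
      then have "poly p (esize (x, e')) \<le> poly p (?m x)" by (rule poly_nat_mono)
      then show "esize e \<le> poly p (?m x)" using p[OF x e'(1)] unfolding e'(2) by (rule le_trans[rotated])
    qed
    also have "\<dots> \<le> ?b x"
      using length_le_tsize[of "L x"] by (intro Suc_le_mono[THEN iffD2] mult_right_mono) auto
    finally show "esize (fold (\<lambda>e acc. g x e # acc) (take i (L x)) []) \<le> ?b x"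
      by (simp add: fold_Cons_map)
  qed (auto intro!: L size_bounded_intros polytime_intros)
  from polytime_rev[OF this] show ?thesis by (simp add: fold_Cons_map)
qed

lemma fold_append_concat: "fold (\<lambda>e acc. acc @ e) xss acc = acc @ concat xss"
  by (induction xss arbitrary: acc) auto

lemma polytime_concat [polytime_intros]:
  assumes "polytime_on A L" shows "polytime_on A (\<lambda>x. concat (L x))"
proof -
  have "polytime_on A (\<lambda>x. fold (\<lambda>e acc. acc @ e) (L x) [])"
  proof (rule polytime_fold_reachable[where B = UNIV and b = "\<lambda>x. esize (L x)"])
    show "polytime_on UNIV (\<lambda>y. snd (snd y) @ fst (snd y))"
      by (intro polytime_intros)
    fix x i
    show "esize (fold (\<lambda>e acc. acc @ e) (take i (L x)) []) \<le> esize (L x)"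
      using tsize_encode_concat[of "take i (L x)"] tsize_encode_take[of i "L x"]
      by (simp add: fold_append_concat)
  qed (intro assms size_bounded_intros UNIV_I polytime_intros)+
  then show ?thesis by (simp add: fold_append_concat)
qed

lemma polytime_filter [polytime_intros]:
  assumes L: "polytime_on A L"
    and P: "polytime_on {(x, e). x \<in> A \<and> e \<in> set (L x)} (\<lambda>y. P (fst y) (snd y))"
  shows "polytime_on A (\<lambda>x. filter (P x) (L x))"
proof -
  have "filter Q xs = concat (map (\<lambda>e. if Q e then [e] else []) xs)" for Q and xs :: "'b list"
    by (induction xs) auto
  moreover have "polytime_on A (\<lambda>x. concat (map (\<lambda>e. if P x e then [e] else []) (L x)))"
    by (intro polytime_intros L P)
  ultimately show ?thesis by simp
qed

lemma polytime_length [polytime_intros]: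
  assumes "polytime_on A L" shows "polytime_on A (\<lambda>x. length (L x))"
proof -
  have "polytime_on A (\<lambda>x. map (\<lambda>_. Atom) (L x))" by (intro polytime_intros assms)
  then show ?thesis by (simp add: map_replicate_const polytime_replicate_Atom)
qed

lemma polytime_replicate [polytime_intros]:
  assumes "polytime_on A n" "polytime_on A c" shows "polytime_on A (\<lambda>x. replicate (n x) (c x))"
proof -
  have "polytime_on A (\<lambda>x. map (\<lambda>_. c x) (replicate (n x) Atom))"
    by (intro polytime_intros polytime_replicate_Atom[THEN iffD2] assms
        polytime_comp[OF _ assms(2)]) auto
  then show ?thesis by (simp add: map_replicate_const)
qed

lemma polytime_plus [polytime_intros]:
  fixes f g :: "_ \<Rightarrow> nat"
  assumes "polytime_on A f" "polytime_on A g" shows "polytime_on A (\<lambda>x. f x + g x)"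
proof -
  have "polytime_on A (\<lambda>x. length (replicate (f x) Atom @ replicate (g x) Atom))"
    by (intro polytime_intros assms)
  then show ?thesis by simp
qed

lemma polytime_times [polytime_intros]:
  fixes f g :: "_ \<Rightarrow> nat"
  assumes "polytime_on A f" "polytime_on A g" shows "polytime_on A (\<lambda>x. f x * g x)"
proof -
  have "polytime_on A (\<lambda>x. length (concat (map (\<lambda>_. replicate (g x) Atom) (replicate (f x) Atom))))"
    by (intro polytime_intros assms polytime_comp[OF _ assms(2)]) auto
  moreover have "length (concat (map (\<lambda>_. replicate n Atom) (replicate m Atom))) = m * n" for m n :: nat
    by (induction m) auto
  ultimately show ?thesis by simp
qed

lemma fold_tl: "fold (\<lambda>_. tl) (replicate n Atom) xs = drop n xs"
  by (induction n arbitrary: xs) (auto simp: drop_Suc)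

lemma polytime_drop [polytime_intros]:
  assumes "polytime_on A n" "polytime_on A f" shows "polytime_on A (\<lambda>x. drop (n x) (f x))"
proof -
  have "polytime_on A (\<lambda>x. fold (\<lambda>_. tl) (replicate (n x) Atom) (f x))"
  proof (rule polytime_fold_reachable[where B = UNIV and b = "\<lambda>x. esize (f x)"])
    show "polytime_on UNIV (\<lambda>y. tl (snd (snd y)))"
      by (intro polytime_intros)
    fix x i
    show "esize (fold (\<lambda>_. tl) (take i (replicate (n x) Atom)) (f x)) \<le> esize (f x)"
      by (simp only: take_replicate fold_tl tsize_encode_drop)
  qed (intro assms size_bounded_intros UNIV_I polytime_intros)+
  then show ?thesis by (simp only: fold_tl)
qed

lemma polytime_minus [polytime_intros]:
  fixes f g :: "_ \<Rightarrow> nat"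
  assumes "polytime_on A f" "polytime_on A g" shows "polytime_on A (\<lambda>x. f x - g x)"
proof -
  have "polytime_on A (\<lambda>x. length (drop (g x) (replicate (f x) Atom)))"
    by (intro polytime_intros assms)
  then show ?thesis by simp
qed

lemma polytime_le [polytime_intros]:
  fixes f g :: "_ \<Rightarrow> nat"
  assumes "polytime_on A f" "polytime_on A g" shows "polytime_on A (\<lambda>x. f x \<le> g x)"
proof -
  have "polytime_on A (\<lambda>x. drop (g x) (replicate (f x) Atom) = [])"
    by (intro polytime_intros assms)
  then show ?thesis by simp
qed

lemma polytime_eq_nat [polytime_intros]:
  fixes f g :: "_ \<Rightarrow> nat"
  assumes "polytime_on A f" "polytime_on A g" shows "polytime_on A (\<lambda>x. f x = g x)"
proof -
  have "polytime_on A (\<lambda>x. f x \<le> g x \<and> g x \<le> f x)"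
    by (intro polytime_intros assms)
  then show ?thesis by (simp add: eq_iff)
qed

lemma polytime_take [polytime_intros]:
  assumes "polytime_on A n" "polytime_on A f" shows "polytime_on A (\<lambda>x. take (n x) (f x))"
proof -
  have "polytime_on A (\<lambda>x. rev (drop (length (f x) - n x) (rev (f x))))"
    by (intro polytime_intros assms)
  moreover have "rev (drop (length xs - m) (rev xs)) = take m xs" for m and xs :: "'b list"
    by (cases "m \<le> length xs") (simp_all add: rev_drop)
  ultimately show ?thesis by simp
qed

lemma polytime_nth:
  assumes "polytime_on A f" "polytime_on A n" "\<And>x. x \<in> A \<Longrightarrow> n x < length (f x)"
  shows "polytime_on A (\<lambda>x. f x ! n x)"
proof -
  have "polytime_on A (\<lambda>x. hd (drop (n x) (f x)))"
    using assms(3) by (intro polytime_hd polytime_intros assms(1,2)) force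
  then show ?thesis
    using assms(3) by (subst polytime_cong[of _ _ "\<lambda>x. hd (drop (n x) (f x))"]) (auto simp: hd_drop_conv_nth)
qed

text \<open>The next number to be listed is the length of what has been listed so far, so the loop
  keeps no counter.\<close>

lemma fold_upt: "fold (\<lambda>_ acc. length acc # acc) (replicate n Atom) [] = rev [0..<n]"
proof (induction n)
  case (Suc n)
  have "fold (\<lambda>_ acc. length acc # acc) (replicate (Suc n) Atom) [] =
    fold (\<lambda>_ acc. length acc # acc) (replicate n Atom @ [Atom]) []"
    by (simp add: replicate_append_same)
  then show ?case using Suc by simp
qed simp

lemma polytime_upt [polytime_intros]:
  assumes "polytime_on A n" shows "polytime_on A (\<lambda>x. [0..<n x])"
proof -
  let ?b = "\<lambda>x. Suc (esize (n x) * Suc (esize (n x)))"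
  have "polytime_on A (\<lambda>x. fold (\<lambda>_ acc. length acc # acc) (replicate (n x) Atom) [])"
  proof (rule polytime_fold_reachable[where B = UNIV and b = ?b])
    show "polytime_on UNIV (\<lambda>y. length (snd (snd y)) # snd (snd y))"
      by (intro polytime_intros)
    fix x i assume "i \<le> length (replicate (n x) Atom)"
    then have i: "i \<le> n x" by simp
    have "esize [0..<i] \<le> Suc (length [0..<i] * Suc (esize (n x)))"
      using i by (intro tsize_encode_list_le) auto
    also have "\<dots> \<le> ?b x" using i by (intro Suc_le_mono[THEN iffD2] mult_right_mono) auto
    finally show "esize (fold (\<lambda>_ acc. length acc # acc) (take i (replicate (n x) Atom)) []) \<le> ?b x"
      using i by (simp only: take_replicate fold_upt tsize_encode_rev min_absorb1)
  qed (intro assms size_bounded_intros UNIV_I polytime_intros)+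
  from polytime_rev[OF this] show ?thesis by (simp only: fold_upt rev_rev_ident)
qed

lemma polytime_zip [polytime_intros]:
  assumes "polytime_on A f" "polytime_on A g" shows "polytime_on A (\<lambda>x. zip (f x) (g x))"
proof -
  have "polytime_on A (\<lambda>x. map (\<lambda>i. (f x ! i, g x ! i)) (filter (\<lambda>i. Suc i \<le> length (f x) \<and> Suc i \<le> length (g x)) [0..<length (f x)]))"
    by (intro polytime_intros polytime_nth assms polytime_comp[OF _ assms(1)] polytime_comp[OF _ assms(2)])
      auto
  moreover have "map (\<lambda>i. (xs ! i, ys ! i)) (filter (\<lambda>i. Suc i \<le> length xs \<and> Suc i \<le> length ys) [0..<length xs]) = zip xs ys"
    for xs :: "'b list" and ys :: "'c list"
  proof -
    have "filter (\<lambda>i. Suc i \<le> m \<and> Suc i \<le> n) [0..<m] = [0..<min m n]" for m n :: nat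
    proof (cases "m \<le> n")
      case False
      then have "[0..<m] = [0..<n] @ [n..<m]" using upt_add_eq_append[of 0 n "m - n"] by simp
      then show ?thesis using False by simp
    qed (auto intro: filter_True)
    then show ?thesis by (intro nth_equalityI) auto
  qed
  ultimately show ?thesis by simp
qed

lemma polytime_half [polytime_intros]:
  fixes f :: "_ \<Rightarrow> nat"
  assumes "polytime_on A f" shows "polytime_on A (\<lambda>x. f x div 2)"
proof -
  \<comment> \<open>\<open>2 * (i + 1) \<le> m\<close> holds for exactly \<open>m div 2\<close>
    values of \<open>i\<close>.\<close>
  have "polytime_on A (\<lambda>x. length (filter (\<lambda>i. i + i + 2 \<le> f x) [0..<f x]))"
    by (intro polytime_intros polytime_comp[OF _ assms] assms) auto
  moreover have "length (filter (\<lambda>i. i + i + 2 \<le> m) [0..<m]) = m div 2" for m :: nat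
  proof -
    have "length (filter (\<lambda>i. i + i + 2 \<le> m) [0..<m]) = card {i. i < m \<and> i + i + 2 \<le> m}"
      by (subst distinct_length_filter) (auto intro: arg_cong[where f = card])
    also have "{i. i < m \<and> i + i + 2 \<le> m} = {..<m div 2}" by auto
    finally show ?thesis by simp
  qed
  ultimately show ?thesis by simp
qed

lemma polytime_mem [polytime_intros]:
  fixes f :: "_ \<Rightarrow> nat"
  assumes "polytime_on A f" "polytime_on A L" shows "polytime_on A (\<lambda>x. f x \<in> set (L x))"
proof -
  have "polytime_on A (\<lambda>x. filter (\<lambda>e. e = f x) (L x) \<noteq> [])"
    by (intro polytime_intros assms polytime_comp[OF _ assms(1)]) auto
  then show ?thesis by (simp add: filter_empty_conv)
qed

subsection \<open>Affine systems over the field with two elements\<close>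

definition vxor :: "bool list \<Rightarrow> bool list \<Rightarrow> bool list" where
  "vxor u v = map2 (\<noteq>) u v"

lemma in_bits [simp]: "u \<in> bits m \<longleftrightarrow> length u = m"
  by (auto simp: bits_def words_def)

lemma vxor_Cons [simp]: "vxor (a # u) (b # v) = (a \<noteq> b) # vxor u v"
  by (simp add: vxor_def)

lemma vxor_Nil [simp]: "vxor [] v = []" "vxor u [] = []"
  by (simp_all add: vxor_def)

lemma length_vxor [simp]: "length (vxor u v) = min (length u) (length v)"
  by (simp add: vxor_def)

lemma nth_vxor [simp]: "i < length u \<Longrightarrow> i < length v \<Longrightarrow> vxor u v ! i = (u ! i \<noteq> v ! i)"
  by (simp add: vxor_def)

lemma vxor_append:
  "length u = length u' \<Longrightarrow> vxor (u @ v) (u' @ v') = vxor u u' @ vxor v v'"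
  by (simp add: vxor_def)

lemma vxor_commute: "vxor u v = vxor v u"
  by (induction u v rule: list_induct2') auto

lemma vxor_assoc: "vxor (vxor u v) w = vxor u (vxor v w)"
proof (induction u arbitrary: v w)
  case (Cons a u)
  show ?case by (cases v; cases w) (auto simp: Cons)
qed simp

lemma vxor_left_commute: "vxor u (vxor v w) = vxor v (vxor u w)"
  by (metis vxor_assoc vxor_commute)

lemmas vxor_ac = vxor_assoc vxor_commute vxor_left_commute

lemma vxor_self: "vxor u u = replicate (length u) False"
  by (induction u) auto

lemma vxor_zero: "length u \<le> m \<Longrightarrow> vxor u (replicate m False) = u"
proof (induction u arbitrary: m)
  case (Cons a u)
  then show ?case by (cases m) auto
qed simp

lemma vxor_cancel: "length v \<ge> length u \<Longrightarrow> vxor u (vxor v v) = u"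
  by (simp add: vxor_self vxor_zero)

definition lead :: "bool list \<Rightarrow> bool" where
  "lead w \<longleftrightarrow> w \<noteq> [] \<and> hd w"

lemma lead_Cons [simp]: "lead (a # u) = a"
  by (simp add: lead_def)

definition reduce :: "bool list \<Rightarrow> bool list \<Rightarrow> bool list" where
  "reduce v w = tl (if lead w then vxor w v else w)"

text \<open>The zero vector is the default when no direction has a leading one: reduction then
  merely deletes the coordinate.\<close>

definition pivot :: "bool list \<Rightarrow> bool list list \<Rightarrow> bool list" where
  "pivot p B = hd (filter lead B @ [replicate (length p) False])"

text \<open>An affine subspace is given by a point \<open>p\<close> and a list \<open>B\<close> spanning its direction space. One step
  intersects it with the hyperplane on which the leading coordinate vanishes, and deletes that
  coordinate. The pivot itself is reduced to the zero vector, so it need not be removed.\<close>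

definition elim_step :: "bool list \<times> bool list list \<Rightarrow> bool list \<times> bool list list" where
  "elim_step s = (reduce (pivot (fst s) (snd s)) (fst s), map (reduce (pivot (fst s) (snd s))) (snd s))"

definition unit_vec :: "nat \<Rightarrow> nat \<Rightarrow> bool list" where
  "unit_vec d i = map (\<lambda>j. j = i) [0..<d]"

text \<open>Eliminates the first part of the graph \<open>{\<Phi> z @ z | z}\<close> of an affine map; what remains of the
  base point is a zero of \<open>\<Phi>\<close>, if there is one.\<close>

definition affine_zero :: "nat \<Rightarrow> (bool list \<Rightarrow> bool list) \<Rightarrow> bool list" where
  "affine_zero d \<Phi> = (let z0 = replicate d False in
     fst (fold (\<lambda>_. elim_step) (\<Phi> z0)
       (\<Phi> z0 @ z0, map (\<lambda>i. vxor (\<Phi> (unit_vec d i)) (\<Phi> z0) @ unit_vec d i) [0..<d])))"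

text \<open>Directions may be added repeatedly and in any order. Since every vector is its own
  negative, this is the coset of \<open>p\<close> modulo the linear span of
  \<open>B\<close>.\<close>

inductive_set aff_span :: "bool list \<Rightarrow> bool list list \<Rightarrow> bool list set" for p B where
  base: "p \<in> aff_span p B"
| add: "u \<in> aff_span p B \<Longrightarrow> w \<in> set B \<Longrightarrow> vxor u w \<in> aff_span p B"

lemma aff_span_length:
  "u \<in> aff_span p B \<Longrightarrow> length p = m \<Longrightarrow> (\<And>w. w \<in> set B \<Longrightarrow> length w = m) \<Longrightarrow> length u = m"
  by (induction rule: aff_span.induct) auto

lemma pivot_cases:
  "(pivot p B \<in> set B \<and> lead (pivot p B)) \<or>
   (pivot p B = replicate (length p) False \<and> (\<forall>w\<in>set B. \<not> lead w))"
proof (cases "filter lead B")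
  case Nil
  then show ?thesis by (auto simp: pivot_def filter_empty_conv)
next
  case (Cons v vs)
  then have "v \<in> set (filter lead B)" by (metis list.set_intros(1))
  then have "v \<in> set B" "lead v" by auto
  then show ?thesis using Cons by (simp add: pivot_def)
qed

context
  fixes p :: "bool list" and B :: "bool list list" and m :: nat
  assumes len: "length p = Suc m" "\<And>w. w \<in> set B \<Longrightarrow> length w = Suc m"
begin

lemma length_pivot: "length (pivot p B) = Suc m"
  using pivot_cases[of p B] len by auto

text \<open>\<open>reduce v w\<close> is \<open>tl w\<close> plus \<open>lead w\<close> times
  \<open>tl v\<close>, hence linear in \<open>w\<close>; when both summands have a leading one, the
  two copies of the pivot cancel.\<close>

lemma reduce_vxor:
  assumes "length u = Suc m" "length w = Suc m"
  shows "reduce (pivot p B) (vxor u w) = vxor (reduce (pivot p B) u) (reduce (pivot p B) w)"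
proof -
  obtain a u' b w' c v' where "u = a # u'" "w = b # w'" "pivot p B = c # v'"
    using assms length_pivot by (metis length_Suc_conv)
  moreover from this have "length u' = m" "length w' = m" "length v' = m"
    using assms length_pivot by auto
  moreover have "vxor u' (vxor w' (vxor v' v')) = vxor u' w'" "vxor u' (vxor v' (vxor w' v')) = vxor u' w'"
    if "length u' = m" "length w' = m" "length v' = m"
    using that by (simp_all add: vxor_cancel vxor_left_commute[of v' w' v'])
  ultimately show ?thesis using assms
    by (cases a; cases b) (simp_all add: reduce_def vxor_ac)
qed

lemma reduce_mem:
  "u \<in> aff_span p B \<Longrightarrow> reduce (pivot p B) u \<in> aff_span (fst (elim_step (p, B))) (snd (elim_step (p, B)))"
proof (induction rule: aff_span.induct)
  case base
  show ?case by (simp add: elim_step_def aff_span.base)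
next
  case (add u w)
  then show ?case using aff_span_length[OF add(1) len] len(2)[OF add(2)]
    by (subst reduce_vxor) (auto simp: elim_step_def intro: aff_span.add)
qed

lemma elim_step_complete:
  assumes "False # u \<in> aff_span p B"
  shows "u \<in> aff_span (fst (elim_step (p, B))) (snd (elim_step (p, B)))"
  using reduce_mem[OF assms] by (simp add: reduce_def)

text \<open>With the deleted zero put back, a reduced direction is a combination of at most two old
  ones, because a direction with a leading one guarantees a genuine pivot.\<close>

lemma False_reduce:
  assumes w: "w \<in> set B"
  shows "False # reduce (pivot p B) w = (if lead w then vxor w (pivot p B) else w)"
    and "lead w \<Longrightarrow> pivot p B \<in> set B"
proof -
  obtain a w' c v' where *: "w = a # w'" "pivot p B = c # v'"
    using len(2)[OF w] length_pivot by (metis length_Suc_conv)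
  have "lead w \<Longrightarrow> lead (pivot p B) \<and> pivot p B \<in> set B" using pivot_cases[of p B] w by auto
  then show "False # reduce (pivot p B) w = (if lead w then vxor w (pivot p B) else w)"
    and "lead w \<Longrightarrow> pivot p B \<in> set B"
    using * by (auto simp: reduce_def)
qed

text \<open>The hypothesis \<open>ex\<close> says that the hyperplane is met at all. It decides the
  case without a genuine pivot: there all points share the leading bit of \<open>p\<close>, which
  \<open>ex\<close> forces to be \<open>False\<close>, so deleting it loses nothing.\<close>

lemma elim_step_sound:
  assumes ex: "False # u0 \<in> aff_span p B"
    and "u \<in> aff_span (fst (elim_step (p, B))) (snd (elim_step (p, B)))"
  shows "False # u \<in> aff_span p B"
  using assms(2)
proof (induction rule: aff_span.induct)
  case base
  obtain a p' c v' where *: "p = a # p'" "pivot p B = c # v'"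
    using len(1) length_pivot by (metis length_Suc_conv)
  show ?case
  proof (cases "pivot p B \<in> set B \<and> lead (pivot p B)")
    case True
    then have "False # reduce (pivot p B) p = (if lead p then vxor p (pivot p B) else p)"
      using * by (auto simp: reduce_def)
    then show ?thesis using True by (auto simp: elim_step_def intro: aff_span.intros)
  next
    case False
    then have nl: "\<forall>w\<in>set B. \<not> lead w" using pivot_cases[of p B] by blast
    have "lead u = lead p" if "u \<in> aff_span p B" for u
      using that
    proof (induction rule: aff_span.induct)
      case (add u w)
      have "length u = Suc m" "length w = Suc m" using aff_span_length[OF add(1) len] len(2)[OF add(2)] by auto
      then show ?case using nl add by (cases u; cases w) auto
    qed simp
    from this[OF ex] show ?thesis using * by (auto simp: elim_step_def reduce_def intro: aff_span.base)
  qed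
next
  case (add u w)
  then obtain w' where w': "w' \<in> set B" "w = reduce (pivot p B) w'" by (auto simp: elim_step_def)
  have "False # vxor u w = vxor (False # u) (False # reduce (pivot p B) w')" using w' by simp
  also have "\<dots> = (if lead w' then vxor (vxor (False # u) w') (pivot p B) else vxor (False # u) w')"
    by (simp add: False_reduce(1)[OF w'(1)] vxor_assoc)
  also have "\<dots> \<in> aff_span p B"
    using add.IH w'(1) False_reduce(2)[OF w'(1)] by (auto intro!: aff_span.add)
  finally show ?case .
qed

lemma length_elim_step:
  "length (fst (elim_step (p, B))) = m" "w \<in> set (snd (elim_step (p, B))) \<Longrightarrow> length w = m"
  using len length_pivot by (auto simp: elim_step_def reduce_def)

end

text \<open>Only the length of \<open>xs\<close> matters: it counts the coordinates to be
  eliminated. \<open>affine_zero\<close> uses a value of \<open>\<Phi>\<close> as this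
  counter.\<close>

lemma fold_elim_step:
  assumes "length p = length xs + d" "\<And>w. w \<in> set B \<Longrightarrow> length w = length xs + d"
  shows "length (fst (fold (\<lambda>_. elim_step) xs (p, B))) = d \<and>
    (replicate (length xs) False @ z \<in> aff_span p B \<longrightarrow>
     replicate (length xs) False @ fst (fold (\<lambda>_. elim_step) xs (p, B)) \<in> aff_span p B)"
  using assms
proof (induction xs arbitrary: p B)
  case Nil
  then show ?case by (simp add: aff_span.base)
next
  case (Cons x xs)
  obtain p1 B1 where s: "elim_step (p, B) = (p1, B1)" by force
  have len: "length p = Suc (length xs + d)" "\<And>w. w \<in> set B \<Longrightarrow> length w = Suc (length xs + d)"
    using Cons.prems by auto
  note IH = Cons.IH[of p1 B1]
  have "length p1 = length xs + d" "\<And>w. w \<in> set B1 \<Longrightarrow> length w = length xs + d"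
    using length_elim_step[where B = B, OF len] s by auto
  note IH = IH[OF this]
  show ?case
  proof (intro conjI impI)
    show "length (fst (fold (\<lambda>_. elim_step) (x # xs) (p, B))) = d" using IH s by simp
    assume "replicate (length (x # xs)) False @ z \<in> aff_span p B"
    then have f: "False # (replicate (length xs) False @ z) \<in> aff_span p B" by simp
    from elim_step_complete[OF len this]
    have "replicate (length xs) False @ z \<in> aff_span p1 B1" by (simp add: s)
    with IH have "replicate (length xs) False @ fst (fold (\<lambda>_. elim_step) xs (p1, B1)) \<in> aff_span p1 B1"
      by blast
    then have "False # replicate (length xs) False @ fst (fold (\<lambda>_. elim_step) xs (p1, B1)) \<in> aff_span p B"
      by (intro elim_step_sound[where B = B, OF len f]) (simp_all add: s)
    then show "replicate (length (x # xs)) False @ fst (fold (\<lambda>_. elim_step) (x # xs) (p, B)) \<in> aff_span p B"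
      by (simp add: s)
  qed
qed

lemma length_unit_vec [simp]: "length (unit_vec d i) = d"
  by (simp add: unit_vec_def)

lemma length_affine_zero:
  assumes "\<And>z. length z = d \<Longrightarrow> length (\<Phi> z) = D"
  shows "length (affine_zero d \<Phi>) = d"
proof -
  let ?z0 = "replicate d False"
  have "length (fst (fold (\<lambda>_. elim_step) (\<Phi> ?z0)
       (\<Phi> ?z0 @ ?z0, map (\<lambda>i. vxor (\<Phi> (unit_vec d i)) (\<Phi> ?z0) @ unit_vec d i) [0..<d]))) = d"
    using fold_elim_step[of "\<Phi> ?z0 @ ?z0" "\<Phi> ?z0" d "map (\<lambda>i. vxor (\<Phi> (unit_vec d i)) (\<Phi> ?z0) @ unit_vec d i) [0..<d]"]
    by (fastforce simp: assms)
  then show ?thesis by (simp add: affine_zero_def Let_def)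
qed

text \<open>The identity for a sum of three points characterises affine maps over two elements,
  without splitting off the constant part. Elimination cannot miss a solution, because the graph of
  \<open>\<Phi>\<close> is an affine subspace and the zeros are its points with vanishing first
  part.\<close>

theorem affine_zero:
  assumes len: "\<And>z. length z = d \<Longrightarrow> length (\<Phi> z) = D"
    and affine: "\<And>u v w. length u = d \<Longrightarrow> length v = d \<Longrightarrow> length w = d \<Longrightarrow>
      \<Phi> (vxor u (vxor v w)) = vxor (\<Phi> u) (vxor (\<Phi> v) (\<Phi> w))"
    and z: "length z = d" "True \<notin> set (\<Phi> z)"
  shows "True \<notin> set (\<Phi> (affine_zero d \<Phi>))"
proof -
  define z0 where "z0 = replicate d False"
  define B where "B = map (\<lambda>i. vxor (\<Phi> (unit_vec d i)) (\<Phi> z0) @ unit_vec d i) [0..<d]"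
  let ?S = "aff_span (\<Phi> z0 @ z0) B"
  have lo [simp]: "length z0 = d" by (simp add: z0_def)
  \<comment> \<open>Adding a direction to a graph point gives a graph point; this is affinity with
    the zero vector \<open>z0\<close> as the third point.\<close>
  have step: "vxor (\<Phi> u @ u) (vxor (\<Phi> v) (\<Phi> z0) @ v) = \<Phi> (vxor u v) @ vxor u v"
    if "length u = d" "length v = d" for u v
  proof -
    have "vxor u (vxor v z0) = vxor u v" using that by (simp add: z0_def vxor_zero)
    then show ?thesis using affine[of u v z0] that by (simp add: vxor_append len)
  qed
  have graph: "\<exists>v. length v = d \<and> u = \<Phi> v @ v" if "u \<in> ?S" for u
    using that
  proof (induction rule: aff_span.induct)
    case base
    show ?case using lo by blast
  next
    case (add u w)
    then obtain v i where v: "length v = d" "u = \<Phi> v @ v" "w = vxor (\<Phi> (unit_vec d i)) (\<Phi> z0) @ unit_vec d i"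
      by (auto simp: B_def)
    then have "vxor u w = \<Phi> (vxor v (unit_vec d i)) @ vxor v (unit_vec d i)" using step by simp
    then show ?case using v(1) by (intro exI[of _ "vxor v (unit_vec d i)"]) auto
  qed
  \<comment> \<open>The graph point over \<open>z\<close> is reached from the base point by
    switching on the bits of \<open>z\<close> one after the other.\<close>
  have "\<Phi> (take j z @ replicate (d - j) False) @ take j z @ replicate (d - j) False \<in> ?S" if "j \<le> d" for j
    using that
  proof (induction j)
    case 0
    then show ?case by (simp add: aff_span.base flip: z0_def)
  next
    case (Suc j)
    let ?z = "take j z @ replicate (d - j) False"
    have lz: "length ?z = d" using Suc.prems z(1) by simp
    have IH: "\<Phi> ?z @ ?z \<in> ?S" using Suc by simp
    have "take (Suc j) z @ replicate (d - Suc j) False = (if z ! j then vxor ?z (unit_vec d j) else ?z)"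
      using Suc.prems z(1)
      by (intro nth_equalityI) (auto simp: nth_append unit_vec_def less_Suc_eq)
    moreover have "\<Phi> (vxor ?z (unit_vec d j)) @ vxor ?z (unit_vec d j) \<in> ?S"
      using aff_span.add[OF IH, of "vxor (\<Phi> (unit_vec d j)) (\<Phi> z0) @ unit_vec d j"] step[OF lz, of "unit_vec d j"] Suc.prems
      by (simp add: B_def)
    ultimately show ?case using IH by (simp split: if_splits)
  qed
  from this[of d] have "\<Phi> z @ z \<in> ?S" using z by simp
  moreover have "\<Phi> z = replicate D False"
    using z len[OF z(1)] by (intro replicate_eqI) (metis (full_types))+
  ultimately have "replicate D False @ z \<in> ?S" by simp
  moreover have "length (fst (fold (\<lambda>_. elim_step) (\<Phi> z0) (\<Phi> z0 @ z0, B))) = d \<and>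
      (replicate (length (\<Phi> z0)) False @ z \<in> ?S \<longrightarrow>
       replicate (length (\<Phi> z0)) False @ fst (fold (\<lambda>_. elim_step) (\<Phi> z0) (\<Phi> z0 @ z0, B)) \<in> ?S)"
    by (rule fold_elim_step) (auto simp: B_def len)
  ultimately have "replicate D False @ affine_zero d \<Phi> \<in> ?S"
    by (simp add: len affine_zero_def Let_def B_def flip: z0_def)
  \<comment> \<open>The result of elimination, with its deleted zeros restored, still lies on the
    graph; so the deleted part is the value of \<open>\<Phi>\<close> at the remaining part.\<close>
  from graph[OF this] obtain v where v: "length v = d" "replicate D False @ affine_zero d \<Phi> = \<Phi> v @ v"
    by blast
  then have "replicate D False = \<Phi> v \<and> affine_zero d \<Phi> = v" using len[of v] by (metis append_eq_append_conv length_replicate)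
  then show ?thesis by (metis in_set_replicate)
qed


section \<open>Running time of elimination\<close>

lemma polytime_vxor [polytime_intros]:
  assumes "polytime_on A f" "polytime_on A g" shows "polytime_on A (\<lambda>x. vxor (f x) (g x))"
proof -
  have "polytime_on A (\<lambda>x. map (\<lambda>p. fst p \<noteq> snd p) (zip (f x) (g x)))"
    by (intro polytime_intros assms)
  then show ?thesis by (simp add: vxor_def case_prod_beta')
qed

lemma polytime_lead [polytime_intros]:
  assumes "polytime_on A f" shows "polytime_on A (\<lambda>x. lead (f x))"
proof -
  have "polytime_on A (\<lambda>x. filter (\<lambda>b. b) (take 1 (f x)) \<noteq> [])"
    by (intro polytime_intros assms)
  moreover have "lead w \<longleftrightarrow> filter (\<lambda>b. b) (take 1 w) \<noteq> []" for w
    by (cases w) (auto simp: lead_def)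
  ultimately show ?thesis by simp
qed

lemma polytime_reduce [polytime_intros]:
  assumes "polytime_on A f" "polytime_on A g" shows "polytime_on A (\<lambda>x. reduce (f x) (g x))"
  unfolding reduce_def by (intro polytime_intros assms)

lemma polytime_pivot [polytime_intros]:
  assumes "polytime_on A f" "polytime_on A g" shows "polytime_on A (\<lambda>x. pivot (f x) (g x))"
  unfolding pivot_def by (intro polytime_hd polytime_intros assms) simp

lemma polytime_elim_step [polytime_intros]:
  assumes "polytime_on A f" shows "polytime_on A (\<lambda>x. elim_step (f x))"
  unfolding elim_step_def by (intro polytime_intros assms polytime_comp[OF _ assms]) auto

lemma polytime_unit_vec [polytime_intros]:
  assumes "polytime_on A d" "polytime_on A i" shows "polytime_on A (\<lambda>x. unit_vec (d x) (i x))"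
  unfolding unit_vec_def
  by (intro polytime_intros assms polytime_comp[OF _ assms(1)] polytime_comp[OF _ assms(2)]) auto

lemma tsize_encode_bits: "length (u :: bool list) \<le> m \<Longrightarrow> esize u \<le> Suc (m * 4)"
proof -
  assume "length u \<le> m"
  have "esize u \<le> Suc (length u * Suc 3)"
    by (rule tsize_encode_list_le) (simp add: encode_bool_def)
  with \<open>length u \<le> m\<close> show ?thesis by simp
qed

text \<open>Elimination keeps the number of directions and never lengthens a vector, so the state
  stays as small as the initial one. This excludes the growth that iterated polynomial-time steps
  could cause.\<close>

theorem polytime_affine_zero:
  assumes d: "polytime_on A d"
    and \<Phi>: "polytime_on {(x, z). x \<in> A \<and> length z = d x} (\<lambda>y. \<Phi> (fst y) (snd y))"
  shows "polytime_on A (\<lambda>x. affine_zero (d x) (\<Phi> x))"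
proof -
  let ?o = "\<lambda>x. replicate (d x) False"
  let ?L = "\<lambda>x. \<Phi> x (?o x)"
  let ?s = "\<lambda>x. (?L x @ ?o x, map (\<lambda>i. vxor (\<Phi> x (unit_vec (d x) i)) (?L x) @ unit_vec (d x) i) [0..<d x])"
  let ?m = "\<lambda>x. esize (?L x) + esize (d x)"
  let ?b = "\<lambda>x. 1 + Suc (?m x * 4) + Suc (esize (d x) * Suc (Suc (?m x * 4)))"
  let ?I = "\<lambda>x. {(p :: bool list, B :: bool list list). length p \<le> ?m x \<and> length B \<le> d x \<and> (\<forall>w\<in>set B. length w \<le> ?m x)}"
  have \<Phi>': "polytime_on C (\<lambda>y. \<Phi> (f y) (g y))"
    if "polytime_on C f" "polytime_on C g" "\<And>y. y \<in> C \<Longrightarrow> f y \<in> A \<and> length (g y) = d (f y)"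
    for C :: "'c::encodable set" and f g
    using polytime_comp[OF polytime_pair[OF that(1,2)] \<Phi>] that(3) by simp
  have L: "polytime_on A ?L" by (intro \<Phi>' polytime_intros d) auto
  have "polytime_on A (\<lambda>x. fold (\<lambda>_. elim_step) (?L x) (?s x))"
  proof (rule polytime_fold[where I = ?I and b = ?b])
    show "polytime_on A ?s"
      by (intro polytime_intros \<Phi>' L d polytime_comp[OF _ d]) auto
    show "polytime_on {(x, e, s). x \<in> A \<and> e \<in> set (?L x) \<and> s \<in> ?I x} (\<lambda>y. elim_step (snd (snd y)))"
      by (intro polytime_intros)
    show "?s x \<in> ?I x" for x
      using length_le_tsize[of "?L x"] by auto
    have red: "length (reduce v w) \<le> length w" for v w by (auto simp: reduce_def)
    show "elim_step s \<in> ?I x" if "s \<in> ?I x" for x s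
      using that red by (fastforce simp: elim_step_def intro: le_trans)
    show "size_bounded A ?b" by (intro size_bounded_intros L d)
    show "esize s \<le> ?b x" if "s \<in> ?I x" for s x
    proof -
      obtain p B where s: "s = (p, B)" "length p \<le> ?m x" "length B \<le> d x" "\<forall>w\<in>set B. length w \<le> ?m x"
        using \<open>s \<in> ?I x\<close> by blast
      have "esize B \<le> Suc (length B * Suc (Suc (?m x * 4)))"
      proof (rule tsize_encode_list_le)
        fix w assume "w \<in> set B"
        then show "esize w \<le> Suc (?m x * 4)" using s(4) by (intro tsize_encode_bits) blast
      qed
      also have "\<dots> \<le> Suc (esize (d x) * Suc (Suc (?m x * 4)))"
        using s(3) by (intro Suc_le_mono[THEN iffD2] mult_right_mono) auto
      finally show ?thesis using tsize_encode_bits[OF s(2)] unfolding s(1) tsize_encode_pair by linarith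
    qed
  qed (rule L)
  from polytime_fst[OF this] show ?thesis by (simp add: affine_zero_def Let_def)
qed

subsection \<open>Polynomials over a binary field\<close>

definition sxor :: "symbol list \<Rightarrow> symbol list \<Rightarrow> symbol list" where
  "sxor v w = map2 vxor v w"

lemma length_sxor [simp]: "length (sxor v w) = min (length v) (length w)"
  by (simp add: sxor_def)

lemma nth_sxor [simp]: "i < length v \<Longrightarrow> i < length w \<Longrightarrow> sxor v w ! i = vxor (v ! i) (w ! i)"
  by (simp add: sxor_def)

lemma sxor_Cons [simp]: "sxor (a # v) (b # w) = vxor a b # sxor v w"
  by (simp add: sxor_def)

lemma sxor_Nil [simp]: "sxor [] w = []"
  by (simp add: sxor_def)

lemma sxor_append: "length v = length v' \<Longrightarrow> sxor (v @ w) (v' @ w') = sxor v v' @ sxor w w'"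
  by (simp add: sxor_def)

lemma take_sxor: "take i (sxor v w) = sxor (take i v) (take i w)"
  by (simp add: sxor_def take_map take_zip)

lemma drop_sxor: "drop i (sxor v w) = sxor (drop i v) (drop i w)"
  by (simp add: sxor_def drop_map drop_zip)

lemma take_vxor: "take i (vxor v w) = vxor (take i v) (take i w)"
  by (simp add: vxor_def take_map take_zip)

lemma drop_vxor: "drop i (vxor v w) = vxor (drop i v) (drop i w)"
  by (simp add: vxor_def drop_map drop_zip)

lemma length_to_symbols [simp]: "length (to_symbols l n z) = n"
  by (simp add: to_symbols_def)

lemma to_symbols_vxor: "to_symbols l n (vxor u v) = sxor (to_symbols l n u) (to_symbols l n v)"
  by (rule nth_equalityI) (simp_all add: to_symbols_def take_vxor drop_vxor)

lemma to_symbols_Suc: "to_symbols l (Suc n) z = take l z # to_symbols l n (drop l z)"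
proof -
  have "[0..<Suc n] = 0 # map Suc [0..<n]" by (simp add: upt_conv_Cons map_Suc_upt del: upt_Suc)
  then show ?thesis by (simp add: to_symbols_def comp_def add.commute del: upt_Suc)
qed

lemma set_to_symbols: "length z = n * l \<Longrightarrow> set (to_symbols l n z) \<subseteq> bits l"
proof (induction n arbitrary: z)
  case (Suc n)
  then show ?case by (auto simp: to_symbols_Suc)
qed (simp add: to_symbols_def)

lemma concat_to_symbols: "length z = n * l \<Longrightarrow> concat (to_symbols l n z) = z"
proof (induction n arbitrary: z)
  case (Suc n)
  then show ?case by (simp add: to_symbols_Suc)
qed (simp add: to_symbols_def)

lemma to_symbols_concat: "set v \<subseteq> bits l \<Longrightarrow> to_symbols l (length v) (concat v) = v"
proof (induction v)
  case (Cons a v)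
  then show ?case by (simp add: to_symbols_Suc)
qed (simp add: to_symbols_def)

lemma length_concat_bits: "set v \<subseteq> bits l \<Longrightarrow> length (concat v) = length v * l"
  by (induction v) auto

lemma length_concat_map: "(\<And>p. p \<in> set ps \<Longrightarrow> length (g p) = l) \<Longrightarrow> length (concat (map g ps)) = length ps * l"
  by (induction ps) auto

text \<open>Lifts affinity from single equations to a whole system; the equal lengths keep the
  blocks aligned.\<close>

lemma concat_map_vxor3:
  assumes "\<And>p. p \<in> set ps \<Longrightarrow> f p = vxor (g1 p) (vxor (g2 p) (g3 p))"
    and "\<And>p. p \<in> set ps \<Longrightarrow> length (g1 p) = l \<and> length (g2 p) = l \<and> length (g3 p) = l"
  shows "concat (map f ps) = vxor (concat (map g1 ps)) (vxor (concat (map g2 ps)) (concat (map g3 ps)))"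
  using assms
proof (induction ps)
  case (Cons p ps)
  have "length (concat (map g1 ps)) = length ps * l" "length (concat (map g2 ps)) = length ps * l"
    "length (concat (map g3 ps)) = length ps * l"
    by (rule length_concat_map; use Cons.prems(2) in simp)+
  then show ?case using Cons by (simp add: vxor_append)
qed simp

text \<open>The coefficient of lowest degree comes first. In contrast to powers and finite sums in
  an abstract ring, this form uses XOR and multiplication alone, and the all-\<open>False\<close>
  string stands for zero.\<close>

definition horner :: "symbol ring \<Rightarrow> nat \<Rightarrow> symbol list \<Rightarrow> symbol \<Rightarrow> symbol" where
  "horner K l P a = foldr (\<lambda>c acc. vxor c (a \<otimes>\<^bsub>K\<^esub> acc)) P (replicate l False)"

locale gf =
  fixes l :: nat and K :: "symbol ring" (structure)
  assumes bf: "binary_field l K"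

sublocale gf \<subseteq> field K
  using bf by (simp add: binary_field_def)

context gf
begin

lemma carrier_eq: "carrier K = bits l"
  using bf by (simp add: binary_field_def)

lemma carrier_iff: "a \<in> carrier K \<longleftrightarrow> length a = l"
  by (simp add: carrier_eq)

lemma add_eq: "a \<in> carrier K \<Longrightarrow> b \<in> carrier K \<Longrightarrow> vxor a b = a \<oplus> b"
  using bf by (simp add: binary_field_def vxor_def)

text \<open>The zero of \<open>K\<close> is not given as a particular string, but it is its own
  double, hence an XOR of a string with itself, hence all \<open>False\<close>.\<close>

lemma char2: "a \<in> carrier K \<Longrightarrow> a \<oplus> a = \<zero>"
proof -
  have "vxor \<zero> \<zero> = \<zero>" by (simp add: add_eq)
  moreover have "length \<zero> = l" using zero_closed carrier_iff by blast
  ultimately have "\<zero> = replicate l False" by (simp add: vxor_self)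
  moreover assume a: "a \<in> carrier K"
  then have "vxor a a = replicate l False" using carrier_iff by (simp add: vxor_self)
  ultimately show ?thesis using add_eq[OF a a] by simp
qed

lemma zero_eq: "\<zero> = replicate l False"
  using char2[OF zero_closed] add_eq[OF zero_closed zero_closed] carrier_iff[of \<zero>] by (simp add: vxor_self)

lemma char2': "a \<in> carrier K \<Longrightarrow> b \<in> carrier K \<Longrightarrow> a \<oplus> (a \<oplus> b) = b"
  by (simp add: char2 flip: a_assoc)

lemma add_eq_zero: "a \<in> carrier K \<Longrightarrow> b \<in> carrier K \<Longrightarrow> a \<oplus> b = \<zero> \<longleftrightarrow> a = b"
  by (metis char2 char2' r_zero)

lemma l_pos: "0 < l"
proof (rule ccontr)
  assume "\<not> 0 < l"
  then have "\<zero> = \<one>" using zero_closed one_closed carrier_iff by auto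
  then show False using one_not_zero by simp
qed

abbreviation ev :: "symbol list \<Rightarrow> symbol \<Rightarrow> symbol" where
  "ev \<equiv> horner K l"

lemma ev_Nil [simp]: "ev [] a = \<zero>"
  by (simp add: horner_def zero_eq)

lemma ev_closed [simp]: "set P \<subseteq> carrier K \<Longrightarrow> a \<in> carrier K \<Longrightarrow> ev P a \<in> carrier K"
proof (induction P)
  case (Cons c P)
  then show ?case by (simp add: horner_def add_eq)
qed (simp add: horner_def zero_eq carrier_iff)

lemma ev_Cons [simp]:
  "c \<in> carrier K \<Longrightarrow> set P \<subseteq> carrier K \<Longrightarrow> a \<in> carrier K \<Longrightarrow> ev (c # P) a = c \<oplus> a \<otimes> ev P a"
  using ev_closed[of P a] by (simp add: horner_def add_eq)

lemma ev_zeros: "set P \<subseteq> {\<zero>} \<Longrightarrow> a \<in> carrier K \<Longrightarrow> ev P a = \<zero>"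
proof (induction P)
  case (Cons c P)
  then have "set P \<subseteq> carrier K" by auto
  then show ?case using Cons by simp
qed simp

lemma ev_append_zeros:
  "set P \<subseteq> carrier K \<Longrightarrow> set Q \<subseteq> {\<zero>} \<Longrightarrow> a \<in> carrier K \<Longrightarrow> ev (P @ Q) a = ev P a"
proof (induction P)
  case (Cons c P)
  moreover from Cons have "set (P @ Q) \<subseteq> carrier K" by auto
  ultimately show ?case using Cons.IH by (simp del: set_append)
qed (simp add: ev_zeros)

lemma set_sxor:
  "set P \<subseteq> carrier K \<Longrightarrow> set Q \<subseteq> carrier K \<Longrightarrow> set (sxor P Q) \<subseteq> carrier K"
  by (induction P Q rule: list_induct2') (auto simp: add_eq sxor_def)

lemma ev_sxor:
  assumes "length P = length Q" "set P \<subseteq> carrier K" "set Q \<subseteq> carrier K" "a \<in> carrier K"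
  shows "ev (sxor P Q) a = ev P a \<oplus> ev Q a"
  using assms
proof (induction P Q rule: list_induct2)
  case (Cons c P d Q)
  then have "set (sxor P Q) \<subseteq> carrier K" by (intro set_sxor) auto
  with Cons show ?case
    by (simp add: add_eq r_distr a_ac)
qed simp

lemma ev_scale:
  assumes "c \<in> carrier K" "set P \<subseteq> carrier K" "a \<in> carrier K"
  shows "ev (map (\<lambda>b. c \<otimes> b) P) a = c \<otimes> ev P a"
  using assms(2)
proof (induction P)
  case (Cons b P)
  then have "set (map (\<lambda>b. c \<otimes> b) P) \<subseteq> carrier K" using assms by auto
  then show ?case using Cons assms by (simp add: r_distr m_lcomm)
qed (simp add: assms)

text \<open>Inductive step of synthetic division, with \<open>x \<oplus> a\<close> in the role of
  the difference because the characteristic is two.\<close>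

lemma factor_identity:
  assumes "x \<in> carrier K" "a \<in> carrier K" "q \<in> carrier K" "h \<in> carrier K" "c \<in> carrier K"
  shows "c \<oplus> x \<otimes> ((x \<oplus> a) \<otimes> q \<oplus> h) = (x \<oplus> a) \<otimes> (h \<oplus> x \<otimes> q) \<oplus> (c \<oplus> a \<otimes> h)"
proof -
  have "(x \<oplus> a) \<otimes> (h \<oplus> x \<otimes> q) \<oplus> (c \<oplus> a \<otimes> h)
    = a \<otimes> h \<oplus> (a \<otimes> h \<oplus> (c \<oplus> (x \<otimes> h \<oplus> (x \<otimes> (x \<otimes> q) \<oplus> a \<otimes> (x \<otimes> q)))))"
    using assms by (simp add: l_distr r_distr a_ac)
  also have "\<dots> = c \<oplus> (x \<otimes> h \<oplus> (x \<otimes> (x \<otimes> q) \<oplus> a \<otimes> (x \<otimes> q)))"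
    using assms by (intro char2') auto
  also have "\<dots> = c \<oplus> x \<otimes> ((x \<oplus> a) \<otimes> q \<oplus> h)"
    using assms by (simp add: l_distr r_distr a_ac m_ac)
  finally show ?thesis by simp
qed

text \<open>Synthetic division; the remainder is the value at \<open>a\<close>. The last coefficient
  is tracked in place of a degree, which a list with trailing zeros does not show.\<close>

lemma root_factor:
  assumes "length P = Suc d" "set P \<subseteq> carrier K" "a \<in> carrier K"
  shows "\<exists>Q. length Q = d \<and> set Q \<subseteq> carrier K \<and> (0 < d \<longrightarrow> last Q = last P) \<and>
    (\<forall>x\<in>carrier K. ev P x = (x \<oplus> a) \<otimes> ev Q x \<oplus> ev P a)"
  using assms(1,2)
proof (induction d arbitrary: P)
  case 0
  then obtain c where "P = [c]" "c \<in> carrier K" by (auto simp: length_Suc_conv)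
  then show ?case using assms by (intro exI[of _ "[]"]) simp
next
  case (Suc d)
  then obtain c P' where P: "P = c # P'" "length P' = Suc d" "set P' \<subseteq> carrier K" "c \<in> carrier K"
    by (cases P) auto
  with Suc.IH obtain Q where Q: "length Q = d" "set Q \<subseteq> carrier K" "0 < d \<longrightarrow> last Q = last P'"
    "\<forall>x\<in>carrier K. ev P' x = (x \<oplus> a) \<otimes> ev Q x \<oplus> ev P' a" by blast
  have last: "last (ev P' a # Q) = last P"
  proof (cases "d = 0")
    case True
    then obtain b where "P' = [b]" "b \<in> carrier K" using P by (auto simp: length_Suc_conv)
    then show ?thesis using True Q P assms by simp
  qed (use Q P in auto)
  have eq: "ev P x = (x \<oplus> a) \<otimes> ev (ev P' a # Q) x \<oplus> ev P a" if x: "x \<in> carrier K" for x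
  proof -
    have "ev P x = c \<oplus> x \<otimes> ((x \<oplus> a) \<otimes> ev Q x \<oplus> ev P' a)"
      using bspec[OF Q(4) x] x P by simp
    also have "\<dots> = (x \<oplus> a) \<otimes> (ev P' a \<oplus> x \<otimes> ev Q x) \<oplus> (c \<oplus> a \<otimes> ev P' a)"
      by (intro factor_identity x assms(3) P(3,4) Q(2) ev_closed)
    finally show ?thesis using x assms(3) P Q(2) by simp
  qed
  have "length (ev P' a # Q) = Suc d" "set (ev P' a # Q) \<subseteq> carrier K" using P(3) Q(1,2) assms(3) by auto
  with last eq show ?case by blast
qed

text \<open>Dividing out one root shortens the list by one and keeps its last entry, until a single
  constant with a root is left.\<close>

lemma last_eq_zero:
  assumes "length P = Suc d" "set P \<subseteq> carrier K" "S \<subseteq> carrier K" "card S = Suc d" "\<forall>x\<in>S. ev P x = \<zero>"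
  shows "last P = \<zero>"
  using assms
proof (induction d arbitrary: P S)
  case 0
  then obtain c x where "P = [c]" "S = {x}" by (auto simp: length_Suc_conv card_1_singleton_iff)
  then show ?case using 0 by simp
next
  case (Suc d)
  then obtain a where a: "a \<in> S" by (metis card.empty equals0I nat.distinct(1))
  then have aK: "a \<in> carrier K" using Suc by blast
  obtain Q where Q: "length Q = Suc d" "set Q \<subseteq> carrier K" "last Q = last P"
    "\<forall>x\<in>carrier K. ev P x = (x \<oplus> a) \<otimes> ev Q x \<oplus> ev P a"
    using root_factor[OF Suc.prems(1,2) aK] by auto
  have "ev Q x = \<zero>" if "x \<in> S - {a}" for x
  proof -
    have x: "x \<in> carrier K" "x \<noteq> a" using that Suc by auto
    have "ev P x = (x \<oplus> a) \<otimes> ev Q x \<oplus> ev P a" using Q(4) x(1) by blast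
    moreover have "ev P x = \<zero>" "ev P a = \<zero>" using that a Suc.prems(5) by auto
    ultimately have "(x \<oplus> a) \<otimes> ev Q x = \<zero>" using x aK Q(2) by simp
    moreover have "x \<oplus> a \<noteq> \<zero>" using x aK by (simp add: add_eq_zero)
    ultimately show ?thesis using x aK Q(2) by (metis a_closed ev_closed integral_iff)
  qed
  moreover have "card (S - {a}) = Suc d" using a Suc by simp
  moreover have "S - {a} \<subseteq> carrier K" using Suc.prems(3) by blast
  ultimately have "last Q = \<zero>" using Suc.IH[OF Q(1,2)] by blast
  then show ?case using Q by simp
qed

lemma all_zero:
  assumes "set P \<subseteq> carrier K" "S \<subseteq> carrier K" "length P \<le> card S" "\<forall>x\<in>S. ev P x = \<zero>"
  shows "set P \<subseteq> {\<zero>}"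
  using assms(1,3,4)
proof (induction P rule: rev_induct)
  case (snoc c P)
  obtain S' where S': "S' \<subseteq> S" "card S' = Suc (length P)"
    using snoc.prems by (metis length_append_singleton obtain_subset_with_card_n)
  have c: "c = \<zero>" using last_eq_zero[of "P @ [c]" "length P" S'] S' snoc.prems assms(2) by auto
  have "ev P x = \<zero>" if "x \<in> S" for x
    using that snoc.prems c ev_append_zeros[of P "[\<zero>]" x] assms(2) by auto
  then show ?case using snoc c by auto
qed simp

text \<open>The product of the factors \<open>x \<oplus> a\<close>, scaled by \<open>w\<close>.
  Entries of \<open>as\<close> may repeat, by which the degree can be raised to a prescribed
  value.\<close>

lemma locator:
  assumes "set as \<subseteq> carrier K" "w \<in> carrier K"
  shows "\<exists>E. length E = Suc (length as) \<and> set E \<subseteq> carrier K \<and> last E = w \<and> (\<forall>x\<in>set as. ev E x = \<zero>)"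
  using assms(1)
proof (induction as)
  case Nil
  show ?case using assms by (intro exI[of _ "[w]"]) simp
next
  case (Cons a as)
  then obtain E where E: "length E = Suc (length as)" "set E \<subseteq> carrier K" "last E = w"
    "\<forall>x\<in>set as. ev E x = \<zero>" by auto
  \<comment> \<open>Multiplication by \<open>x \<oplus> a\<close>: a shift of the coefficients plus
    \<open>a\<close> times the old ones, padded to equal length.\<close>
  let ?A = "\<zero> # E" and ?B = "map (\<lambda>b. a \<otimes> b) E @ [\<zero>]"
  have a: "a \<in> carrier K" using Cons by simp
  have sub: "set ?A \<subseteq> carrier K" "set ?B \<subseteq> carrier K" "length ?A = length ?B" using E a by auto
  have eval: "ev (sxor ?A ?B) x = x \<otimes> ev E x \<oplus> a \<otimes> ev E x" if x: "x \<in> carrier K" for x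
  proof -
    have "ev ?B x = a \<otimes> ev E x"
      using ev_append_zeros[of "map (\<lambda>b. a \<otimes> b) E" "[\<zero>]" x] ev_scale[OF a E(2) x] x sub by simp
    then show ?thesis using ev_sxor[OF sub(3,1,2) x] x E by simp
  qed
  have "last (sxor ?A ?B) = w"
  proof -
    have E': "E = butlast E @ [w]" using E by (metis append_butlast_last_id length_0_conv nat.distinct(1))
    have "length (\<zero> # butlast E) = length (map (\<lambda>b. a \<otimes> b) E)" using E by simp
    from sxor_append[OF this, of "[w]" "[\<zero>]"]
    have "sxor ?A ?B = sxor (\<zero> # butlast E) (map (\<lambda>b. a \<otimes> b) E) @ [vxor w \<zero>]" using E' by simp
    then show ?thesis using assms by (simp add: add_eq)
  qed
  moreover have "ev (sxor ?A ?B) x = \<zero>" if "x \<in> set (a # as)" for x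
  proof -
    have x: "x \<in> carrier K" using that Cons by auto
    show ?thesis
    proof (cases "x = a")
      case True
      then show ?thesis using eval[OF x] x E by (simp add: char2)
    next
      case False
      then show ?thesis using eval[OF x] x E that a by simp
    qed
  qed
  ultimately show ?case using set_sxor[OF sub(1,2)] E by (intro exI[of _ "sxor ?A ?B"]) simp
qed

lemma mult_poly:
  assumes "length E = Suc d" "set E \<subseteq> carrier K" "set P \<subseteq> carrier K"
  shows "\<exists>R. length R = length P + d \<and> set R \<subseteq> carrier K \<and> (\<forall>x\<in>carrier K. ev R x = ev P x \<otimes> ev E x)"
  using assms(3)
proof (induction P)
  case Nil
  have "\<forall>x\<in>carrier K. ev (replicate d \<zero>) x = \<zero>" by (auto intro!: ev_zeros)
  then show ?case using assms by (intro exI[of _ "replicate d \<zero>"]) auto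
next
  case (Cons c P)
  then obtain R where R: "length R = length P + d" "set R \<subseteq> carrier K"
    "\<forall>x\<in>carrier K. ev R x = ev P x \<otimes> ev E x" by auto
  let ?A = "map (\<lambda>b. c \<otimes> b) E @ replicate (length P) \<zero>" and ?B = "\<zero> # R"
  have c: "c \<in> carrier K" using Cons by simp
  have sub: "set ?A \<subseteq> carrier K" "set ?B \<subseteq> carrier K" "length ?A = length ?B" using R c assms by auto
  have "ev (sxor ?A ?B) x = ev (c # P) x \<otimes> ev E x" if x: "x \<in> carrier K" for x
  proof -
    have "set (replicate (length P) \<zero>) \<subseteq> {\<zero>}" by auto
    then have "ev ?A x = c \<otimes> ev E x"
      using ev_append_zeros[of "map (\<lambda>b. c \<otimes> b) E" "replicate (length P) \<zero>" x] ev_scale[OF c assms(2) x] x sub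
      by simp
    then show ?thesis using ev_sxor[OF sub(3,1,2) x] x R Cons.prems assms(2) by (simp add: l_distr m_assoc)
  qed
  then show ?case using set_sxor[OF sub(1,2)] R assms by (intro exI[of _ "sxor ?A ?B"]) simp
qed

lemma finsum_horner:
  assumes "set m \<subseteq> carrier K" "a \<in> carrier K"
  shows "(\<Oplus>i\<in>{..<length m}. (m ! i) \<otimes> (a [^] i)) = ev m a"
  using assms(1)
proof (induction m)
  case (Cons c m)
  have mi: "m ! i \<in> carrier K" if "i < length m" for i using Cons that by auto
  have "(\<Oplus>i\<in>{..<length (c # m)}. ((c # m) ! i) \<otimes> (a [^] i))
     = (\<Oplus>i\<in>insert 0 (Suc ` {..<length m}). ((c # m) ! i) \<otimes> (a [^] i))"
    by (simp add: lessThan_Suc_eq_insert_0)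
  also have "\<dots> = c \<oplus> (\<Oplus>i\<in>Suc ` {..<length m}. ((c # m) ! i) \<otimes> (a [^] i))"
    using Cons.prems assms mi by (subst finsum_insert) auto
  also have "(\<Oplus>i\<in>Suc ` {..<length m}. ((c # m) ! i) \<otimes> (a [^] i)) = (\<Oplus>i\<in>{..<length m}. (m ! i) \<otimes> (a [^] Suc i))"
    using assms mi by (subst finsum_reindex) auto
  also have "\<dots> = (\<Oplus>i\<in>{..<length m}. a \<otimes> ((m ! i) \<otimes> (a [^] i)))"
    using assms mi by (intro finsum_cong') (auto simp: m_ac)
  also have "\<dots> = a \<otimes> (\<Oplus>i\<in>{..<length m}. (m ! i) \<otimes> (a [^] i))"
    using assms mi by (subst finsum_rdistr) auto
  finally show ?case using Cons assms by simp
qed simp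

lemma rs_encode_horner:
  "set m \<subseteq> carrier K \<Longrightarrow> set pts \<subseteq> carrier K \<Longrightarrow> rs_encode K pts m = map (ev m) pts"
  unfolding rs_encode_def by (intro map_cong refl finsum_horner) auto

end

subsection \<open>Decoding Reed--Solomon codes\<close>

text \<open>Berlekamp--Welch decoding over the coordinate bits: the unknowns are the locator polynomial,
  whose leading coefficient is normalised to a fixed nonzero symbol, and its product with the
  message polynomial.\<close>

definition locator_of :: "nat \<Rightarrow> nat \<Rightarrow> nat \<Rightarrow> bool list \<Rightarrow> symbol list" where
  "locator_of l e k z = take e (to_symbols l (e + e + k) z) @ [True # replicate (l - 1) False]"

definition product_of :: "nat \<Rightarrow> nat \<Rightarrow> nat \<Rightarrow> bool list \<Rightarrow> symbol list" where
  "product_of l e k z = drop e (to_symbols l (e + e + k) z)"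

definition key_residue :: "symbol ring \<Rightarrow> nat \<Rightarrow> nat \<Rightarrow> nat \<Rightarrow> (symbol \<times> symbol) list \<Rightarrow> bool list \<Rightarrow> bool list" where
  "key_residue K l e k ps z = concat (map (\<lambda>p.
     vxor (snd p \<otimes>\<^bsub>K\<^esub> horner K l (locator_of l e k z) (fst p)) (horner K l (product_of l e k z) (fst p))) ps)"

text \<open>Replaces division of the product polynomial by the locator: the message is required to
  match the received word wherever the locator does not vanish. This system is again affine over
  bits.\<close>

definition message_residue :: "symbol ring \<Rightarrow> nat \<Rightarrow> symbol list \<Rightarrow> nat \<Rightarrow> (symbol \<times> symbol) list \<Rightarrow> bool list \<Rightarrow> bool list" where
  "message_residue K l E k ps z = concat (map (\<lambda>p.
     horner K l E (fst p) \<otimes>\<^bsub>K\<^esub> vxor (horner K l (to_symbols l k z) (fst p)) (snd p)) ps)"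

text \<open>For \<open>k \<le> length y\<close>, the number \<open>e\<close> is the largest one with
  \<open>2 * e + k \<le> length y\<close>, the guaranteed radius of unique decoding.\<close>

definition decoded_locator :: "symbol ring \<Rightarrow> nat \<Rightarrow> symbol list \<Rightarrow> nat \<Rightarrow> symbol list \<Rightarrow> symbol list" where
  "decoded_locator K l pts k y = (let e = (length y - k) div 2 in
     locator_of l e k (affine_zero ((e + e + k) * l) (key_residue K l e k (zip pts y))))"

definition rs_decode :: "symbol ring \<Rightarrow> nat \<Rightarrow> symbol list \<Rightarrow> nat \<Rightarrow> symbol list \<Rightarrow> bool list" where
  "rs_decode K l pts k y =
     affine_zero (k * l) (message_residue K l (decoded_locator K l pts k y) k (zip pts y))"

lemma hamming_eq_card: "length v = n \<Longrightarrow> hamming v w = card {i. i < n \<and> v ! i \<noteq> w ! i}"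
  by (simp add: hamming_def)

context gf
begin

abbreviation "W0 \<equiv> True # replicate (l - 1) False"

lemma W0: "W0 \<in> carrier K" "W0 \<noteq> \<zero>"
  using l_pos by (cases l; simp add: carrier_iff zero_eq)+

lemma vxor_mem: "a \<in> carrier K \<Longrightarrow> b \<in> carrier K \<Longrightarrow> vxor a b \<in> carrier K"
  by (simp add: add_eq)

lemma to_symbols_mem: "length z = n * l \<Longrightarrow> set (to_symbols l n z) \<subseteq> carrier K"
  using set_to_symbols by (simp add: carrier_eq)

lemma locator_of_mem: "length z = (e + e + k) * l \<Longrightarrow> set (locator_of l e k z) \<subseteq> carrier K"
  using to_symbols_mem[of z "e + e + k"] W0 by (auto simp: locator_of_def dest: in_set_takeD)

lemma product_of_mem: "length z = (e + e + k) * l \<Longrightarrow> set (product_of l e k z) \<subseteq> carrier K"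
  using to_symbols_mem[of z "e + e + k"] by (auto simp: product_of_def dest: in_set_dropD)

lemma length_locator_of [simp]: "length (locator_of l e k z) = Suc e"
  by (simp add: locator_of_def)

lemma length_product_of [simp]: "length (product_of l e k z) = e + k"
  by (simp add: product_of_def)

lemma ev_sxor3:
  assumes "length P = length Q" "length P = length R" "set P \<subseteq> carrier K" "set Q \<subseteq> carrier K"
    "set R \<subseteq> carrier K" "a \<in> carrier K"
  shows "ev (sxor P (sxor Q R)) a = ev P a \<oplus> (ev Q a \<oplus> ev R a)"
  using assms ev_sxor[of Q R a] ev_sxor[of P "sxor Q R" a] set_sxor[of Q R] by simp

text \<open>The fixed leading symbol survives because the number of summands is odd. A sum of two
  locators would lose it: the system is affine and not linear.\<close>

lemma locator_of_vxor3:
  "locator_of l e k (vxor u (vxor v w)) =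
     sxor (locator_of l e k u) (sxor (locator_of l e k v) (locator_of l e k w))"
  by (simp add: locator_of_def to_symbols_vxor take_sxor sxor_append vxor_self vxor_zero)

lemma product_of_vxor3:
  "product_of l e k (vxor u (vxor v w)) =
     sxor (product_of l e k u) (sxor (product_of l e k v) (product_of l e k w))"
  by (simp add: product_of_def to_symbols_vxor drop_sxor)

context
  fixes ps :: "(symbol \<times> symbol) list"
  assumes ps: "\<And>p. p \<in> set ps \<Longrightarrow> fst p \<in> carrier K \<and> snd p \<in> carrier K"
begin

lemma key_term_mem:
  assumes "p \<in> set ps" "length z = (e + e + k) * l"
  shows "vxor (snd p \<otimes> ev (locator_of l e k z) (fst p)) (ev (product_of l e k z) (fst p)) \<in> carrier K"
  using ps[OF assms(1)] locator_of_mem[OF assms(2)] product_of_mem[OF assms(2)] by (simp add: add_eq)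

lemma length_key_residue:
  "length z = (e + e + k) * l \<Longrightarrow> length (key_residue K l e k ps z) = length ps * l"
  unfolding key_residue_def using key_term_mem by (intro length_concat_map) (simp add: carrier_iff)

lemma key_residue_vxor3:
  assumes "length u = (e + e + k) * l" "length v = (e + e + k) * l" "length w = (e + e + k) * l"
  shows "key_residue K l e k ps (vxor u (vxor v w)) =
    vxor (key_residue K l e k ps u) (vxor (key_residue K l e k ps v) (key_residue K l e k ps w))"
  unfolding key_residue_def
proof (rule concat_map_vxor3[where l = l])
  fix p assume p: "p \<in> set ps"
  note mem = locator_of_mem[OF assms(1)] locator_of_mem[OF assms(2)] locator_of_mem[OF assms(3)]
    product_of_mem[OF assms(1)] product_of_mem[OF assms(2)] product_of_mem[OF assms(3)]
  show "vxor (snd p \<otimes> ev (locator_of l e k (vxor u (vxor v w))) (fst p)) (ev (product_of l e k (vxor u (vxor v w))) (fst p)) =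
    vxor (vxor (snd p \<otimes> ev (locator_of l e k u) (fst p)) (ev (product_of l e k u) (fst p)))
      (vxor (vxor (snd p \<otimes> ev (locator_of l e k v) (fst p)) (ev (product_of l e k v) (fst p)))
        (vxor (snd p \<otimes> ev (locator_of l e k w) (fst p)) (ev (product_of l e k w) (fst p))))"
    using ps[OF p] mem
    by (simp add: locator_of_vxor3 product_of_vxor3 ev_sxor3 add_eq r_distr a_ac)
qed (use key_term_mem assms in \<open>simp add: carrier_iff\<close>)

context
  fixes E assumes E: "set E \<subseteq> carrier K"
begin

lemma message_term_mem:
  assumes "p \<in> set ps" "length z = k * l"
  shows "ev E (fst p) \<otimes> vxor (ev (to_symbols l k z) (fst p)) (snd p) \<in> carrier K"
  using ps[OF assms(1)] to_symbols_mem[OF assms(2)] E by (simp add: add_eq)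

lemma length_message_residue:
  "length z = k * l \<Longrightarrow> length (message_residue K l E k ps z) = length ps * l"
  unfolding message_residue_def using message_term_mem by (intro length_concat_map) (simp add: carrier_iff)

lemma message_residue_vxor3:
  assumes "length u = k * l" "length v = k * l" "length w = k * l"
  shows "message_residue K l E k ps (vxor u (vxor v w)) =
    vxor (message_residue K l E k ps u) (vxor (message_residue K l E k ps v) (message_residue K l E k ps w))"
  unfolding message_residue_def
proof (rule concat_map_vxor3[where l = l])
  fix p assume p: "p \<in> set ps"
  note mem = to_symbols_mem[OF assms(1)] to_symbols_mem[OF assms(2)] to_symbols_mem[OF assms(3)]
  show "ev E (fst p) \<otimes> vxor (ev (to_symbols l k (vxor u (vxor v w))) (fst p)) (snd p) =
    vxor (ev E (fst p) \<otimes> vxor (ev (to_symbols l k u) (fst p)) (snd p))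
      (vxor (ev E (fst p) \<otimes> vxor (ev (to_symbols l k v) (fst p)) (snd p))
        (ev E (fst p) \<otimes> vxor (ev (to_symbols l k w) (fst p)) (snd p)))"
    using ps[OF p] mem E
    by (simp add: to_symbols_vxor ev_sxor3 add_eq r_distr a_ac char2')
qed (use message_term_mem assms in \<open>simp add: carrier_iff\<close>)

end

lemma residue_zero_iff:
  assumes "\<And>p. p \<in> set ps \<Longrightarrow> g p \<in> carrier K"
  shows "True \<notin> set (concat (map g ps)) \<longleftrightarrow> (\<forall>p\<in>set ps. g p = \<zero>)"
proof -
  have "True \<notin> set a \<longleftrightarrow> a = \<zero>" if "a \<in> carrier K" for a
  proof
    assume "True \<notin> set a"
    then have "\<forall>x\<in>set a. x = False" by (metis (full_types))
    then show "a = \<zero>" using that replicate_length_same[of a False] by (simp add: carrier_iff zero_eq)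
  qed (simp add: zero_eq)
  then show ?thesis using assms by auto
qed

end

lemma zip_mem:
  assumes "set pts \<subseteq> carrier K" "set y \<subseteq> carrier K" "p \<in> set (zip pts y)"
  shows "fst p \<in> carrier K \<and> snd p \<in> carrier K"
  using assms by (metis in_set_zipE prod.collapse subsetD)

lemma decoded_locator_mem:
  assumes "set pts \<subseteq> carrier K" "set y \<subseteq> carrier K"
  shows "set (decoded_locator K l pts k y) \<subseteq> carrier K"
  unfolding decoded_locator_def Let_def
  by (intro locator_of_mem length_affine_zero[where D = "length (zip pts y) * l"]
      length_key_residue zip_mem[OF assms])

text \<open>The true error locator shows that the first system is solvable. Elimination may find
  another solution, but every solution has the form \<open>E1\<close>, \<open>m * E1\<close>, by
  counting the correct positions. As \<open>E1\<close> has at most \<open>e\<close> roots, at least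
  \<open>k\<close> positions remain where the second system determines the message.\<close>

theorem rs_decode:
  assumes m: "set m \<subseteq> carrier K" "length m = k"
    and y: "set y \<subseteq> carrier K" "length y = n"
    and pts: "set pts \<subseteq> carrier K" "length pts = n" "distinct pts"
    and errors: "2 * hamming y (rs_encode K pts m) + k \<le> n"
  shows "rs_decode K l pts k y = concat m"
proof -
  define e where "e = (n - k) div 2"
  let ?ps = "zip pts y"
  define D where "D = (e + e + k) * l"
  note zm = zip_mem[OF pts(1) y(1)]
  have pi: "pts ! i \<in> carrier K" "y ! i \<in> carrier K" if "i < n" for i
    using that pts y nth_mem[of i pts] nth_mem[of i y] by auto
  have ps: "(\<forall>p\<in>set ?ps. P p) \<longleftrightarrow> (\<forall>i<n. P (pts ! i, y ! i))" for P
    using pts(2) y(2) by (auto simp: set_zip)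
  have inj: "inj_on (\<lambda>i. pts ! i) {..<n}" using pts by (auto simp: inj_on_def nth_eq_iff_index_eq)
  define bad where "bad = {i. i < n \<and> y ! i \<noteq> ev m (pts ! i)}"
  have fbad: "finite bad" by (simp add: bad_def)
  have "hamming y (rs_encode K pts m) = card bad"
    unfolding rs_encode_horner[OF m(1) pts(1)] hamming_eq_card[OF y(2)] bad_def
    using pts(2) by (intro arg_cong[where f = card]) auto
  then have bad: "card bad \<le> e" and ekn: "e + e + k \<le> n" using errors by (auto simp: e_def)
  \<comment> \<open>The normalised locator has degree exactly \<open>e\<close>. If there are fewer
    errors, additional roots at zero make up the difference; they do no harm even if zero is an
    evaluation point.\<close>
  define as where "as = map (\<lambda>i. pts ! i) (sorted_list_of_set bad) @ replicate (e - card bad) \<zero>"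
  have "length as = e" using bad fbad by (simp add: as_def)
  have "set as \<subseteq> carrier K" using pi fbad by (auto simp: as_def bad_def)
  with locator[OF _ W0(1)] obtain E where E: "length E = Suc e" "set E \<subseteq> carrier K" "last E = W0"
    "\<forall>x\<in>set as. ev E x = \<zero>" using \<open>length as = e\<close> by blast
  obtain N where N: "length N = k + e" "set N \<subseteq> carrier K" "\<forall>x\<in>carrier K. ev N x = ev m x \<otimes> ev E x"
    using mult_poly[OF E(1,2) m(1)] m(2) by auto
  define z where "z = concat (butlast E @ N)"
  have sEN: "set (butlast E @ N) \<subseteq> bits l" using E N by (auto simp: carrier_eq dest: in_set_butlastD)
  have lz: "length z = D" using length_concat_bits[OF sEN] E N by (simp add: z_def D_def)
  have sym: "to_symbols l (e + e + k) z = butlast E @ N"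
    using to_symbols_concat[OF sEN] E N by (simp add: z_def add.commute add.left_commute)
  have "butlast E @ [W0] = E" using E by (metis append_butlast_last_id length_0_conv nat.distinct(1))
  then have zE: "locator_of l e k z = E" and zN: "product_of l e k z = N"
    using E(1) by (simp_all add: locator_of_def product_of_def sym)
  have key_iff: "True \<notin> set (key_residue K l e k ?ps z) \<longleftrightarrow>
      (\<forall>i<n. y ! i \<otimes> ev (locator_of l e k z) (pts ! i) = ev (product_of l e k z) (pts ! i))"
    if "length z = D" for z
  proof -
    note mem = locator_of_mem[OF that[unfolded D_def]] product_of_mem[OF that[unfolded D_def]]
    have "True \<notin> set (key_residue K l e k ?ps z) \<longleftrightarrow>
      (\<forall>p\<in>set ?ps. vxor (snd p \<otimes> ev (locator_of l e k z) (fst p)) (ev (product_of l e k z) (fst p)) = \<zero>)"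
      unfolding key_residue_def
      by (rule residue_zero_iff[OF zm], assumption) (rule key_term_mem[OF zm _ that[unfolded D_def]])
    then show ?thesis unfolding ps using pi mem by (simp add: add_eq add_eq_zero)
  qed
  \<comment> \<open>At an error both the locator and the product vanish; elsewhere
    \<open>y ! i\<close> is the value of the message polynomial.\<close>
  have "y ! i \<otimes> ev E (pts ! i) = ev N (pts ! i)" if "i < n" for i
  proof (cases "i \<in> bad")
    case True
    then have "pts ! i \<in> set as" using fbad by (auto simp: as_def)
    then show ?thesis using E N pi[OF that] m by auto
  next
    case False
    then show ?thesis using N(3) pi[OF that] that by (auto simp: bad_def)
  qed
  then have "True \<notin> set (key_residue K l e k ?ps z)" using key_iff[OF lz] zE zN by simp
  define z1 where "z1 = affine_zero D (key_residue K l e k ?ps)"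
  have lk: "length (key_residue K l e k ?ps z) = length ?ps * l" if "length z = D" for z
    using that by (intro length_key_residue zm) (simp_all add: D_def)
  have lz1: "length z1 = D" unfolding z1_def by (rule length_affine_zero[where \<Phi> = "key_residue K l e k ?ps", OF lk])
  have "True \<notin> set (key_residue K l e k ?ps z1)" unfolding z1_def
    by (rule affine_zero[where \<Phi> = "key_residue K l e k ?ps", OF lk _ lz \<open>True \<notin> set (key_residue K l e k ?ps z)\<close>])
      (auto intro!: key_residue_vxor3 zm simp: D_def)
  then have key: "y ! i \<otimes> ev (locator_of l e k z1) (pts ! i) = ev (product_of l e k z1) (pts ! i)" if "i < n" for i
    using key_iff[OF lz1] that by blast
  define E1 where "E1 = locator_of l e k z1"
  define N1 where "N1 = product_of l e k z1"
  have E1: "length E1 = Suc e" "set E1 \<subseteq> carrier K" "last E1 = W0"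
    and N1: "length N1 = e + k" "set N1 \<subseteq> carrier K"
    using locator_of_mem[OF lz1[unfolded D_def]] product_of_mem[OF lz1[unfolded D_def]]
    by (simp_all add: E1_def N1_def) (simp add: locator_of_def)
  obtain R where R: "length R = k + e" "set R \<subseteq> carrier K" "\<forall>x\<in>carrier K. ev R x = ev m x \<otimes> ev E1 x"
    using mult_poly[OF E1(1,2) m(1)] m(2) by auto
  \<comment> \<open>The products \<open>R = m * E1\<close> and \<open>N1\<close> agree at the
    correct positions. There are at least \<open>n - e \<ge> e + k\<close> of them, as many as there
    are coefficients, so the two agree everywhere.\<close>
  let ?G = "(\<lambda>i. pts ! i) ` ({..<n} - bad)"
  have "bad \<subseteq> {..<n}" by (auto simp: bad_def)
  then have "card ({..<n} - bad) = n - card bad" using fbad by (simp add: card_Diff_subset)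
  moreover have "card ?G = card ({..<n} - bad)" by (rule card_image) (rule inj_on_subset[OF inj], blast)
  ultimately have "card ?G = n - card bad" by simp
  moreover have "ev (sxor R N1) x = \<zero>" if "x \<in> ?G" for x
  proof -
    obtain i where i: "i < n" "i \<notin> bad" "x = pts ! i" using \<open>x \<in> ?G\<close> by blast
    then have "ev R x = y ! i \<otimes> ev E1 x" using R pi[OF i(1)] by (auto simp: bad_def)
    then show ?thesis using ev_sxor[of R N1 x] R N1 E1 pi[OF i(1)] i key[OF i(1)]
      by (simp add: E1_def N1_def add_eq_zero)
  qed
  moreover have "?G \<subseteq> carrier K" using pi by blast
  ultimately have "set (sxor R N1) \<subseteq> {\<zero>}"
    using R N1 bad ekn set_sxor[OF R(2) N1(2)] by (intro all_zero[of _ ?G]) auto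
  then have RN: "ev R x = ev N1 x" if "x \<in> carrier K" for x
    using ev_zeros[of "sxor R N1" x] ev_sxor[of R N1 x] that R(1,2) N1 by (simp add: add_eq_zero)
  \<comment> \<open>Agreement of the products also at the erroneous positions forces
    \<open>E1\<close> to vanish there, so the true message solves the second system.\<close>
  have all: "ev E1 (pts ! i) \<otimes> (ev m (pts ! i) \<oplus> y ! i) = \<zero>" if "i < n" for i
  proof -
    have "ev E1 (pts ! i) \<otimes> (ev m (pts ! i) \<oplus> y ! i) = ev R (pts ! i) \<oplus> ev N1 (pts ! i)"
      using bspec[OF R(3) pi(1)[OF that]] key[OF that, folded E1_def N1_def, symmetric] pi[OF that] E1 m
      by (simp add: r_distr m_comm)
    then show ?thesis using RN[OF pi(1)[OF that]] R(1,2) N1 pi[OF that] by (simp add: char2)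
  qed
  have msg_iff: "True \<notin> set (message_residue K l E1 k ?ps z) \<longleftrightarrow>
      (\<forall>i<n. ev E1 (pts ! i) \<otimes> (ev (to_symbols l k z) (pts ! i) \<oplus> y ! i) = \<zero>)"
    if "length z = k * l" for z
  proof -
    note mem = to_symbols_mem[OF that]
    have "True \<notin> set (message_residue K l E1 k ?ps z) \<longleftrightarrow>
      (\<forall>p\<in>set ?ps. ev E1 (fst p) \<otimes> vxor (ev (to_symbols l k z) (fst p)) (snd p) = \<zero>)"
      unfolding message_residue_def
      by (rule residue_zero_iff[OF zm], assumption) (rule message_term_mem[OF zm E1(2) _ that])
    then show ?thesis unfolding ps using pi mem by (simp add: add_eq)
  qed
  have mb: "set m \<subseteq> bits l" using m by (simp add: carrier_eq)
  have lm: "length (concat m) = k * l" using length_concat_bits[OF mb] m by simp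
  have "True \<notin> set (message_residue K l E1 k ?ps (concat m))"
    unfolding msg_iff[OF lm] using all to_symbols_concat[OF mb] m(2) by simp
  define z2 where "z2 = affine_zero (k * l) (message_residue K l E1 k ?ps)"
  have lk2: "length (message_residue K l E1 k ?ps z) = length ?ps * l" if "length z = k * l" for z
    using that by (intro length_message_residue zm E1)
  have lz2: "length z2 = k * l" unfolding z2_def by (rule length_affine_zero[where \<Phi> = "message_residue K l E1 k ?ps", OF lk2])
  have "True \<notin> set (message_residue K l E1 k ?ps z2)" unfolding z2_def
    by (rule affine_zero[where \<Phi> = "message_residue K l E1 k ?ps", OF lk2 _ lm \<open>True \<notin> set (message_residue K l E1 k ?ps (concat m))\<close>])
      (auto intro!: message_residue_vxor3 zm E1)
  then have msg: "ev E1 (pts ! i) \<otimes> (ev (to_symbols l k z2) (pts ! i) \<oplus> y ! i) = \<zero>" if "i < n" for i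
    using msg_iff[OF lz2] that by blast
  define w where "w = to_symbols l k z2"
  have w: "length w = k" "set w \<subseteq> carrier K" using to_symbols_mem[OF lz2] by (auto simp: w_def)
  \<comment> \<open>The leading coefficient \<open>W0\<close> of \<open>E1\<close> is nonzero, so at
    most \<open>e\<close> evaluation points are lost, and \<open>n - e \<ge> k\<close> points remain
    to compare the decoded message with \<open>m\<close>.\<close>
  let ?Z = "{x \<in> set pts. ev E1 x = \<zero>}"
  have "card ?Z \<le> e"
  proof (rule ccontr)
    assume "\<not> card ?Z \<le> e"
    then have "Suc e \<le> card ?Z" by simp
    then obtain S where "S \<subseteq> ?Z" "card S = Suc e" by (rule obtain_subset_with_card_n)
    then show False using last_eq_zero[OF E1(1,2), of S] E1(3) W0(2) pts by auto
  qed
  moreover have "card (set pts - ?Z) = n - card ?Z"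
    using pts by (subst card_Diff_subset) (auto simp: distinct_card)
  ultimately have "length (sxor w m) \<le> card (set pts - ?Z)" using w m ekn by simp
  moreover have "\<forall>x\<in>set pts - ?Z. ev (sxor w m) x = \<zero>"
  proof
    fix x assume x: "x \<in> set pts - ?Z"
    then obtain i where i: "i < n" "x = pts ! i" using pts by (auto simp: in_set_conv_nth)
    have *: "a = b" if "ev E1 x \<otimes> (a \<oplus> b) = \<zero>" "a \<in> carrier K" "b \<in> carrier K" for a b
    proof -
      have "a \<oplus> b = \<zero>" using that x i pi[OF i(1)] E1(2)
        by (metis (mono_tags, lifting) DiffD2 a_closed ev_closed integral_iff mem_Collect_eq nth_mem pts(2))
      then show ?thesis using that add_eq_zero by blast
    qed
    have "ev w x = y ! i"
    proof (rule *)
      show "ev E1 x \<otimes> (ev w x \<oplus> y ! i) = \<zero>" using msg[OF i(1)] by (simp add: i w_def)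
    qed (use w pi[OF i(1)] i in auto)
    moreover have "ev m x = y ! i"
    proof (rule *)
      show "ev E1 x \<otimes> (ev m x \<oplus> y ! i) = \<zero>" using all[OF i(1)] by (simp add: i)
    qed (use m pi[OF i(1)] i in auto)
    ultimately show "ev (sxor w m) x = \<zero>" using w m pi[OF i(1)] by (subst ev_sxor) (auto simp: i char2)
  qed
  moreover have "set pts - ?Z \<subseteq> carrier K" using pts by blast
  ultimately have zero: "set (sxor w m) \<subseteq> {\<zero>}" using set_sxor[OF w(2) m(1)] by (intro all_zero) auto
  have "w = m"
  proof (rule nth_equalityI)
    fix i assume i: "i < length w"
    then have "sxor w m ! i = \<zero>" using zero w m nth_mem[of i "sxor w m"] by auto
    moreover have "w ! i \<in> carrier K" "m ! i \<in> carrier K" using i w m nth_mem by (metis subsetD)+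
    ultimately show "w ! i = m ! i" using i w m by (simp add: add_eq add_eq_zero)
  qed (simp add: w m)
  then have "z2 = concat m" using concat_to_symbols[OF lz2] by (simp add: w_def)
  moreover have "decoded_locator K l pts k y = E1"
    by (simp add: decoded_locator_def Let_def y(2) E1_def z1_def D_def flip: e_def)
  ultimately show ?thesis by (simp add: rs_decode_def z2_def)
qed

end

subsection \<open>Running time of the decoder\<close>

lemma polytime_to_symbols [polytime_intros]:
  assumes "polytime_on A L" "polytime_on A n" "polytime_on A z"
  shows "polytime_on A (\<lambda>x. to_symbols (L x) (n x) (z x))"
  unfolding to_symbols_def
  by (intro polytime_intros assms polytime_comp[OF _ assms(1)] polytime_comp[OF _ assms(3)]) auto

lemma polytime_sxor [polytime_intros]:
  assumes "polytime_on A f" "polytime_on A g" shows "polytime_on A (\<lambda>x. sxor (f x) (g x))"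
proof -
  have "polytime_on A (\<lambda>x. map (\<lambda>p. vxor (fst p) (snd p)) (zip (f x) (g x)))"
    by (intro polytime_intros assms)
  then show ?thesis by (simp add: sxor_def case_prod_beta')
qed

lemma polytime_locator_of [polytime_intros]:
  assumes "polytime_on A L" "polytime_on A e" "polytime_on A k" "polytime_on A z"
  shows "polytime_on A (\<lambda>x. locator_of (L x) (e x) (k x) (z x))"
  unfolding locator_of_def by (intro polytime_intros assms)

lemma polytime_product_of [polytime_intros]:
  assumes "polytime_on A L" "polytime_on A e" "polytime_on A k" "polytime_on A z"
  shows "polytime_on A (\<lambda>x. product_of (L x) (e x) (k x) (z x))"
  unfolding product_of_def by (intro polytime_intros assms)

locale fields =
  fixes sec0 :: nat and l :: "nat \<Rightarrow> nat" and K :: "nat \<Rightarrow> symbol ring"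
  assumes fields: "efficient_binary_fields sec0 l K"
begin

lemma gf: "sec0 \<le> sec \<Longrightarrow> gf (l sec) (K sec)"
  using fields by (simp add: efficient_binary_fields_def gf_def)

lemma mem_iff: "sec0 \<le> sec \<Longrightarrow> a \<in> carrier (K sec) \<longleftrightarrow> length a = l sec"
  using gf.carrier_iff[OF gf] .

lemma polytime_mult:
  assumes "polytime_on A s" "polytime_on A f" "polytime_on A g"
    and "\<And>x. x \<in> A \<Longrightarrow> sec0 \<le> s x \<and> f x \<in> carrier (K (s x)) \<and> g x \<in> carrier (K (s x))"
  shows "polytime_on A (\<lambda>x. f x \<otimes>\<^bsub>K (s x)\<^esub> g x)"
proof -
  have "polytime_on {(sec, a, b). sec0 \<le> sec \<and> a \<in> carrier (K sec) \<and> b \<in> carrier (K sec)}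
       (\<lambda>(sec, a, b). a \<otimes>\<^bsub>K sec\<^esub> b)"
    using fields by (simp add: efficient_binary_fields_def)
  from polytime_comp[OF polytime_pair[OF assms(1) polytime_pair[OF assms(2,3)]] this]
  show ?thesis using assms(4) by simp
qed

text \<open>Multiplication has a time bound only on field elements, hence the carrier as loop
  invariant. The symbol length is a separate argument because its computability is established only
  later, from the evaluation points.\<close>

lemma polytime_horner:
  assumes s: "polytime_on A s" and L: "polytime_on A L" and P: "polytime_on A P" and a: "polytime_on A a"
    and dom: "\<And>x. x \<in> A \<Longrightarrow> sec0 \<le> s x \<and> L x = l (s x) \<and> set (P x) \<subseteq> carrier (K (s x)) \<and> a x \<in> carrier (K (s x))"
  shows "polytime_on A (\<lambda>x. horner (K (s x)) (L x) (P x) (a x))"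
proof -
  let ?I = "\<lambda>x. carrier (K (s x))"
  have "polytime_on A (\<lambda>x. fold (\<lambda>c acc. vxor c (a x \<otimes>\<^bsub>K (s x)\<^esub> acc)) (rev (P x)) (replicate (L x) False))"
  proof (rule polytime_fold[where I = ?I and b = "\<lambda>x. Suc (esize (L x) * 4)"])
    show "polytime_on {(x, c, acc). x \<in> A \<and> c \<in> set (rev (P x)) \<and> acc \<in> ?I x}
        (\<lambda>y. vxor (fst (snd y)) (a (fst y) \<otimes>\<^bsub>K (s (fst y))\<^esub> snd (snd y)))"
      by (intro polytime_intros polytime_mult polytime_comp[OF _ s] polytime_comp[OF _ a])
        (use dom in auto)
    show "replicate (L x) False \<in> ?I x" if "x \<in> A" for x
      using dom[OF that] by (simp add: mem_iff)
    show "vxor c (a x \<otimes>\<^bsub>K (s x)\<^esub> acc) \<in> ?I x" if "x \<in> A" "c \<in> set (rev (P x))" "acc \<in> ?I x" for x c acc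
    proof -
      interpret gf "l (s x)" "K (s x)" using gf dom[OF that(1)] by blast
      show ?thesis using that dom[OF that(1)] by (intro vxor_mem m_closed) auto
    qed
    show "size_bounded A (\<lambda>x. Suc (esize (L x) * 4))" by (intro size_bounded_intros L)
    show "esize acc \<le> Suc (esize (L x) * 4)" if "x \<in> A" "acc \<in> ?I x" for x acc
      using dom[OF that(1)] that(2) by (intro tsize_encode_bits) (simp add: mem_iff)
  qed (intro polytime_intros P L)+
  then show ?thesis by (simp add: horner_def foldr_conv_fold)
qed

lemma polytime_rs_encode:
  assumes s: "polytime_on A s" and L: "polytime_on A L" and P: "polytime_on A P" and m: "polytime_on A m"
    and dom: "\<And>x. x \<in> A \<Longrightarrow> sec0 \<le> s x \<and> L x = l (s x) \<and> set (P x) \<subseteq> carrier (K (s x)) \<and> set (m x) \<subseteq> carrier (K (s x))"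
  shows "polytime_on A (\<lambda>x. rs_encode (K (s x)) (P x) (m x))"
proof -
  have dom': "sec0 \<le> s x" "L x = l (s x)" "b \<in> set (P x) \<Longrightarrow> b \<in> carrier (K (s x))"
    "b \<in> set (m x) \<Longrightarrow> b \<in> carrier (K (s x))" if "x \<in> A" for x b
    using dom[OF that] by auto
  have "polytime_on A (\<lambda>x. map (\<lambda>a. horner (K (s x)) (L x) (m x) a) (P x))"
    by (intro polytime_intros polytime_horner P polytime_comp[OF _ s] polytime_comp[OF _ L] polytime_comp[OF _ m])
      (use dom' in auto)
  moreover have "rs_encode (K (s x)) (P x) (m x) = map (\<lambda>a. horner (K (s x)) (L x) (m x) a) (P x)"
    if "x \<in> A" for x
    using gf.rs_encode_horner[OF gf] dom[OF that] by simp
  ultimately show ?thesis by (subst polytime_cong)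
qed

lemma polytime_key_residue:
  assumes s: "polytime_on A s" and L: "polytime_on A L" and e: "polytime_on A e" and k: "polytime_on A k"
    and ps: "polytime_on A ps" and z: "polytime_on A z"
    and dom: "\<And>x. x \<in> A \<Longrightarrow> sec0 \<le> s x \<and> L x = l (s x) \<and> length (z x) = (e x + e x + k x) * l (s x)"
    and mem: "\<And>x p. x \<in> A \<Longrightarrow> p \<in> set (ps x) \<Longrightarrow> fst p \<in> carrier (K (s x)) \<and> snd p \<in> carrier (K (s x))"
  shows "polytime_on A (\<lambda>x. key_residue (K (s x)) (L x) (e x) (k x) (ps x) (z x))"
proof -
  have g: "gf (L x) (K (s x))" if "x \<in> A" for x using gf dom[OF that] by simp
  have lm: "set (locator_of (L x) (e x) (k x) (z x)) \<subseteq> carrier (K (s x))"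
    and pm: "set (product_of (L x) (e x) (k x) (z x)) \<subseteq> carrier (K (s x))" if "x \<in> A" for x
    using gf.locator_of_mem[OF g[OF that]] gf.product_of_mem[OF g[OF that]] dom[OF that] by simp_all
  have ev: "horner (K (s x)) (L x) (locator_of (L x) (e x) (k x) (z x)) a \<in> carrier (K (s x))"
    if "x \<in> A" "a \<in> carrier (K (s x))" for x a
    using gf.ev_closed[OF g[OF that(1)] lm[OF that(1)] that(2)] .
  show ?thesis unfolding key_residue_def
    by (intro polytime_intros polytime_mult polytime_horner ps polytime_comp[OF _ s] polytime_comp[OF _ L]
        polytime_comp[OF _ e] polytime_comp[OF _ k] polytime_comp[OF _ z])
      (use dom mem subsetD[OF lm] subsetD[OF pm] ev in auto)
qed

lemma polytime_message_residue:
  assumes s: "polytime_on A s" and L: "polytime_on A L" and E: "polytime_on A E" and k: "polytime_on A k"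
    and ps: "polytime_on A ps" and z: "polytime_on A z"
    and dom: "\<And>x. x \<in> A \<Longrightarrow> sec0 \<le> s x \<and> L x = l (s x) \<and> length (z x) = k x * l (s x) \<and> set (E x) \<subseteq> carrier (K (s x))"
    and mem: "\<And>x p. x \<in> A \<Longrightarrow> p \<in> set (ps x) \<Longrightarrow> fst p \<in> carrier (K (s x)) \<and> snd p \<in> carrier (K (s x))"
  shows "polytime_on A (\<lambda>x. message_residue (K (s x)) (L x) (E x) (k x) (ps x) (z x))"
proof -
  have g: "gf (L x) (K (s x))" if "x \<in> A" for x using gf dom[OF that] by simp
  have tm: "set (to_symbols (L x) (k x) (z x)) \<subseteq> carrier (K (s x))" if "x \<in> A" for x
    using gf.to_symbols_mem[OF g[OF that]] dom[OF that] by simp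
  have ev: "horner (K (s x)) (L x) P a \<in> carrier (K (s x))"
    if "x \<in> A" "a \<in> carrier (K (s x))" "set P \<subseteq> carrier (K (s x))" for x P a
    using gf.ev_closed[OF g[OF that(1)] that(3,2)] .
  have Em: "set (E x) \<subseteq> carrier (K (s x))" if "x \<in> A" for x using dom[OF that] by simp
  have vx: "vxor b c \<in> carrier (K (s x))" if "x \<in> A" "b \<in> carrier (K (s x))" "c \<in> carrier (K (s x))" for x b c
    using gf.vxor_mem[OF g[OF that(1)] that(2,3)] .
  show ?thesis unfolding message_residue_def
    by (intro polytime_intros polytime_mult polytime_horner ps polytime_comp[OF _ s] polytime_comp[OF _ L]
        polytime_comp[OF _ E] polytime_comp[OF _ k] polytime_comp[OF _ z])
      (use dom mem tm in \<open>auto intro!: vx ev intro: subsetD[OF tm] subsetD[OF Em]\<close>)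
qed

theorem polytime_rs_decode:
  assumes s: "polytime_on A s" and L: "polytime_on A L" and P: "polytime_on A P" and k: "polytime_on A k"
    and y: "polytime_on A y"
    and dom: "\<And>x. x \<in> A \<Longrightarrow> sec0 \<le> s x \<and> L x = l (s x) \<and> set (P x) \<subseteq> carrier (K (s x)) \<and> set (y x) \<subseteq> carrier (K (s x))"
  shows "polytime_on A (\<lambda>x. rs_decode (K (s x)) (L x) (P x) (k x) (y x))"
proof -
  have g: "gf (L x) (K (s x))" if "x \<in> A" for x using gf dom[OF that] by simp
  have mem: "fst p \<in> carrier (K (s x)) \<and> snd p \<in> carrier (K (s x))" if "x \<in> A" "p \<in> set (zip (P x) (y x))" for x p
    using gf.zip_mem[OF g[OF that(1)] _ _ that(2)] dom[OF that(1)] by blast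
  have dm: "set (decoded_locator (K (s x)) (L x) (P x) (k x) (y x)) \<subseteq> carrier (K (s x))" if "x \<in> A" for x
    using gf.decoded_locator_mem[OF g[OF that]] dom[OF that] by simp
  let ?e = "\<lambda>x. (length (y x) - k x) div 2"
  have "polytime_on A (\<lambda>x. affine_zero ((?e x + ?e x + k x) * L x)
      (\<lambda>z. key_residue (K (s x)) (L x) (?e x) (k x) (zip (P x) (y x)) z))"
    by (intro polytime_affine_zero polytime_key_residue polytime_intros L k y
        polytime_comp[OF _ s] polytime_comp[OF _ L]
        polytime_comp[OF _ P] polytime_comp[OF _ k] polytime_comp[OF _ y])
      (use dom mem in auto)
  then have E: "polytime_on A (\<lambda>x. decoded_locator (K (s x)) (L x) (P x) (k x) (y x))"
    unfolding decoded_locator_def Let_def by (intro polytime_intros L k y)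
  show ?thesis unfolding rs_decode_def
    by (intro polytime_affine_zero polytime_message_residue polytime_intros L k y
        polytime_comp[OF _ s] polytime_comp[OF _ L]
        polytime_comp[OF _ P] polytime_comp[OF _ k] polytime_comp[OF _ y] polytime_comp[OF _ E])
      (use dom mem subsetD[OF dm] in auto)
qed

end

subsection \<open>Consistent learners\<close>

lemma integrable_pmf_bounded:
  fixes f :: "'a \<Rightarrow> real"
  assumes "\<And>x. x \<in> set_pmf p \<Longrightarrow> \<bar>f x\<bar> \<le> c"
  shows "integrable (measure_pmf p) f"
  by (rule measure_pmf.integrable_const_bound[of _ c]) (auto simp: AE_measure_pmf_iff assms)

lemma prob_replicate_pmf_avoid:
  "measure_pmf.prob (replicate_pmf N D) {xs. \<forall>x\<in>set xs. x \<notin> B} = (1 - measure_pmf.prob D B) ^ N"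
proof (induction N)
  case (Suc N)
  let ?S = "{xs. \<forall>x\<in>set xs. x \<notin> B}"
  have "replicate_pmf (Suc N) D = D \<bind> (\<lambda>x. map_pmf ((#) x) (replicate_pmf N D))"
    by (simp add: map_pmf_def)
  then have "ennreal (measure_pmf.prob (replicate_pmf (Suc N) D) ?S) =
      (\<integral>\<^sup>+ x. emeasure (measure_pmf (map_pmf ((#) x) (replicate_pmf N D))) ?S \<partial>measure_pmf D)"
    by (simp only: emeasure_bind_pmf flip: measure_pmf.emeasure_eq_measure)
  also have "\<dots> = (\<integral>\<^sup>+ x. ennreal ((1 - measure_pmf.prob D B) ^ N) * indicator (- B) x \<partial>measure_pmf D)"
  proof (intro nn_integral_cong)
    fix x
    have "(#) x -` ?S = (if x \<in> B then {} else ?S)" by auto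
    then show "emeasure (measure_pmf (map_pmf ((#) x) (replicate_pmf N D))) ?S =
        ennreal ((1 - measure_pmf.prob D B) ^ N) * indicator (- B) x"
      using Suc by (simp add: measure_pmf.emeasure_eq_measure)
  qed
  also have "\<dots> = ennreal ((1 - measure_pmf.prob D B) ^ N) * ennreal (1 - measure_pmf.prob D B)"
    using measure_pmf.prob_compl[of B D]
    by (simp add: nn_integral_cmult measure_pmf.emeasure_eq_measure Compl_eq_Diff_UNIV)
  also have "\<dots> = ennreal ((1 - measure_pmf.prob D B) ^ Suc N)"
    by (subst ennreal_mult[symmetric]) (auto simp: mult.commute)
  finally show ?case by (subst (asm) ennreal_inj) auto
qed simp

text \<open>The linear bound \<open>N t \<le> ln A - 1 + exp (N t) / A\<close>, where \<open>A\<close> is the number of hypotheses, takes the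
  expectation to exponential moments without a logarithmic loss in the accuracy.\<close>

theorem expected_risk_consistent:
  fixes D :: "'x pmf" and bad :: "'m \<Rightarrow> 'x set"
  assumes H: "finite H" and N: "0 < N"
    and sel: "\<And>xs. set xs \<subseteq> set_pmf D \<Longrightarrow> length xs = N \<Longrightarrow> sel xs \<in> H \<and> (\<forall>x\<in>set xs. x \<notin> bad (sel xs))"
  shows "measure_pmf.expectation (replicate_pmf N D) (\<lambda>xs. measure_pmf.prob D (bad (sel xs)))
    \<le> ln (real (card H)) / real N"
proof -
  let ?p = "replicate_pmf N D"
  define r where "r h = measure_pmf.prob D (bad h)" for h
  define ok where "ok h = {xs. \<forall>x\<in>set xs. x \<notin> bad h}" for h
  have r: "0 \<le> r h" "r h \<le> 1" for h by (simp_all add: r_def)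
  have sup: "set xs \<subseteq> set_pmf D \<and> length xs = N" if "xs \<in> set_pmf ?p" for xs
    using that by (auto simp: set_replicate_pmf)
  obtain xs0 where "xs0 \<in> set_pmf ?p" by (meson set_pmf_not_empty ex_in_conv)
  with sel sup have "H \<noteq> {}" by blast
  define A where "A = real (card H)"
  have A: "A > 0" using H \<open>H \<noteq> {}\<close> by (simp add: A_def card_gt_0_iff)
  have tangent: "t \<le> ln A - 1 + exp t / A" for t
    using exp_ge_add_one_self[of "t - ln A"] A by (simp add: exp_diff)
  define S where "S xs = (\<Sum>h\<in>H. exp (real N * r h) * indicator (ok h) xs)" for xs
  have S0: "0 \<le> S xs" for xs unfolding S_def by (intro sum_nonneg) auto
  \<comment> \<open>The selected hypothesis avoids its own bad set on the sample, so its term is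
    present in the sum whichever hypothesis it is; this is the union bound.\<close>
  have Sle: "exp (real N * r (sel xs)) \<le> S xs" if "xs \<in> set_pmf ?p" for xs
  proof -
    have "exp (real N * r (sel xs)) = exp (real N * r (sel xs)) * indicator (ok (sel xs)) xs"
      using sel sup[OF that] by (simp add: ok_def)
    also have "\<dots> \<le> S xs"
      unfolding S_def using sel sup[OF that] H by (intro member_le_sum) auto
    finally show ?thesis .
  qed
  have intI: "integrable (measure_pmf ?p) (\<lambda>xs. exp (real N * r h) * indicator (ok h) xs)" for h
    by (rule integrable_pmf_bounded[of _ _ "exp (real N * r h)"]) (auto simp: indicator_def)
  have intS: "integrable (measure_pmf ?p) S" unfolding S_def by (intro Bochner_Integration.integrable_sum intI)
  have "real N * measure_pmf.expectation ?p (\<lambda>xs. r (sel xs)) = measure_pmf.expectation ?p (\<lambda>xs. real N * r (sel xs))"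
    by simp
  also have "\<dots> \<le> measure_pmf.expectation ?p (\<lambda>xs. ln A - 1 + S xs / A)"
  proof (rule integral_mono_AE)
    show "integrable (measure_pmf ?p) (\<lambda>xs. real N * r (sel xs))"
      by (rule integrable_pmf_bounded[of _ _ "real N"]) (use r in \<open>auto simp: abs_mult mult_left_le\<close>)
    show "integrable (measure_pmf ?p) (\<lambda>xs. ln A - 1 + S xs / A)" using intS by simp
    show "AE xs in ?p. real N * r (sel xs) \<le> ln A - 1 + S xs / A"
    proof (rule AE_pmfI)
      fix xs assume "xs \<in> set_pmf ?p"
      from divide_right_mono[OF Sle[OF this], of A] tangent[of "real N * r (sel xs)"] A
      show "real N * r (sel xs) \<le> ln A - 1 + S xs / A" by linarith
    qed
  qed
  also have "\<dots> = ln A - 1 + measure_pmf.expectation ?p S / A" using intS by simp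
  also have "measure_pmf.expectation ?p S = (\<Sum>h\<in>H. exp (real N * r h) * (1 - r h) ^ N)"
    unfolding S_def using intI
    by (simp add: Bochner_Integration.integral_sum ok_def r_def prob_replicate_pmf_avoid)
  \<comment> \<open>A hypothesis of risk \<open>r\<close> survives the sample with probability at
    most \<open>exp (- N r)\<close>, which cancels its exponential. So the sum is at most
    \<open>A\<close>, and its quotient by \<open>A\<close> makes up for the
    \<open>- 1\<close>.\<close>
  also have "\<dots> \<le> (\<Sum>h\<in>H. 1)"
  proof (rule sum_mono)
    fix h
    have "(1 - r h) ^ N \<le> exp (- r h) ^ N"
      using exp_ge_add_one_self[of "- r h"] r[of h] by (intro power_mono) auto
    then have "exp (real N * r h) * (1 - r h) ^ N \<le> exp (real N * r h) * exp (- r h) ^ N" by simp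
    also have "\<dots> = 1" by (simp flip: exp_of_nat_mult exp_add)
    finally show "exp (real N * r h) * (1 - r h) ^ N \<le> 1" .
  qed
  finally have "real N * measure_pmf.expectation ?p (\<lambda>xs. r (sel xs)) \<le> ln A"
    using A by (simp add: A_def divide_right_mono)
  then show ?thesis using N by (simp add: r_def A_def field_simps)
qed

subsection \<open>The models and their residues\<close>

text \<open>Truncates to the shorter argument, where \<open>inner_F2\<close> would look beyond the
  end of the second list. So it is meaningful also when a decoded seed selects too few bits.\<close>

definition dot :: "bool list \<Rightarrow> bool list \<Rightarrow> bool" where
  "dot v w = foldr (\<noteq>) (map2 (\<and>) v w) False"

text \<open>A seed decoded from an arbitrary word may select the wrong number of bits. Padding or
  cutting gives every example the same number of equations and remains linear.\<close>

definition fit :: "nat \<Rightarrow> bool list \<Rightarrow> bool list" where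
  "fit m v = take m (v @ replicate m False)"

lemma dot_Cons [simp]: "dot (a # v) (b # w) = ((a \<and> b) \<noteq> dot v w)"
  by (simp add: dot_def)

lemma dot_Nil [simp]: "dot [] w = False" "dot v [] = False"
  by (simp_all add: dot_def)

lemma inner_F2_dot: "length v = length w \<Longrightarrow> inner_F2 v w = dot v w"
proof (induction v w rule: list_induct2)
  case (Cons a v b w)
  have "inner_F2 (a # v) (b # w) = ((a \<and> b) \<noteq> inner_F2 v w)"
    unfolding inner_F2_def by (cases a; cases b; simp add: sum.lessThan_Suc_shift del: sum.lessThan_Suc)
  with Cons show ?case by simp
qed (simp add: inner_F2_def)

lemma vxor_vxor_cancel: "length u = length v \<Longrightarrow> vxor (vxor u v) u = v"
proof -
  assume "length u = length v"
  moreover have "vxor (vxor u v) u = vxor v (vxor u u)" by (simp only: vxor_ac)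
  ultimately show ?thesis by (simp add: vxor_self vxor_zero)
qed

lemma dot_vxor: "length u = length v \<Longrightarrow> dot m (vxor u v) = (dot m u \<noteq> dot m v)"
proof (induction u v arbitrary: m rule: list_induct2)
  case (Cons a u b v)
  show ?case by (cases m) (auto simp: Cons.IH)
qed simp

lemma length_fit [simp]: "length (fit m v) = m"
  by (simp add: fit_def)

lemma fit_same [simp]: "length v = m \<Longrightarrow> fit m v = v"
  by (simp add: fit_def)

lemma fit_vxor: "length u = length v \<Longrightarrow> fit m (vxor u v) = vxor (fit m u) (fit m v)"
  by (simp add: fit_def vxor_append vxor_self flip: take_vxor)

lemma nths_vxor: "length u = length v \<Longrightarrow> nths (vxor u v) A = vxor (nths u A) (nths v A)"
proof (induction u v arbitrary: A rule: list_induct2)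
  case (Cons a u b v)
  then show ?case by (simp add: nths_Cons)
qed simp

lemma length_nths_eq: "length u = length v \<Longrightarrow> length (nths u A) = length (nths v A)"
  by (simp add: length_nths)

lemma hamming_append:
  "length v = length w \<Longrightarrow> hamming (v @ v') (w @ w') = hamming v w + hamming v' w'"
proof -
  assume len: "length v = length w"
  let ?A = "{i. i < length v \<and> v ! i \<noteq> w ! i}" and ?B = "{i. i < length v' \<and> v' ! i \<noteq> w' ! i}"
  have "{i. i < length (v @ v') \<and> (v @ v') ! i \<noteq> (w @ w') ! i} = ?A \<union> (\<lambda>i. length v + i) ` ?B"
  proof (rule equalityI; rule subsetI)
    fix i assume "i \<in> {i. i < length (v @ v') \<and> (v @ v') ! i \<noteq> (w @ w') ! i}"
    then show "i \<in> ?A \<union> (\<lambda>i. length v + i) ` ?B"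
      using len by (cases "i < length v") (auto simp: nth_append image_iff intro!: exI[of _ "i - length v"])
  qed (use len in \<open>auto simp: nth_append\<close>)
  moreover have "card (?A \<union> (\<lambda>i. length v + i) ` ?B) = card ?A + card ((\<lambda>i. length v + i) ` ?B)"
    by (intro card_Un_disjoint) auto
  moreover have "card ((\<lambda>i. length v + i) ` ?B) = card ?B" by (intro card_image) auto
  ultimately show ?thesis by (simp add: hamming_def)
qed

lemma hamming_commute: "length v = length w \<Longrightarrow> hamming v w = hamming w v"
  unfolding hamming_def by (intro arg_cong[where f = card]) auto

lemma hamming_self [simp]: "hamming v v = 0"
  by (simp add: hamming_def)

section \<open>Models, residues and classification in the setting of the problem\<close>

type_synonym example = "point \<times> bool"

text \<open>The budget enters as \<open>2 * budget + k \<le> n\<close>, the decoding condition for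
  the Reed--Solomon part, and as \<open>budget < e\<close> for the two encoded seeds. Seed lengths
  come with size bounds and not with programs: the seeds themselves are obtained by
  decoding.\<close>

locale prg_learning = fields sec0 l K for sec0 l K +
  fixes n k \<alpha> \<beta> r1 r2 :: "nat \<Rightarrow> nat" and budget :: "nat \<Rightarrow> real"
    and pts :: "nat \<Rightarrow> symbol list" and f1 f2 :: "bool list \<Rightarrow> bool list"
    and samp1 samp2 :: "nat \<Rightarrow> bool list \<Rightarrow> nat set"
    and len :: "nat \<Rightarrow> nat \<Rightarrow> nat" and ecc :: "nat \<Rightarrow> bool list \<Rightarrow> symbol list"
    and dec :: "nat \<Rightarrow> symbol list \<Rightarrow> bool list" and e :: "nat \<Rightarrow> nat"
  assumes n: "\<And>sec. sec0 \<le> sec \<Longrightarrow> 0 < n sec \<and> k sec \<le> n sec \<and> n sec < sec"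
    and budget: "\<And>sec. sec0 \<le> sec \<Longrightarrow> 0 \<le> budget sec \<and> 2 * budget sec + real (k sec) \<le> real (n sec)"
    and pts: "\<And>sec. sec0 \<le> sec \<Longrightarrow> distinct (pts sec) \<and> pts sec \<in> words (carrier (K sec)) (n sec)"
    and pts_time: "polytime_on {sec. sec0 \<le> sec} pts"
    and f: "\<And>s. length (f1 s) = \<alpha> (length s)" "\<And>s. length (f2 s) = \<beta> (length s)"
    and f_time: "polytime_on UNIV f1" "polytime_on UNIV f2"
    and samp1: "\<And>sec u. sec0 \<le> sec \<Longrightarrow> u \<in> bits (r1 sec) \<Longrightarrow> samp1 sec u \<subseteq> {..<\<alpha> sec} \<and> card (samp1 sec u) = k sec * l sec"
    and samp2: "\<And>sec u. sec0 \<le> sec \<Longrightarrow> u \<in> bits (r2 sec) \<Longrightarrow> samp2 sec u \<subseteq> {..<\<beta> sec} \<and> card (samp2 sec u) = n sec * l sec"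
    and samp_time: "polytime_on {(sec, u). sec0 \<le> sec} (\<lambda>(sec, u). sorted_list_of_set (samp1 sec u))"
      "polytime_on {(sec, u). sec0 \<le> sec} (\<lambda>(sec, u). sorted_list_of_set (samp2 sec u))"
    and ecc: "\<And>sec v. sec0 \<le> sec \<Longrightarrow> ecc sec v \<in> words (carrier (K sec)) (len sec (length v))"
    and ecc_time: "polytime_on {(sec, v). sec0 \<le> sec} (\<lambda>(sec, v). ecc sec v)"
    and dec_time: "polytime_on {(sec, w). sec0 \<le> sec \<and> set w \<subseteq> carrier (K sec)} (\<lambda>(sec, w). dec sec w)"
    and dec: "\<And>sec v w. sec0 \<le> sec \<Longrightarrow> w \<in> words (carrier (K sec)) (len sec (length v)) \<Longrightarrow>
      hamming w (ecc sec v) \<le> e sec \<Longrightarrow> dec sec w = v"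
    and e: "\<And>sec. sec0 \<le> sec \<Longrightarrow> budget sec < real (e sec)"
    and bounded: "size_bounded {sec. sec0 \<le> sec} \<alpha>" "size_bounded {sec. sec0 \<le> sec} \<beta>"
      "size_bounded {sec. sec0 \<le> sec} r1" "size_bounded {sec. sec0 \<le> sec} r2"
begin

definition problem :: "nat \<Rightarrow> (point, bool) learning_problem" where
  "problem = prg_problem K pts len ecc f1 f2 samp1 samp2 r1 r2 l k n"

definition points :: "nat \<Rightarrow> point set" where
  "points sec = point_space (K sec) (len sec) (r1 sec) (r2 sec) (k sec) (n sec)"

text \<open>The detour through \<open>sorted_list_of_set\<close> does not change a finite set of
  positions. On a seed of wrong length the sampler is unconstrained and its set may be infinite; the
  list is what the program computes in any case.\<close>

definition key_bits :: "nat \<Rightarrow> bool list \<Rightarrow> symbol list \<Rightarrow> bool list" where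
  "key_bits sec z c = nths (take (\<alpha> sec) z) (set (sorted_list_of_set (samp1 sec (dec sec c))))"

definition pad_bits :: "nat \<Rightarrow> bool list \<Rightarrow> symbol list \<Rightarrow> bool list" where
  "pad_bits sec z c =
     fit (n sec * l sec) (nths (drop (\<alpha> sec) z) (set (sorted_list_of_set (samp2 sec (dec sec c)))))"

text \<open>Only the length of the received message is used, in place of \<open>k\<close>, for which
  no program is given. Its contents may be corrupted; the message is recovered from \<open>y\<close>
  after removal of the noise.\<close>

definition classify :: "nat \<Rightarrow> bool list \<Rightarrow> point \<Rightarrow> bool" where
  "classify sec z x = (case x of (c1, c2, m, y) \<Rightarrow>
     dot (rs_decode (K sec) (l sec) (pts sec) (length m)
           (sxor y (to_symbols (l sec) (n sec) (pad_bits sec z c2))))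
       (key_bits sec z c1))"

text \<open>One equation for the label, followed by those for the pad. In a training example the
  message is intact, so adding its codeword to \<open>y\<close> exposes the noise; both parts are
  affine in the model.\<close>

definition residue1 :: "nat \<Rightarrow> example \<Rightarrow> bool list \<Rightarrow> bool list" where
  "residue1 sec q z = (case q of ((c1, c2, m, y), b) \<Rightarrow>
     (dot (concat m) (key_bits sec z c1) \<noteq> b)
       # vxor (pad_bits sec z c2) (concat (sxor y (rs_encode (K sec) (pts sec) m))))"

definition residue :: "nat \<Rightarrow> example list \<Rightarrow> bool list \<Rightarrow> bool list" where
  "residue sec S z = concat (map (\<lambda>q. residue1 sec q z) S)"

definition fitted :: "nat \<Rightarrow> example list \<Rightarrow> bool list" where
  "fitted sec S = affine_zero (\<alpha> sec + \<beta> sec) (residue sec S)"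

lemma points_iff:
  "(c1, c2, m, y) \<in> points sec \<longleftrightarrow>
     c1 \<in> words (carrier (K sec)) (len sec (r1 sec)) \<and> c2 \<in> words (carrier (K sec)) (len sec (r2 sec)) \<and>
     m \<in> words (carrier (K sec)) (k sec) \<and> y \<in> words (carrier (K sec)) (n sec)"
  by (simp add: points_def point_space_def)

lemma problem_simps [simp]: "instances (problem sec) = points sec" "labels (problem sec) = UNIV"
  by (simp_all add: problem_def prg_problem_def points_def)

lemma samples_iff: "S \<in> samples (problem sec) \<longleftrightarrow> (\<forall>q\<in>set S. fst q \<in> points sec)"
  by (auto simp: samples_def lists_eq_set)

lemma words_iff: "w \<in> words A m \<longleftrightarrow> set w \<subseteq> A \<and> length w = m"
  by (simp add: words_def)

context
  fixes sec assumes sec: "sec0 \<le> sec"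
begin

interpretation F: gf "l sec" "K sec" using gf[OF sec] .

abbreviation "enc m \<equiv> rs_encode (K sec) (pts sec) m"

abbreviation "noise s u \<equiv> to_symbols (l sec) (n sec) (nths (f2 s) (samp2 sec u))"

abbreviation "point_dstr s \<equiv> point_distribution (K sec) (pts sec) (ecc sec) (samp2 sec)
  (r1 sec) (r2 sec) (l sec) (k sec) (n sec) (f2 s)"

lemma pts': "set (pts sec) \<subseteq> carrier (K sec)" "length (pts sec) = n sec" "distinct (pts sec)"
  using pts[OF sec] by (auto simp: words_iff)

lemma rs_encode_mem:
  assumes "set m \<subseteq> carrier (K sec)"
  shows "set (enc m) \<subseteq> carrier (K sec)" "length (enc m) = n sec"
  using F.rs_encode_horner[OF assms pts'(1)] pts' assms by (auto intro!: F.ev_closed)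

lemma length_residue1:
  assumes "fst q \<in> points sec"
  shows "length (residue1 sec q z) = Suc (n sec * l sec)"
proof -
  obtain c1 c2 m y b where q: "q = ((c1, c2, m, y), b)" by (metis surj_pair)
  with assms have m: "set m \<subseteq> carrier (K sec)" and y: "set y \<subseteq> carrier (K sec)" "length y = n sec"
    by (auto simp: points_iff words_iff)
  have "set (sxor y (enc m)) \<subseteq> bits (l sec)"
    using F.set_sxor[OF y(1) rs_encode_mem(1)[OF m]] by (simp add: F.carrier_eq)
  from length_concat_bits[OF this] show ?thesis
    using rs_encode_mem(2)[OF m] y by (simp add: residue1_def q pad_bits_def)
qed

text \<open>Restriction and padding are linear. The label and the exposed noise \<open>?t\<close>
  are constants of the map: each occurs three times on the right, and an odd number of copies leaves
  one.\<close>

lemma residue1_vxor3: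
  assumes "fst q \<in> points sec" "length u = d" "length v = d" "length w = d"
  shows "residue1 sec q (vxor u (vxor v w)) = vxor (residue1 sec q u) (vxor (residue1 sec q v) (residue1 sec q w))"
proof -
  obtain c1 c2 m y b where q: "q = ((c1, c2, m, y), b)" by (metis surj_pair)
  let ?t = "concat (sxor y (enc m))"
  have lk: "length (key_bits sec u c1) = length (key_bits sec v c1)" "length (key_bits sec u c1) = length (key_bits sec w c1)"
    using assms by (auto simp: key_bits_def intro!: length_nths_eq)
  have "key_bits sec (vxor u (vxor v w)) c1 = vxor (key_bits sec u c1) (vxor (key_bits sec v c1) (key_bits sec w c1))"
    using assms by (simp add: key_bits_def take_vxor nths_vxor)
  then have 1: "dot (concat m) (key_bits sec (vxor u (vxor v w)) c1) = (dot (concat m) (key_bits sec u c1) \<noteq>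
      (dot (concat m) (key_bits sec v c1) \<noteq> dot (concat m) (key_bits sec w c1)))"
    using lk by (simp add: dot_vxor)
  have ln: "length (nths (drop (\<alpha> sec) u) A) = length (nths (drop (\<alpha> sec) v) A)"
      "length (nths (drop (\<alpha> sec) u) A) = length (nths (drop (\<alpha> sec) w) A)" for A
    using assms by (auto intro!: length_nths_eq)
  have 2: "pad_bits sec (vxor u (vxor v w)) c2 = vxor (pad_bits sec u c2) (vxor (pad_bits sec v c2) (pad_bits sec w c2))"
    using assms ln by (simp add: pad_bits_def drop_vxor nths_vxor fit_vxor)
  have lp: "length (pad_bits sec z c2) = length ?t" for z
    using length_residue1[OF assms(1), of z] length_residue1[OF assms(1), of "[]"]
    using assms(1) rs_encode_mem F.set_sxor length_concat_bits[of "sxor y (enc m)" "l sec"]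
    by (simp add: q pad_bits_def points_iff words_iff F.carrier_eq)
  have "vxor (pad_bits sec u c2) (vxor (vxor (pad_bits sec v c2) ?t) (vxor (pad_bits sec w c2) ?t))
      = vxor (pad_bits sec u c2) (vxor (pad_bits sec v c2) (vxor (pad_bits sec w c2) (vxor ?t ?t)))"
    by (simp add: vxor_ac)
  also have "\<dots> = vxor (pad_bits sec u c2) (vxor (pad_bits sec v c2) (pad_bits sec w c2))"
    using lp by (simp add: vxor_self vxor_zero)
  finally show ?thesis unfolding residue1_def q prod.case 1 2
    by (auto simp: vxor_ac)
qed

lemma length_residue:
  "S \<in> samples (problem sec) \<Longrightarrow> length (residue sec S z) = length S * Suc (n sec * l sec)"
  unfolding residue_def using length_residue1 by (intro length_concat_map) (simp add: samples_iff)

lemma residue_vxor3: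
  assumes "S \<in> samples (problem sec)" "length u = d" "length v = d" "length w = d"
  shows "residue sec S (vxor u (vxor v w)) = vxor (residue sec S u) (vxor (residue sec S v) (residue sec S w))"
  unfolding residue_def
proof (rule concat_map_vxor3)
  fix q assume "q \<in> set S"
  then have q: "fst q \<in> points sec" using assms(1) by (simp add: samples_iff)
  from residue1_vxor3[OF q assms(2-4)]
  show "residue1 sec q (vxor u (vxor v w)) = vxor (residue1 sec q u) (vxor (residue1 sec q v) (residue1 sec q w))" .
  show "length (residue1 sec q u) = Suc (n sec * l sec) \<and> length (residue1 sec q v) = Suc (n sec * l sec) \<and>
      length (residue1 sec q w) = Suc (n sec * l sec)"
    using length_residue1[OF q] by simp
qed

lemma length_fitted: "S \<in> samples (problem sec) \<Longrightarrow> length (fitted sec S) = \<alpha> sec + \<beta> sec"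
  unfolding fitted_def by (rule length_affine_zero[OF length_residue])

lemma fitted:
  assumes S: "S \<in> samples (problem sec)" and z: "length z = \<alpha> sec + \<beta> sec" "\<forall>q\<in>set S. True \<notin> set (residue1 sec q z)"
  shows "\<forall>q\<in>set S. True \<notin> set (residue1 sec q (fitted sec S))"
proof -
  have "True \<notin> set (residue sec S (fitted sec S))"
    unfolding fitted_def
  proof (rule affine_zero)
    show "True \<notin> set (residue sec S z)" using z by (simp add: residue_def)
  qed (use S z in \<open>auto intro: length_residue residue_vxor3\<close>)
  then show ?thesis by (simp add: residue_def)
qed

lemma dec_ecc: "dec sec (ecc sec u) = u"
  by (rule dec[OF sec ecc[OF sec]]) simp

lemma set_pmf_point_distribution:
  assumes s: "s \<in> bits sec"
    and x: "x \<in> set_pmf (point_dstr s)"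
  obtains u1 u2 m where "u1 \<in> bits (r1 sec)" "u2 \<in> bits (r2 sec)" "m \<in> words (carrier (K sec)) (k sec)"
    "length (nths (f2 s) (samp2 sec u2)) = n sec * l sec"
    "x = (ecc sec u1, ecc sec u2, m,
      sxor (enc m) (noise s u2))"
proof -
  have fin: "finite (words (UNIV :: bool set) d)" "replicate d True \<in> words (UNIV :: bool set) d" for d
    using finite_lists_length_eq[of "UNIV :: bool set" d] by (auto simp: words_def)
  have unif: "set_pmf (unif d) = bits d" for d
    unfolding unif_def bits_def using fin[of d] by (intro set_pmf_of_set) auto
  have "finite (bits (l sec))" using fin by (simp add: bits_def)
  then have fw: "finite (words (carrier (K sec)) (k sec))"
    using finite_lists_length_eq[of "carrier (K sec)" "k sec"] by (simp add: words_def F.carrier_eq)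
  have "replicate (k sec) \<zero>\<^bsub>K sec\<^esub> \<in> words (carrier (K sec)) (k sec)" by (auto simp: words_def)
  then have words: "set_pmf (pmf_of_set (words (carrier (K sec)) (k sec))) = words (carrier (K sec)) (k sec)"
    using fw by (intro set_pmf_of_set) auto
  obtain u1 u2 m where u: "u1 \<in> bits (r1 sec)" "u2 \<in> bits (r2 sec)" "m \<in> words (carrier (K sec)) (k sec)"
    and x: "x = (ecc sec u1, ecc sec u2, m,
      vec_add (K sec) (enc m) (noise s u2))"
    using x unfolding point_distribution_def by (auto simp: unif words simp del: in_bits)
  have "{i. i < length (f2 s) \<and> i \<in> samp2 sec u2} = samp2 sec u2"
    using samp2[OF sec u(2)] f(2)[of s] s by auto
  then have len: "length (nths (f2 s) (samp2 sec u2)) = n sec * l sec"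
    using samp2[OF sec u(2)] by (simp add: length_nths)
  have add: "vec_add (K sec) v w = sxor v w" if "set v \<subseteq> carrier (K sec)" "set w \<subseteq> carrier (K sec)" for v w
    using that unfolding vec_add_def sxor_def by (induction v w rule: list_induct2') (auto simp: F.add_eq)
  have "vec_add (K sec) (enc m) (noise s u2)
     = sxor (enc m) (noise s u2)"
    using u(3) by (intro add rs_encode_mem F.to_symbols_mem len) (simp add: words_iff)
  then show ?thesis using that[OF u len] x by simp
qed

context
  fixes s1 s2 x
  assumes s: "s1 \<in> bits sec" "s2 \<in> bits sec"
    and x: "x \<in> set_pmf (point_dstr s2)"
begin

abbreviation "label \<equiv> point_label (ecc sec) (samp1 sec) (r1 sec) (f1 s1)"

lemma support_points: "x \<in> points sec"
proof -
  obtain u1 u2 m where u: "u1 \<in> bits (r1 sec)" "u2 \<in> bits (r2 sec)" "m \<in> words (carrier (K sec)) (k sec)"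
    "length (nths (f2 s2) (samp2 sec u2)) = n sec * l sec"
    and x: "x = (ecc sec u1, ecc sec u2, m,
      sxor (enc m) (noise s2 u2))"
    by (rule set_pmf_point_distribution[OF s(2) x])
  have "set m \<subseteq> carrier (K sec)" using u(3) by (simp add: words_iff)
  note cm = rs_encode_mem[OF this]
  show ?thesis unfolding x points_iff
    using ecc[OF sec, of u1] ecc[OF sec, of u2] u F.set_sxor[OF cm(1) F.to_symbols_mem[OF u(4)]] cm(2)
    by (simp add: words_iff)
qed

text \<open>Realisability: the outputs of the two generators explain every example. The seed
  \<open>s1\<close> of the hypothesis and the seed \<open>s2\<close> of the distribution are
  unrelated, so a model carries both.\<close>

lemma residue1_true_model: "True \<notin> set (residue1 sec (x, label x) (f1 s1 @ f2 s2))"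
proof -
  obtain u1 u2 m where u: "u1 \<in> bits (r1 sec)" "u2 \<in> bits (r2 sec)" "m \<in> words (carrier (K sec)) (k sec)"
    "length (nths (f2 s2) (samp2 sec u2)) = n sec * l sec"
    and x: "x = (ecc sec u1, ecc sec u2, m,
      sxor (enc m) (noise s2 u2))"
    by (rule set_pmf_point_distribution[OF s(2) x])
  have m: "set m \<subseteq> carrier (K sec)" "length m = k sec" using u(3) by (auto simp: words_iff)
  note cm = rs_encode_mem[OF m(1)]
  let ?pad = "nths (f2 s2) (samp2 sec u2)"
  let ?noise = "to_symbols (l sec) (n sec) ?pad"
  have fin: "finite (samp1 sec u1)" "finite (samp2 sec u2)"
    using samp1[OF sec u(1)] samp2[OF sec u(2)] finite_subset[OF _ finite_lessThan] by blast+
  have key: "key_bits sec (f1 s1 @ f2 s2) (ecc sec u1) = nths (f1 s1) (samp1 sec u1)"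
    using f(1)[of s1] s fin by (simp add: key_bits_def dec_ecc)
  have pad: "pad_bits sec (f1 s1 @ f2 s2) (ecc sec u2) = ?pad"
    using f(1)[of s1] s fin u(4) by (simp add: pad_bits_def dec_ecc)
  have "inj_on (ecc sec) (bits (r1 sec))" using dec_ecc by (metis inj_on_inverseI)
  then have inv: "inv_into (bits (r1 sec)) (ecc sec) (ecc sec u1) = u1" using u(1) by (rule inv_into_f_f)
  have "{i. i < length (f1 s1) \<and> i \<in> samp1 sec u1} = samp1 sec u1"
    using samp1[OF sec u(1)] f(1)[of s1] s by auto
  then have "length (nths (f1 s1) (samp1 sec u1)) = k sec * l sec"
    using samp1[OF sec u(1)] by (simp add: length_nths)
  moreover have "length (concat m) = k sec * l sec"
    using length_concat_bits[of m "l sec"] m by (simp add: F.carrier_eq)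
  ultimately have lab: "label x = dot (concat m) (nths (f1 s1) (samp1 sec u1))"
    unfolding x point_label_def by (simp add: inv inner_F2_dot)
  have "sxor (sxor (enc m) ?noise) (enc m) = ?noise"
  proof (rule nth_equalityI)
    fix i assume "i < length (sxor (sxor (enc m) ?noise) (enc m))"
    then have i: "i < n sec" using cm by simp
    have "enc m ! i \<in> carrier (K sec)" "?noise ! i \<in> carrier (K sec)"
      using i cm F.to_symbols_mem[OF u(4)] nth_mem[of i "enc m"] nth_mem[of i ?noise]
      by auto
    then have "length (enc m ! i) = l sec" "length (?noise ! i) = l sec"
      by (simp_all add: F.carrier_iff)
    then show "sxor (sxor (enc m) ?noise) (enc m) ! i = ?noise ! i"
      using i cm by (simp add: vxor_vxor_cancel)
  qed (simp add: cm)
  then have "concat (sxor (sxor (enc m) ?noise) (enc m)) = ?pad"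
    using concat_to_symbols[OF u(4)] by simp
  then have "residue1 sec (x, label x) (f1 s1 @ f2 s2) = False # vxor ?pad ?pad"
    unfolding residue1_def lab unfolding x by (simp add: key pad)
  then show ?thesis by (simp add: vxor_self)
qed

text \<open>The budget limits the errors in each of the four blocks. Both seeds therefore decode
  correctly, and a zero residue says that \<open>z\<close> has the right pad bits at the second seed
  and the right inner product at the first. Nothing else about \<open>z\<close> enters, so it may
  differ from the true model.\<close>

lemma classify_robust:
  assumes z: "True \<notin> set (residue1 sec (x, label x) z)"
    and x': "x' \<in> points sec" "real (point_dist x x') \<le> budget sec"
  shows "classify sec z x' = label x"
proof -
  obtain u1 u2 m where u: "u1 \<in> bits (r1 sec)" "u2 \<in> bits (r2 sec)" "m \<in> words (carrier (K sec)) (k sec)"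
    "length (nths (f2 s2) (samp2 sec u2)) = n sec * l sec"
    and x: "x = (ecc sec u1, ecc sec u2, m,
      sxor (enc m) (noise s2 u2))"
    by (rule set_pmf_point_distribution[OF s(2) x])
  define y where "y = sxor (enc m) (noise s2 u2)"
  let ?c = "enc m"
  have xp: "x = (ecc sec u1, ecc sec u2, m, y)" by (simp add: x y_def)
  have m: "set m \<subseteq> carrier (K sec)" "length m = k sec" using u(3) by (auto simp: words_iff)
  note cm = rs_encode_mem[OF m(1)]
  have y: "set y \<subseteq> carrier (K sec)" "length y = n sec"
    using support_points by (auto simp: xp points_iff words_iff)
  obtain c1 c2 m' y' where x'p: "x' = (c1, c2, m', y')" by (metis surj_pair)
  have c1: "c1 \<in> words (carrier (K sec)) (len sec (length u1))" and c2: "c2 \<in> words (carrier (K sec)) (len sec (length u2))"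
    and m': "length m' = k sec" and y': "set y' \<subseteq> carrier (K sec)" "length y' = n sec"
    using x'(1) u by (auto simp: x'p points_iff words_iff)
  have lens: "length (ecc sec u1) = length c1" "length (ecc sec u2) = length c2"
    using ecc[OF sec, of u1] ecc[OF sec, of u2] c1 c2 by (auto simp: words_iff)
  have "point_dist x x' = hamming (ecc sec u1) c1 + (hamming (ecc sec u2) c2 + (hamming m m' + hamming y y'))"
    using lens m m' by (simp add: point_dist_def xp x'p hamming_append)
  then have d: "real (hamming (ecc sec u1) c1) \<le> budget sec" "real (hamming (ecc sec u2) c2) \<le> budget sec"
    "real (hamming y y') \<le> budget sec"
    using x'(2) by auto
  have d1: "dec sec c1 = u1"
    using d(1) e[OF sec] hamming_commute[OF lens(1)] by (intro dec[OF sec c1]) linarith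
  have d2: "dec sec c2 = u2"
    using d(2) e[OF sec] hamming_commute[OF lens(2)] by (intro dec[OF sec c2]) linarith
  have key: "key_bits sec z c1 = key_bits sec z (ecc sec u1)" and pad: "pad_bits sec z c2 = pad_bits sec z (ecc sec u2)"
    by (simp_all add: key_bits_def pad_bits_def d1 d2 dec_ecc)
  let ?pad = "pad_bits sec z c2"
  have lab: "dot (concat m) (key_bits sec z c1) = label x" and "True \<notin> set (vxor ?pad (concat (sxor y ?c)))"
    using z by (auto simp: residue1_def xp key pad)
  moreover have yc: "set (sxor y ?c) \<subseteq> bits (l sec)" "length (sxor y ?c) = n sec"
    using F.set_sxor[OF y(1) cm(1)] y cm by (auto simp: F.carrier_eq)
  moreover have "length ?pad = n sec * l sec" by (simp add: pad_bits_def)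
  ultimately have "?pad = concat (sxor y ?c)"
  proof (intro nth_equalityI)
    fix i assume i: "i < length ?pad"
    then have "vxor ?pad (concat (sxor y ?c)) ! i \<in> set (vxor ?pad (concat (sxor y ?c)))"
      using length_concat_bits[OF yc(1)] yc(2) \<open>length ?pad = n sec * l sec\<close> by (intro nth_mem) simp
    then show "?pad ! i = concat (sxor y ?c) ! i"
      using i length_concat_bits[OF yc(1)] yc(2) \<open>length ?pad = n sec * l sec\<close>
        \<open>True \<notin> set (vxor ?pad (concat (sxor y ?c)))\<close> by (metis (full_types) nth_vxor)
  qed (use length_concat_bits[OF yc(1)] in simp)
  then have ts: "to_symbols (l sec) (n sec) ?pad = sxor y ?c" using to_symbols_concat[OF yc(1)] yc(2) by simp
  \<comment> \<open>The perturbed word minus the pad, written with the noise that the clean example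
    exposes.\<close>
  define y'' where "y'' = sxor y' (sxor y ?c)"
  have y'': "set y'' \<subseteq> carrier (K sec)" "length y'' = n sec"
    using F.set_sxor[OF y'(1) F.set_sxor[OF y(1) cm(1)]] y y' cm by (auto simp: y''_def)
  \<comment> \<open>Over characteristic two \<open>y''\<close> is \<open>?c\<close> plus the
    difference of \<open>y\<close> and \<open>y'\<close>, so its errors as a received word are
    exactly the perturbed symbols.\<close>
  have "hamming y'' ?c = hamming y y'"
  proof -
    have "y'' ! i = ?c ! i \<longleftrightarrow> y ! i = y' ! i" if "i < n sec" for i
    proof -
      have mem: "y ! i \<in> carrier (K sec)" "y' ! i \<in> carrier (K sec)" "?c ! i \<in> carrier (K sec)"
        using that y y' cm nth_mem[of i y] nth_mem[of i y'] nth_mem[of i ?c] by auto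
      have "y'' ! i = (y' ! i \<oplus>\<^bsub>K sec\<^esub> y ! i) \<oplus>\<^bsub>K sec\<^esub> ?c ! i"
        using that y y' cm mem by (simp add: y''_def F.add_eq F.a_assoc)
      then have "y'' ! i = ?c ! i \<longleftrightarrow> y' ! i \<oplus>\<^bsub>K sec\<^esub> y ! i = \<zero>\<^bsub>K sec\<^esub>"
        using mem by (metis F.a_closed F.add.l_cancel_one F.add.m_comm)
      then show ?thesis using mem F.add_eq_zero by auto
    qed
    then show ?thesis unfolding hamming_def using y'' y by (intro arg_cong[where f = card]) auto
  qed
  then have "real (2 * hamming y'' ?c + k sec) \<le> real (n sec)"
    using d(3) budget[OF sec] by simp
  then have "2 * hamming y'' ?c + k sec \<le> n sec" by (simp only: of_nat_le_iff)
  from F.rs_decode[OF m y'' pts' this]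
  have "rs_decode (K sec) (l sec) (pts sec) (k sec) y'' = concat m" .
  then show ?thesis using lab by (simp add: classify_def x'p ts m' y''_def)
qed

end

end

end

subsection \<open>Running times of training and inference\<close>

lemma polytime_nths [polytime_intros]:
  assumes "polytime_on A z" "polytime_on A ps"
  shows "polytime_on A (\<lambda>x. nths (z x) (set (ps x)))"
  unfolding nths_def by (intro polytime_intros assms polytime_comp[OF _ assms(2)]) auto

lemma polytime_dot [polytime_intros]:
  assumes "polytime_on A v" "polytime_on A w" shows "polytime_on A (\<lambda>x. dot (v x) (w x))"
proof -
  have "polytime_on A (\<lambda>x. fold (\<noteq>) (rev (map (\<lambda>p. fst p \<and> snd p) (zip (v x) (w x)))) False)"
  proof (rule polytime_fold[where I = "\<lambda>_. UNIV" and b = "\<lambda>_. 3"])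
    show "esize s \<le> 3" for s :: bool by (simp add: encode_bool_def)
  qed (intro polytime_intros assms size_bounded_intros UNIV_I)+
  then show ?thesis by (simp add: dot_def foldr_conv_fold case_prod_beta')
qed

lemma polytime_fit [polytime_intros]:
  assumes "polytime_on A m" "polytime_on A v" shows "polytime_on A (\<lambda>x. fit (m x) (v x))"
  unfolding fit_def by (intro polytime_intros assms)

context prg_learning
begin

context
  fixes A :: "'a::encodable set" and s :: "'a \<Rightarrow> nat"
  assumes s: "polytime_on A s" and sec: "\<And>x. x \<in> A \<Longrightarrow> sec0 \<le> s x"
begin

lemma polytime_pts: "polytime_on A (\<lambda>x. pts (s x))"
  using sec by (intro polytime_comp[OF s pts_time]) simp

text \<open>No program for \<open>n\<close> or \<open>l\<close> is given; both are read off the list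
  of evaluation points, \<open>n\<close> as its length and \<open>l\<close> as the length of its
  first symbol. For the latter, \<open>0 < n\<close> ensures that there is one.\<close>

lemma polytime_n: "polytime_on A (\<lambda>x. n (s x))"
proof -
  have "polytime_on A (\<lambda>x. length (pts (s x)))" by (intro polytime_intros polytime_pts)
  then show ?thesis using pts'(2) sec by (subst polytime_cong[of _ _ "\<lambda>x. length (pts (s x))"]) auto
qed

lemma polytime_l: "polytime_on A (\<lambda>x. l (s x))"
proof -
  have ne: "pts (s x) \<noteq> []" if "x \<in> A" for x
    using pts'(2)[OF sec[OF that]] n[OF sec[OF that]] by auto
  then have "polytime_on A (\<lambda>x. length (hd (pts (s x))))"
    by (intro polytime_intros polytime_hd polytime_pts)
  moreover have "l (s x) = length (hd (pts (s x)))" if "x \<in> A" for x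
    using pts'(1)[OF sec[OF that]] hd_in_set[OF ne[OF that]] mem_iff[OF sec[OF that]] by auto
  ultimately show ?thesis by (subst polytime_cong[of _ _ "\<lambda>x. length (hd (pts (s x)))"]) auto
qed

text \<open>The output length of a generator depends on the seed length alone, so running it on any
  seed of that length computes the parameter.\<close>

lemma polytime_\<alpha>: "polytime_on A (\<lambda>x. \<alpha> (s x))"
proof -
  have "polytime_on A (\<lambda>x. length (f1 (replicate (s x) False)))"
    by (intro polytime_intros polytime_comp[OF _ f_time(1)] s) auto
  then show ?thesis by (simp add: f)
qed

lemma polytime_\<beta>: "polytime_on A (\<lambda>x. \<beta> (s x))"
proof -
  have "polytime_on A (\<lambda>x. length (f2 (replicate (s x) False)))"
    by (intro polytime_intros polytime_comp[OF _ f_time(2)] s) auto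
  then show ?thesis by (simp add: f)
qed

lemma polytime_dec:
  assumes "polytime_on A w" "\<And>x. x \<in> A \<Longrightarrow> set (w x) \<subseteq> carrier (K (s x))"
  shows "polytime_on A (\<lambda>x. dec (s x) (w x))"
  using polytime_comp[OF polytime_pair[OF s assms(1)] dec_time] sec assms(2) by simp

lemma polytime_samp:
  assumes "polytime_on A u"
  shows "polytime_on A (\<lambda>x. sorted_list_of_set (samp1 (s x) (u x)))"
    and "polytime_on A (\<lambda>x. sorted_list_of_set (samp2 (s x) (u x)))"
  using polytime_comp[OF polytime_pair[OF s assms] samp_time(1)]
    polytime_comp[OF polytime_pair[OF s assms] samp_time(2)] sec by simp_all

lemma polytime_key_bits:
  assumes "polytime_on A z" "polytime_on A c" "\<And>x. x \<in> A \<Longrightarrow> set (c x) \<subseteq> carrier (K (s x))"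
  shows "polytime_on A (\<lambda>x. key_bits (s x) (z x) (c x))"
  unfolding key_bits_def
  by (intro polytime_intros polytime_samp polytime_dec polytime_\<alpha> assms)

lemma polytime_pad_bits:
  assumes "polytime_on A z" "polytime_on A c" "\<And>x. x \<in> A \<Longrightarrow> set (c x) \<subseteq> carrier (K (s x))"
  shows "polytime_on A (\<lambda>x. pad_bits (s x) (z x) (c x))"
  unfolding pad_bits_def
  by (intro polytime_intros polytime_samp polytime_dec polytime_\<alpha> polytime_n polytime_l assms)

lemma points_mem:
  assumes "x \<in> points sec"
  shows "set (fst x) \<subseteq> carrier (K sec)" "set (fst (snd x)) \<subseteq> carrier (K sec)"
    "set (fst (snd (snd x))) \<subseteq> carrier (K sec)" "set (snd (snd (snd x))) \<subseteq> carrier (K sec)"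
    "length (snd (snd (snd x))) = n sec"
  using assms by (cases x; simp add: points_iff words_iff)+

lemma polytime_classify:
  assumes z: "polytime_on A z" and p: "polytime_on A p" and dom: "\<And>x. x \<in> A \<Longrightarrow> p x \<in> points (s x)"
  shows "polytime_on A (\<lambda>x. classify (s x) (z x) (p x))"
proof -
  have mem: "set (sxor (snd (snd (snd (p x)))) (to_symbols (l (s x)) (n (s x)) (pad_bits (s x) (z x) (fst (snd (p x)))))) \<subseteq> carrier (K (s x))"
    if "x \<in> A" for x
    using points_mem[OF dom[OF that]] gf.set_sxor[OF gf[OF sec[OF that]]] gf.to_symbols_mem[OF gf[OF sec[OF that]]]
    by (simp add: pad_bits_def)
  show ?thesis unfolding classify_def case_prod_beta'
    by (intro polytime_intros polytime_rs_decode polytime_key_bits polytime_pad_bits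
        polytime_pts polytime_n polytime_l z p s points_mem dom conjI sec refl mem pts'(1))
qed

lemma polytime_residue1:
  assumes z: "polytime_on A z" and q: "polytime_on A q" and dom: "\<And>x. x \<in> A \<Longrightarrow> fst (q x) \<in> points (s x)"
  shows "polytime_on A (\<lambda>x. residue1 (s x) (q x) (z x))"
  unfolding residue1_def case_prod_beta'
  by (intro polytime_intros polytime_rs_encode[where L = "\<lambda>x. l (s x)"] polytime_key_bits polytime_pad_bits
      polytime_pts polytime_n polytime_l z q s points_mem dom conjI sec refl pts'(1))

end

lemma polytime_residue:
  assumes s: "polytime_on A s" and sec: "\<And>x. x \<in> A \<Longrightarrow> sec0 \<le> s x"
    and S: "polytime_on A S" and z: "polytime_on A z" and dom: "\<And>x. x \<in> A \<Longrightarrow> S x \<in> samples (problem (s x))"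
  shows "polytime_on A (\<lambda>x. residue (s x) (S x) (z x))"
proof -
  have mem: "p \<in> points (s x)" if "x \<in> A" "(p, b) \<in> set (S x)" for x p b
    using dom[OF that(1)] that(2) by (auto simp: samples_iff)
  show ?thesis unfolding residue_def
  by (intro polytime_intros polytime_residue1 S polytime_comp[OF _ s] polytime_comp[OF _ z])
    (use sec mem in auto)
qed

lemma polytime_fitted:
  assumes s: "polytime_on A s" and sec: "\<And>x. x \<in> A \<Longrightarrow> sec0 \<le> s x"
    and S: "polytime_on A S" and dom: "\<And>x. x \<in> A \<Longrightarrow> S x \<in> samples (problem (s x))"
  shows "polytime_on A (\<lambda>x. fitted (s x) (S x))"
  unfolding fitted_def
  by (intro polytime_affine_zero polytime_residue polytime_intros polytime_\<alpha> polytime_\<beta> s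
      polytime_comp[OF _ s] polytime_comp[OF _ S])
    (use sec dom in auto)

end

subsection \<open>Learners\<close>

lemma prob_pmf_mono:
  "(\<And>x. x \<in> set_pmf D \<Longrightarrow> x \<in> A \<Longrightarrow> x \<in> B) \<Longrightarrow> measure_pmf.prob D A \<le> measure_pmf.prob D B"
  by (intro measure_pmf.finite_measure_mono_AE AE_pmfI) auto

lemma card_bits: "finite (bits m)" "card (bits m) = 2 ^ m"
proof -
  have "bits m = {xs. set xs \<subseteq> UNIV \<and> length xs = m}" by auto
  then show "finite (bits m)" "card (bits m) = 2 ^ m"
    using finite_lists_length_eq[of "UNIV :: bool set" m] card_lists_length_eq[of "UNIV :: bool set" m] by auto
qed

context prg_learning
begin

definition consistent :: "nat \<Rightarrow> example list \<Rightarrow> bool list \<Rightarrow> bool" where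
  "consistent sec S z \<longleftrightarrow> (\<forall>q\<in>set S. True \<notin> set (residue1 sec q z))"

definition learner_of :: "(nat \<Rightarrow> example list \<Rightarrow> bool list) \<Rightarrow> (point, bool) learner" where
  "learner_of M = (\<lambda>S sec. return_pmf (restrict (classify sec (M sec S)) (points sec)))"

definition solves :: "(point, bool) learner \<Rightarrow> (nat \<Rightarrow> nat) \<Rightarrow> (nat \<Rightarrow> nat) \<Rightarrow> bool" where
  "solves L b T \<longleftrightarrow> is_learner sec0 problem L \<and> outputs_models_with_bits sec0 problem L b \<and>
     learns_with_sample_complexity sec0 point_dist budget problem L (\<lambda>sec. real (T sec))"

text \<open>Common analysis of both learners. Consistency is demanded only on samples that some pair
  of seeds explains; on the others the output merely has to stay within \<open>H\<close>, which
  keeps the count of models.\<close>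

theorem consistent_learner:
  assumes H: "\<And>sec. sec0 \<le> sec \<Longrightarrow> finite (H sec) \<and> card (H sec) \<le> 2 ^ b sec"
    and M: "\<And>sec S. sec0 \<le> sec \<Longrightarrow> S \<in> samples (problem sec) \<Longrightarrow> M sec S \<in> H sec"
    and cons: "\<And>sec S s1 s2. sec0 \<le> sec \<Longrightarrow> S \<in> samples (problem sec) \<Longrightarrow> s1 \<in> bits sec \<Longrightarrow> s2 \<in> bits sec \<Longrightarrow>
      consistent sec S (f1 s1 @ f2 s2) \<Longrightarrow> consistent sec S (M sec S)"
    and T: "\<And>sec. sec0 \<le> sec \<Longrightarrow> 0 < T sec \<and> b sec \<le> 2 * T sec"
  shows "solves (learner_of M) b T"
  unfolding solves_def
proof (intro conjI)
  show "is_learner sec0 problem (learner_of M)"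
    by (simp add: is_learner_def learner_of_def)
  show "outputs_models_with_bits sec0 problem (learner_of M) b"
    unfolding outputs_models_with_bits_def Let_def
  proof (intro allI impI)
    fix sec assume sec: "sec0 \<le> sec"
    let ?f = "\<lambda>z. restrict (classify sec z) (points sec)"
    let ?out = "\<Union>S\<in>samples (problem sec). set_pmf (learner_of M S sec)"
    have sub: "?out \<subseteq> ?f ` H sec" using M[OF sec] by (auto simp: learner_of_def)
    have "card ?out \<le> card (?f ` H sec)" using H[OF sec] by (intro card_mono sub) simp
    also have "\<dots> \<le> card (H sec)" using H[OF sec] by (intro card_image_le) simp
    also have "\<dots> \<le> 2 ^ b sec" using H[OF sec] by simp
    finally show "finite ?out \<and> card ?out \<le> 2 ^ b sec"
      using H[OF sec] finite_subset[OF sub] by simp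
  qed
  have main: "measure_pmf.expectation (trained (learner_of M) sec N h D) (\<lambda>f. risk h D f) \<le> \<epsilon> \<and>
      measure_pmf.expectation (trained (learner_of M) sec N h D)
        (\<lambda>f. robust_risk (points sec) point_dist (budget sec) h D f) \<le> \<epsilon>"
    if sec: "sec0 \<le> sec" and D: "D \<in> dists (problem sec)" and h: "h \<in> hyps (problem sec)"
      and N: "0 < N" "real (b sec) * ln 2 \<le> \<epsilon> * real N" for sec D h N \<epsilon>
  proof -
    obtain s1 s2 where s: "s1 \<in> bits sec" "s2 \<in> bits sec"
      and h: "h = point_label (ecc sec) (samp1 sec) (r1 sec) (f1 s1)"
      and D: "D = point_distribution (K sec) (pts sec) (ecc sec) (samp2 sec) (r1 sec) (r2 sec) (l sec) (k sec) (n sec) (f2 s2)"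
      using D h unfolding problem_def prg_problem_def by auto
    note sup = support_points[OF sec s] residue1_true_model[OF sec s] classify_robust[OF sec s]
    \<comment> \<open>Failure of any equation of the residue counts, those for the pad included;
      this event contains every clean point with a harmful perturbation.\<close>
    define bad where "bad z = {x. True \<in> set (residue1 sec (x, h x) z)}" for z
    let ?f = "\<lambda>z. restrict (classify sec z) (points sec)"
    have rob: "robust_risk (points sec) point_dist (budget sec) h D (?f z) \<le> measure_pmf.prob D (bad z)" for z
      unfolding robust_risk_def
    proof (rule prob_pmf_mono)
      fix x assume x: "x \<in> set_pmf D" "x \<in> {x. \<exists>x'\<in>points sec. real (point_dist x x') \<le> budget sec \<and> ?f z x' \<noteq> h x}"
      then show "x \<in> bad z" using sup(3)[of x z] by (auto simp: bad_def D h)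
    qed
    \<comment> \<open>The unperturbed point is itself within the budget, so the clean risk is the
      smaller one.\<close>
    have "risk h D (?f z) \<le> robust_risk (points sec) point_dist (budget sec) h D (?f z)" for z
      unfolding robust_risk_def risk_def
    proof (rule prob_pmf_mono)
      fix x assume x: "x \<in> set_pmf D" "x \<in> {x. h x \<noteq> ?f z x}"
      moreover have "point_dist x x = 0" by (cases x) (simp add: point_dist_def)
      moreover have "x \<in> points sec" using sup(1)[OF x(1)[unfolded D]] .
      ultimately show "x \<in> {x. \<exists>x'\<in>points sec. real (point_dist x x') \<le> budget sec \<and> ?f z x' \<noteq> h x}"
        using budget[OF sec] by force
    qed
    then have ris: "risk h D (?f z) \<le> measure_pmf.prob D (bad z)" for z using rob le_trans by (meson order_trans)
    define sel where "sel xs = M sec (map (\<lambda>x. (x, h x)) xs)" for xs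
    have sel: "sel xs \<in> H sec \<and> (\<forall>x\<in>set xs. x \<notin> bad (sel xs))" if xs: "set xs \<subseteq> set_pmf D" for xs
    proof -
      let ?S = "map (\<lambda>x. (x, h x)) xs"
      have S: "?S \<in> samples (problem sec)" using sup(1) xs by (auto simp: samples_iff D)
      have "consistent sec ?S (f1 s1 @ f2 s2)" using sup(2) xs by (auto simp: consistent_def D h)
      from cons[OF sec S s this] show ?thesis using M[OF sec S] by (simp add: sel_def consistent_def bad_def)
    qed
    have tr: "trained (learner_of M) sec N h D = map_pmf (\<lambda>xs. ?f (sel xs)) (replicate_pmf N D)"
      by (simp add: trained_def learner_of_def sel_def map_pmf_def)
    have "measure_pmf.expectation (replicate_pmf N D) (\<lambda>xs. measure_pmf.prob D (bad (sel xs)))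
        \<le> ln (real (card (H sec))) / real N"
      using H[OF sec] N(1) sel by (intro expected_risk_consistent) auto
    also have "\<dots> \<le> \<epsilon>"
    proof -
      have "sel [] \<in> H sec" using sel[of "[]"] by simp
      then have "0 < card (H sec)" using H[OF sec] card_gt_0_iff by blast
      moreover have "real (card (H sec)) \<le> 2 ^ b sec" using H[OF sec] by (metis of_nat_le_iff of_nat_numeral of_nat_power)
      ultimately have "ln (real (card (H sec))) \<le> ln (2 ^ b sec)" by simp
      also have "\<dots> = real (b sec) * ln 2" by (simp add: ln_realpow)
      finally show ?thesis using N by (simp add: field_simps)
    qed
    finally have bound: "measure_pmf.expectation (replicate_pmf N D) (\<lambda>xs. measure_pmf.prob D (bad (sel xs))) \<le> \<epsilon>" .
    have mono: "measure_pmf.expectation (trained (learner_of M) sec N h D) g \<le> \<epsilon>"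
      if "\<And>z. 0 \<le> g (?f z) \<and> g (?f z) \<le> measure_pmf.prob D (bad z)" for g :: "(point \<Rightarrow> bool) \<Rightarrow> real"
    proof -
      have "measure_pmf.expectation (trained (learner_of M) sec N h D) g
          = measure_pmf.expectation (replicate_pmf N D) (\<lambda>xs. g (?f (sel xs)))"
        by (simp add: tr)
      also have "\<dots> \<le> measure_pmf.expectation (replicate_pmf N D) (\<lambda>xs. measure_pmf.prob D (bad (sel xs)))"
      proof (rule integral_mono)
        have "\<bar>g (?f z)\<bar> \<le> 1" for z using that[of z] measure_pmf.prob_le_1[of D "bad z"] by linarith
        then show "integrable (replicate_pmf N D) (\<lambda>xs. g (?f (sel xs)))"
          by (intro integrable_pmf_bounded[of _ _ 1])
        show "integrable (replicate_pmf N D) (\<lambda>xs. measure_pmf.prob D (bad (sel xs)))"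
          by (intro integrable_pmf_bounded[of _ _ 1]) simp
      qed (use that in simp)
      finally show ?thesis using bound by simp
    qed
    show ?thesis
      using rob ris by (intro conjI mono) (simp_all add: risk_def robust_risk_def)
  qed
  show "learns_with_sample_complexity sec0 point_dist budget problem (learner_of M) (\<lambda>sec. real (T sec))"
    unfolding learns_with_sample_complexity_def
  \<comment> \<open>The sample size suffices because \<open>b * ln 2 \<le> b \<le> 2 * T\<close>.
    From \<open>T \<ge> 1\<close> and \<open>\<epsilon> < 1\<close> it follows that
    \<open>T / \<epsilon> \<ge> 1\<close>, so rounding up costs at most one more multiple, whence
    the upper constant 3.\<close>
  proof (rule exI[of _ "1::real"], rule exI[of _ "3::real"],
      rule exI[of _ "\<lambda>sec \<epsilon>. nat \<lceil>2 * real (T sec) / \<epsilon>\<rceil>"], intro conjI allI impI)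
    fix sec and \<epsilon> :: real assume sec: "sec0 \<le> sec" and \<epsilon>: "0 < \<epsilon> \<and> \<epsilon> < 1"
    define N where "N = nat \<lceil>2 * real (T sec) / \<epsilon>\<rceil>"
    have Tp: "1 \<le> real (T sec)" using T[OF sec] by simp
    have q: "1 \<le> real (T sec) / \<epsilon>" using Tp \<epsilon> by (simp add: field_simps)
    have N: "2 * (real (T sec) / \<epsilon>) \<le> real N" "real N \<le> 2 * (real (T sec) / \<epsilon>) + 1"
      unfolding N_def using q by (simp_all add: of_nat_ceiling)
    show "1 * (real (T sec) / \<epsilon>) \<le> real N" "real N \<le> 3 * (real (T sec) / \<epsilon>)"
      using N q by linarith+
    have "real (b sec) * ln 2 \<le> real (b sec) * 1"
      by (intro mult_left_mono) (use ln_2_less_1 in auto)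
    also have "\<dots> \<le> 2 * real (T sec)" using T[OF sec] by simp
    also have "\<dots> \<le> \<epsilon> * real N" using N(1) \<epsilon> by (simp add: field_simps)
    finally have b: "real (b sec) * ln 2 \<le> \<epsilon> * real N" .
    have "0 < N" using N(1) q by linarith
    note main = main[OF sec _ _ this b]
    show "eps_learns (learner_of M) (problem sec) sec N \<epsilon>"
      unfolding eps_learns_def using main by blast
    show "eps_robustly_learns point_dist (budget sec) (learner_of M) (problem sec) sec N \<epsilon>"
      unfolding eps_robustly_learns_def using main by simp
  qed simp_all
qed

text \<open>A sample that no pair of seeds explains gets an arbitrary pair, so that all outputs come
  from the same class.\<close>

definition exhaustive :: "nat \<Rightarrow> example list \<Rightarrow> bool list" where
  "exhaustive sec S = (let Z = {f1 s1 @ f2 s2 | s1 s2. s1 \<in> bits sec \<and> s2 \<in> bits sec} in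
     if \<exists>z\<in>Z. consistent sec S z then SOME z. z \<in> Z \<and> consistent sec S z else SOME z. z \<in> Z)"

theorem exhaustive_learner: "solves (learner_of exhaustive) (\<lambda>sec. 2 * sec) (\<lambda>sec. sec)"
proof -
  define Z where "Z sec = {f1 s1 @ f2 s2 | s1 s2. s1 \<in> bits sec \<and> s2 \<in> bits sec}" for sec
  have Zim: "Z sec = (\<lambda>(s1, s2). f1 s1 @ f2 s2) ` (bits sec \<times> bits sec)" for sec
    unfolding Z_def by (auto simp del: in_bits)
  have H: "finite (Z sec) \<and> card (Z sec) \<le> 2 ^ (2 * sec)" for sec
  proof -
    have "card (Z sec) \<le> card (bits sec \<times> bits sec)"
      unfolding Zim by (intro card_image_le finite_cartesian_product card_bits)
    then show ?thesis unfolding Zim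
      by (simp add: card_cartesian_product card_bits mult_2 power_add del: in_bits)
  qed
  have ex: "exhaustive sec S = (if \<exists>z\<in>Z sec. consistent sec S z then SOME z. z \<in> Z sec \<and> consistent sec S z else SOME z. z \<in> Z sec)"
    for sec S unfolding exhaustive_def Z_def Let_def by (rule refl)
  have M: "exhaustive sec S \<in> Z sec" for sec S
  proof (cases "\<exists>z\<in>Z sec. consistent sec S z")
    case True
    then have "\<exists>z. z \<in> Z sec \<and> consistent sec S z" by blast
    from someI_ex[OF this] show ?thesis using True by (simp add: ex)
  next
    case False
    have "\<exists>z. z \<in> Z sec" unfolding Z_def by (auto intro!: exI[of _ "replicate sec False"])
    from someI_ex[OF this] show ?thesis using False by (simp add: ex)
  qed
  have cons: "consistent sec S (exhaustive sec S)"
    if "s1 \<in> bits sec" "s2 \<in> bits sec" "consistent sec S (f1 s1 @ f2 s2)" for sec S s1 s2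
  proof -
    have "f1 s1 @ f2 s2 \<in> Z sec" using that unfolding Z_def by blast
    then have *: "\<exists>z\<in>Z sec. consistent sec S z" using that by blast
    then have "\<exists>z. z \<in> Z sec \<and> consistent sec S z" by blast
    from someI_ex[OF this] show ?thesis using * by (simp add: ex)
  qed
  have T: "0 < sec \<and> 2 * sec \<le> 2 * sec" if "sec0 \<le> sec" for sec using n[OF that] by simp
  from H M cons T show ?thesis by (intro consistent_learner[where H = Z]) blast+
qed

text \<open>The system has a solution because the true model is one, but the solution found need not
  consist of generator outputs. So the class is that of all bit strings of this length, at the price
  of a larger sample.\<close>

theorem linear_learner:
  assumes pos: "\<And>sec. sec0 \<le> sec \<Longrightarrow> 0 < \<alpha> sec"
  shows "solves (learner_of fitted) (\<lambda>sec. \<alpha> sec + \<beta> sec) (\<lambda>sec. \<alpha> sec + \<beta> sec)"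
proof -
  have H: "finite (bits (\<alpha> sec + \<beta> sec)) \<and> card (bits (\<alpha> sec + \<beta> sec)) \<le> 2 ^ (\<alpha> sec + \<beta> sec)" for sec
    by (simp add: card_bits del: in_bits)
  have M: "fitted sec S \<in> bits (\<alpha> sec + \<beta> sec)" if "sec0 \<le> sec" "S \<in> samples (problem sec)" for sec S
    using length_fitted[OF that] by simp
  have cons: "consistent sec S (fitted sec S)"
    if "sec0 \<le> sec" "S \<in> samples (problem sec)" "s1 \<in> bits sec" "s2 \<in> bits sec" "consistent sec S (f1 s1 @ f2 s2)"
    for sec S s1 s2
    using fitted[OF that(1,2), of "f1 s1 @ f2 s2"] that f by (simp add: consistent_def)
  have T: "0 < \<alpha> sec + \<beta> sec \<and> \<alpha> sec + \<beta> sec \<le> 2 * (\<alpha> sec + \<beta> sec)" if "sec0 \<le> sec" for sec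
    using pos[OF that] by simp
  from H M cons T show ?thesis
    by (rule consistent_learner[where H = "\<lambda>sec. bits (\<alpha> sec + \<beta> sec)"])
qed

section \<open>Polynomial time of the linear learner\<close>

text \<open>\<open>polytime_on\<close> measures time in the size of the encoded input,
  \<open>polytime_learner\<close> in the number of examples and the security parameter. A size bound
  for single points connects the two.\<close>

lemma size_bounded_points:
  obtains p :: "nat poly" where "\<And>sec x. sec0 \<le> sec \<Longrightarrow> x \<in> points sec \<Longrightarrow> esize x \<le> poly p sec"
proof -
  let ?B = "{sec. sec0 \<le> sec}"
  obtain q where q: "\<And>sec v. sec0 \<le> sec \<Longrightarrow> esize (ecc sec v) \<le> poly q (esize (sec, v))"
    using size_bounded_polytime[OF ecc_time] unfolding size_bounded_def by auto
  define c where "c r sec = poly q (2 + 2 * sec + Suc (r sec * 4))" for r :: "nat \<Rightarrow> nat" and sec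
  have cb: "size_bounded ?B (c r)" if "size_bounded ?B r" for r
  proof -
    have "size_bounded ?B (\<lambda>sec. sec)" by (rule size_bounded_mono[OF size_bounded_self]) simp
    then show ?thesis unfolding c_def by (intro size_bounded_intros that)
  qed
  \<comment> \<open>No bound on the code length is given. It is the length of an output of the
    polynomial-time encoder, here on the all-\<open>False\<close> seed.\<close>
  have len: "len sec (r sec) \<le> c r sec" if "sec0 \<le> sec" for r sec
  proof -
    let ?v = "replicate (r sec) False"
    have "len sec (r sec) \<le> esize (ecc sec ?v)"
      using ecc[OF that, of ?v] length_le_tsize[of "ecc sec ?v"] by (simp add: words_iff)
    also have "\<dots> \<le> poly q (esize (sec, ?v))" by (rule q[OF that])
    also have "\<dots> \<le> c r sec"
      unfolding c_def using tsize_encode_bits[of ?v "r sec"] by (intro poly_nat_mono) simp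
    finally show ?thesis .
  qed
  let ?l = "\<lambda>sec. esize (l sec)"
  let ?u = "\<lambda>m sec. Suc (m sec * Suc (Suc (?l sec * 4)))"
  let ?b = "\<lambda>sec. 3 + ?u (c r1) sec + ?u (c r2) sec + ?u (\<lambda>sec. sec) sec + ?u (\<lambda>sec. sec) sec"
  have "size_bounded ?B (\<lambda>sec. sec)" by (rule size_bounded_mono[OF size_bounded_self]) simp
  then have "size_bounded ?B ?b"
    by (intro size_bounded_intros cb bounded polytime_l polytime_id) simp_all
  then obtain p where p: "\<And>sec. sec0 \<le> sec \<Longrightarrow> ?b sec \<le> poly p (esize sec)"
    unfolding size_bounded_def by auto
  have w: "esize v \<le> ?u m sec"
    if "sec0 \<le> sec" "set v \<subseteq> carrier (K sec)" "length v \<le> m sec" for v m sec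
  proof -
    have "esize v \<le> Suc (length v * Suc (Suc (?l sec * 4)))"
    proof (rule tsize_encode_list_le)
      fix a assume "a \<in> set v"
      then have "length a = l sec" using that mem_iff by blast
      then show "esize a \<le> Suc (?l sec * 4)" by (intro tsize_encode_bits) simp
    qed
    also have "\<dots> \<le> ?u m sec" using that(3) by (intro Suc_le_mono[THEN iffD2] mult_right_mono) auto
    finally show ?thesis .
  qed
  \<comment> \<open>\<open>[:1, 2:]\<close> is the size of a security parameter in unary.\<close>
  have "esize x \<le> poly (pcompose p [:1, 2:]) sec" if "sec0 \<le> sec" "x \<in> points sec" for sec x
  proof -
    obtain c1 c2 m y where x: "x = (c1, c2, m, y)" by (metis surj_pair)
    have "esize c1 \<le> ?u (c r1) sec" "esize c2 \<le> ?u (c r2) sec"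
      "esize m \<le> ?u (\<lambda>sec. sec) sec" "esize y \<le> ?u (\<lambda>sec. sec) sec"
      using that(2) n[OF that(1)] len[OF that(1)] by (intro w[OF that(1)]; simp add: x points_iff words_iff)+
    then have "esize x \<le> ?b sec" unfolding x tsize_encode_pair by linarith
    also have "\<dots> \<le> poly p (esize sec)" by (rule p[OF that(1)])
    finally show ?thesis by (simp add: poly_pcompose mult.commute)
  qed
  then show ?thesis by (rule that)
qed

theorem polytime_linear_learner: "polytime_learner sec0 problem (learner_of fitted)"
proof -
  obtain pp where pp: "\<And>sec x. sec0 \<le> sec \<Longrightarrow> x \<in> points sec \<Longrightarrow> esize x \<le> poly pp sec"
    using size_bounded_points by blast
  \<comment> \<open>The learner is deterministic: the coin polynomial is 0, and the only coin string
    is empty.\<close>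
  let ?AT = "{(sec, S, \<omega> :: bool list). sec0 \<le> sec \<and> S \<in> samples (problem sec) \<and> \<omega> = []}"
  let ?AI = "{(sec, z, x). sec0 \<le> sec \<and> length z = \<alpha> sec + \<beta> sec \<and> x \<in> points sec}"
  have "polytime_on ?AT (\<lambda>a. fitted (fst a) (fst (snd a)))"
    by (intro polytime_fitted polytime_intros) auto
  then obtain train p1 where train: "\<And>sec S. sec0 \<le> sec \<Longrightarrow> S \<in> samples (problem sec) \<Longrightarrow>
      \<exists>t \<le> poly p1 (esize (sec, S, [] :: bool list)). runs train (encode (sec, S, [] :: bool list)) t (encode (fitted sec S))"
    unfolding polytime_on_def by fastforce
  have "polytime_on ?AI (\<lambda>a. classify (fst a) (fst (snd a)) (snd (snd a)))"
    by (intro polytime_classify polytime_intros) auto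
  then obtain infer p2 where infer: "\<And>sec z x. sec0 \<le> sec \<Longrightarrow> length z = \<alpha> sec + \<beta> sec \<Longrightarrow> x \<in> points sec \<Longrightarrow>
      \<exists>t \<le> poly p2 (esize (sec, z, x)). runs infer (encode (sec, z, x)) t (encode (classify sec z x))"
    unfolding polytime_on_def by fastforce
  obtain qa where qa: "\<And>sec. sec0 \<le> sec \<Longrightarrow> \<alpha> sec + \<beta> sec \<le> poly qa (esize sec)"
    using size_bounded_add[OF bounded(1,2)] unfolding size_bounded_def by auto
  \<comment> \<open>The constants count the pair nodes, the unary parameter and the empty coin list;
    4 in the inner sum is a label together with the pair node of an example.\<close>
  let ?gT = "\<lambda>m. poly p1 (4 + 2 * m + Suc (m * Suc (4 + poly pp m)))"
  let ?gI = "\<lambda>m. poly p2 (3 + 2 * m + Suc (poly qa (1 + 2 * m) * 4) + poly pp m)"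
  have "poly_bounded (\<lambda>m. ?gT m + ?gI m)" by (intro poly_bounded_intros)
  then obtain P where P: "\<And>m. ?gT m + ?gI m \<le> poly P m" unfolding poly_bounded_def by blast
  have main: "\<exists>(model :: bool list \<Rightarrow> bintree) (g :: bool list \<Rightarrow> point \<Rightarrow> bool).
      (\<forall>\<omega>\<in>bits (poly 0 size).
         (\<exists>t \<le> poly P size. runs train (encode (sec, S, \<omega>)) t (model \<omega>)) \<and>
         (\<forall>x\<in>points sec. \<exists>t \<le> poly P size. runs infer (encode (sec, model \<omega>, x)) t (encode (g \<omega> x)))) \<and>
      learner_of fitted S sec = map_pmf (\<lambda>\<omega>. restrict (g \<omega>) (points sec)) (unif (poly 0 size))"
    if sec: "sec0 \<le> sec" and S: "S \<in> samples (problem sec)" and size: "size = max 1 (length S) * sec"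
    for sec S size
  proof (intro exI[of _ "\<lambda>_. encode (fitted sec S)"] exI[of _ "\<lambda>_. classify sec (fitted sec S)"] conjI ballI)
    let ?z = "fitted sec S"
    have "1 \<le> sec" using n[OF sec] by simp
    \<comment> \<open>The parameter is positive, so \<open>size\<close> dominates the length of the
      sample; the maximum with 1 makes it dominate the parameter even for the empty sample.\<close>
    then have le: "sec \<le> size" "length S \<le> size"
      using mult_le_mono[of 1 "max 1 (length S)" sec sec] mult_le_mono[of "length S" "max 1 (length S)" 1 sec]
      by (simp_all add: size)
    have pS: "poly pp sec \<le> poly pp size" by (rule poly_nat_mono[OF le(1)])
    fix \<omega> :: "bool list" assume "\<omega> \<in> bits (poly 0 size)"
    then have \<omega>: "\<omega> = []" by simp
    have "esize S \<le> Suc (length S * Suc (4 + poly pp size))"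
    proof (rule tsize_encode_list_le)
      fix q assume "q \<in> set S"
      then have "esize (fst q) \<le> poly pp size"
        using S pp[OF sec, of "fst q"] pS by (force simp: samples_iff)
      moreover have "esize (snd q) \<le> 3" by (simp add: encode_bool_def)
      ultimately show "esize q \<le> 4 + poly pp size" by (cases q) simp
    qed
    also have "\<dots> \<le> Suc (size * Suc (4 + poly pp size))"
      using le(2) by (intro Suc_le_mono[THEN iffD2] mult_right_mono) auto
    finally have "esize (sec, S, [] :: bool list) \<le> 4 + 2 * size + Suc (size * Suc (4 + poly pp size))"
      using le(1) by simp
    then have "poly p1 (esize (sec, S, [] :: bool list)) \<le> ?gT size" by (rule poly_nat_mono)
    also have "\<dots> \<le> poly P size" using P[of size] by linarith
    finally show "\<exists>t \<le> poly P size. runs train (encode (sec, S, \<omega>)) t (encode ?z)"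
      unfolding \<omega> using train[OF sec S] le_trans by blast
    fix x assume x: "x \<in> points sec"
    have lz: "length ?z = \<alpha> sec + \<beta> sec" by (rule length_fitted[OF sec S])
    have "poly qa (esize sec) \<le> poly qa (1 + 2 * size)" using le(1) by (intro poly_nat_mono) simp
    then have "length ?z \<le> poly qa (1 + 2 * size)" using qa[OF sec] lz by linarith
    from tsize_encode_bits[OF this]
    have "esize (sec, ?z, x) \<le> 3 + 2 * size + Suc (poly qa (1 + 2 * size) * 4) + poly pp size"
      using le(1) pp[OF sec x] pS unfolding tsize_encode_pair tsize_encode_nat by linarith
    then have "poly p2 (esize (sec, ?z, x)) \<le> ?gI size" by (rule poly_nat_mono)
    also have "\<dots> \<le> poly P size" using P[of size] by linarith
    finally have "\<exists>t \<le> poly P size. runs infer (encode (sec, ?z, x)) t (encode (classify sec ?z x))"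
      using infer[OF sec lz x] le_trans by blast
    \<comment> \<open>Trees encode themselves, so the description \<open>encode ?z\<close> is passed
      to \<open>infer\<close> just as the bit string would be.\<close>
    then show "\<exists>t \<le> poly P size. runs infer (encode (sec, encode ?z, x)) t (encode (classify sec ?z x))"
      by (simp add: encode_prod_def encode_bintree_def)
  next
    show "learner_of fitted S sec = map_pmf (\<lambda>\<omega>. restrict (classify sec (fitted sec S)) (points sec)) (unif (poly 0 size))"
      by (simp add: learner_of_def)
  qed
  show ?thesis unfolding polytime_learner_def Let_def problem_simps
  proof (rule exI[of _ train], rule exI[of _ infer], rule exI[of _ P], rule exI[of _ 0], intro allI impI ballI)
  qed (rule main[OF _ _ refl])
qed

end

section \<open>From the asymptotic hypotheses to the setting\<close>

text \<open>The finitely many values up to the threshold are absorbed into their sum as a constant;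
  real exponent and factor are replaced by the rounded-up absolute values.\<close>

lemma size_bounded_powr:
  assumes "\<forall>\<^sub>F sec in sequentially. real (g sec) \<le> C * real sec powr b"
  shows "size_bounded A g"
proof -
  obtain m where m: "\<And>sec. m \<le> sec \<Longrightarrow> real (g sec) \<le> C * real sec powr b"
    using assms by (auto simp: eventually_sequentially)
  define d where "d = nat \<lceil>\<bar>b\<bar>\<rceil>"
  define c where "c = nat \<lceil>\<bar>C\<bar>\<rceil>"
  have le: "g sec \<le> (\<Sum>i\<le>m. g i) + c * sec ^ d" for sec
  proof (cases "sec \<le> m")
    case True
    then have "g sec \<le> (\<Sum>i\<le>m. g i)" by (intro member_le_sum) auto
    then show ?thesis by simp
  next
    case False
    then have s: "1 \<le> real sec" "m \<le> sec" by auto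
    have d: "b \<le> real d" unfolding d_def by linarith
    have "real (g sec) \<le> C * real sec powr b" by (rule m[OF s(2)])
    also have "\<dots> \<le> \<bar>C\<bar> * real sec powr real d"
      using s(1) d by (intro mult_mono powr_mono) auto
    also have "\<dots> \<le> real c * real sec ^ d"
      using s(1) by (intro mult_mono) (auto simp: c_def powr_realpow)
    finally have "real (g sec) \<le> real (c * sec ^ d)" by simp
    then show ?thesis by (simp only: of_nat_le_iff trans_le_add2)
  qed
  show ?thesis
  proof (rule size_boundedI[where f = "\<lambda>x. (\<Sum>i\<le>m. g i) + c * x ^ d"])
    fix sec
    have "sec ^ d \<le> esize sec ^ d" by (intro power_mono) auto
    then show "g sec \<le> (\<Sum>i\<le>m. g i) + c * esize sec ^ d"
      using le[of sec] by (meson add_left_mono le_trans mult_le_mono2)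
  qed (intro poly_bounded_intros)
qed

theorem theorem20:
  fixes sec0 :: nat
    and n k l \<alpha> \<beta> r1 r2 :: "nat \<Rightarrow> nat"
    and R \<kappa>2 :: real and \<kappa>1 :: "nat \<Rightarrow> real"
    and K :: "nat \<Rightarrow> symbol ring" and pts :: "nat \<Rightarrow> symbol list"
    and f1 f2 :: "bool list \<Rightarrow> bool list"
    and samp1 samp2 :: "nat \<Rightarrow> bool list \<Rightarrow> nat set"
    and len :: "nat \<Rightarrow> nat \<Rightarrow> nat" and ecc :: "nat \<Rightarrow> bool list \<Rightarrow> symbol list"
    and budget :: "nat \<Rightarrow> real" and F :: "nat \<Rightarrow> (point, bool) learning_problem"
  assumes ordered: "\<And>sec. sec0 \<le> sec \<Longrightarrow> n sec < sec \<and> sec < \<alpha> sec \<and> \<alpha> sec < \<beta> sec"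
    and poly_related: "\<exists>a>0. \<exists>b>0. \<forall>sec\<ge>sec0.
          real sec powr a \<le> real (n sec) \<and> real (\<beta> sec) \<le> real sec powr b"
    and symbol_length: "(\<lambda>sec. real (l sec)) \<in> \<Theta>(\<lambda>sec. ln (real sec))"
    and rate: "0 < R" "R < 1 / 3" "\<And>sec. sec0 \<le> sec \<Longrightarrow> real (k sec) / real (n sec) = R"
    and field: "efficient_binary_fields sec0 l K"
    and points: "evaluation_points sec0 K n pts"
    and prgs: "prg f1 \<alpha>" "prg f2 \<beta>"
    and kappa1: "\<kappa>1 \<in> \<Theta>(\<lambda>sec. 1 / ln (real sec))"
    and samplers:
      "sampler sec0 \<kappa>1 \<kappa>2 \<alpha> (\<lambda>sec. k sec * l sec) r1 samp1"
      "sampler sec0 \<kappa>1 \<kappa>2 \<beta> (\<lambda>sec. n sec * l sec) r2 samp2"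
    and budget: "budget = (\<lambda>sec. (1 - R) * real (n sec) / 2)"
    and code: "efficient_ecc sec0 K budget len ecc"
    and problem: "F = prg_problem K pts len ecc f1 f2 samp1 samp2 r1 r2 l k n"
  shows
    "(\<exists>L. is_learner sec0 F L \<and>
        outputs_models_with_bits sec0 F L (\<lambda>sec. 2 * sec) \<and>
        learns_with_sample_complexity sec0 point_dist budget F L (\<lambda>sec. real sec)) \<and>
     (\<exists>L. is_learner sec0 F L \<and>
        polytime_learner sec0 F L \<and>
        outputs_models_with_bits sec0 F L (\<lambda>sec. \<alpha> sec + \<beta> sec) \<and>
        learns_with_sample_complexity sec0 point_dist budget F L (\<lambda>sec. real (\<alpha> sec + \<beta> sec)))"
proof -
  obtain dec :: "nat \<Rightarrow> symbol list \<Rightarrow> bool list" and e :: "nat \<Rightarrow> nat"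
    where dec_time: "polytime_on {(sec, w). sec0 \<le> sec \<and> set w \<subseteq> carrier (K sec)} (\<lambda>(sec, w). dec sec w)"
      and dec: "\<forall>sec\<ge>sec0. budget sec < real (e sec) \<and> (\<forall>v. \<forall>w\<in>words (carrier (K sec)) (len sec (length v)).
              hamming w (ecc sec v) \<le> e sec \<longrightarrow> dec sec w = v)"
    using code unfolding efficient_ecc_def by blast
  obtain a b where ab: "\<forall>sec\<ge>sec0. real sec powr a \<le> real (n sec) \<and> real (\<beta> sec) \<le> real sec powr b"
    using poly_related by blast
  \<comment> \<open>Division by zero yields zero, so the positive rate excludes
    \<open>n sec = 0\<close>.\<close>
  have R: "real (k sec) = R * real (n sec)" "0 < n sec" if "sec0 \<le> sec" for sec
  proof -
    show "0 < n sec" using rate(1) rate(3)[OF that] by (cases "n sec = 0") auto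
    then show "real (k sec) = R * real (n sec)" using rate(3)[OF that] by (simp add: field_simps)
  qed
  have ev\<beta>: "\<forall>\<^sub>F sec in sequentially. real (\<beta> sec) \<le> 1 * real sec powr b"
    using ab by (auto simp: eventually_sequentially)
  have ev\<alpha>: "\<forall>\<^sub>F sec in sequentially. real (\<alpha> sec) \<le> 1 * real sec powr b"
    using eventually_ge_at_top[of sec0] ev\<beta>
  proof eventually_elim
    case (elim sec)
    then show ?case using ordered[of sec] by linarith
  qed
  \<comment> \<open>As \<open>\<kappa>2 < 1\<close> and source lengths are positive integers,
    \<open>M powr \<kappa>2 \<le> M\<close>; so a seed length inherits the polynomial bound of its
    source length.\<close>
  have seeds: "size_bounded A r"
    if r: "(\<lambda>sec. real (r sec)) \<in> \<Theta>(\<lambda>sec. real (M sec) powr \<kappa>2)" and \<kappa>2: "\<kappa>2 < 1"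
      and M: "\<forall>\<^sub>F sec in sequentially. real (M sec) \<le> 1 * real sec powr b" "\<And>sec. sec0 \<le> sec \<Longrightarrow> 0 < M sec"
    for A :: "nat set" and r M :: "nat \<Rightarrow> nat"
  proof -
    obtain c where c: "0 < c" "\<forall>\<^sub>F sec in sequentially. norm (real (r sec)) \<le> c * norm (real (M sec) powr \<kappa>2)"
      using landau_o.bigE[OF bigthetaD1[OF r]] by blast
    have "\<forall>\<^sub>F sec in sequentially. real (r sec) \<le> c * real sec powr b"
      using c(2) M(1) eventually_ge_at_top[of sec0]
    proof eventually_elim
      case (elim sec)
      have "real (M sec) powr \<kappa>2 \<le> real (M sec) powr 1"
        using M(2)[OF elim(3)] \<kappa>2 by (intro powr_mono) auto
      then have "real (M sec) powr \<kappa>2 \<le> real sec powr b" using elim(2) by simp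
      then have "c * real (M sec) powr \<kappa>2 \<le> c * real sec powr b" using c(1) by simp
      then show ?case using elim(1) by simp
    qed
    then show ?thesis by (rule size_bounded_powr)
  qed
  interpret prg_learning sec0 l K n k \<alpha> \<beta> r1 r2 budget pts f1 f2 samp1 samp2 len ecc dec e
  proof
    fix sec assume sec: "sec0 \<le> sec"
    have Rn: "R * real (n sec) \<le> 1 * real (n sec)" using rate(2) by (intro mult_right_mono) auto
    have "real (k sec) \<le> real (n sec)" using Rn R(1)[OF sec] by simp
    then have "k sec \<le> n sec" by (simp only: of_nat_le_iff)
    then show "0 < n sec \<and> k sec \<le> n sec \<and> n sec < sec" using R(2)[OF sec] ordered[OF sec] by simp
    \<comment> \<open>With \<open>k = R * n\<close> the decoding condition holds with
      equality.\<close>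
    show "0 \<le> budget sec \<and> 2 * budget sec + real (k sec) \<le> real (n sec)"
      using Rn R(1)[OF sec] by (simp add: budget field_simps)
  next
    show "length (f1 s) = \<alpha> (length s)" "length (f2 s) = \<beta> (length s)" for s
      using prgs by (auto simp: prg_def)
    show "polytime_on UNIV f1" "polytime_on UNIV f2" using prgs by (auto simp: prg_def)
    show "size_bounded {sec. sec0 \<le> sec} \<alpha>" "size_bounded {sec. sec0 \<le> sec} \<beta>"
      by (rule size_bounded_powr[OF ev\<alpha>] size_bounded_powr[OF ev\<beta>])+
    show "size_bounded {sec. sec0 \<le> sec} r1" "size_bounded {sec. sec0 \<le> sec} r2"
      using samplers ordered by (auto simp: sampler_def intro!: seeds ev\<alpha> ev\<beta> intro: gr_zeroI)
        (metis less_trans not_less_zero neq0_conv)+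
  qed (use field points samplers code dec dec_time in
      \<open>auto simp: evaluation_points_def sampler_def efficient_ecc_def\<close>)
  have F: "F = local.problem"
    unfolding problem problem_def ..
  have "0 < \<alpha> sec" if "sec0 \<le> sec" for sec using ordered[OF that] by simp
  from exhaustive_learner linear_learner[OF this] polytime_linear_learner show ?thesis
    unfolding F solves_def by blast
qed

end
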